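(* Let $(X,d)$ be a hyperbolic metric space, $o\in X$, $b>1$ a parameter admitting a visual metric $D=D_{b,o}$ on $\partial X$, and let $G\le\mathrm{Isom}(X)$ be a strongly discrete group of general type. Fix $\xi\in\partial X$. Let $\delta$ be the Poincaré exponent of $G$, and suppose that $\mu$ is an ergodic $\delta$-quasiconformal probability measure on the limit set $\Lambda$ of $G$ satisfying $\mu(\{\xi\})=0$. Let $\Delta_{\mu,\xi}(r)=\mu(B(\xi,r))$. Let $\Phi:[0,\infty)\to(0,\infty)$ be a function such that $t\mapsto t\Phi(t)$ is nonincreasing. Then: (i) If the series $$\sum_{g\in G}b^{-\delta d(o,g(o))}\,\Delta_{\mu,\xi}\big(b^{d(o,g(o))}\,\Phi(Kb^{d(o,g(o))})\big)$$ diverges for all $K>0$, then $\mu(\mathrm{WA}_{\Phi,\xi})=1$. (iiA) If the series $$\sum_{g\in G}(g'(\xi))^\delta\,\Delta_{\mu,\xi}\big(\Phi(Kb^{d(o,g(o))})/g'(\xi)\big)$$ converges for some $K>0$, then $\mu(\mathrm{WA}_{\Phi,\xi})=0$. (iiB) If $\xi$ is a bounded parabolic point of $G$, and if the series in (i) converges for some $K>0$, then $\mu(\mathrm{WA}_{\Phi,\xi})=0$.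
   Context: For a metric space $(X,d)$ let $\langle x|y\rangle_z=\frac12[d(x,z)+d(y,z)-d(x,y)]$. $(X,d)$ is (Gromov) hyperbolic if there is $C\ge 0$ with $\langle x|z\rangle_w\ge\min(\langle x|y\rangle_w,\langle y|z\rangle_w)-C$ for all $x,y,z,w\in X$ ($X$ need not be proper or geodesic). Fix a basepoint $o\in X$. A sequence $(x_n)$ in $X$ is a Gromov sequence if $\langle x_n|x_m\rangle_o\to\infty$ as $n,m\to\infty$; two Gromov sequences are equivalent if $\langle x_n|y_n\rangle_o\to\infty$; the Gromov boundary $\partial X$ is the set of equivalence classes, and isometries of $X$ act on it. For $\xi,\eta\in\partial X$ and $y,z\in X$: $\langle\xi|\eta\rangle_z=\inf\{\liminf_{n,m\to\infty}\langle x_n|y_m\rangle_z:(x_n)\in\xi,(y_m)\in\eta\}$, $\langle\xi|y\rangle_z=\langle y|\xi\rangle_z=\inf\{\liminf_{n\to\infty}\langle x_n|y\rangle_z:(x_n)\in\xi\}$, and the Busemann function is $\mathcal B_\xi(y,z)=\langle z|\xi\rangle_y-\langle y|\xi\rangle_z$. The bordification $X\cup\partial X$ is topologized so that $S$ is open iff $S\cap X$ is open and for each $\xi\in S\cap\partial X$ there is $t>0$ with $\{y\in X\cup\partial X:\langle y|\xi\rangle_o>t\}\subset S$; thus $x_n\to\xi\in\partial X$ iff $\langle x_n|\xi\rangle_o\to\infty$. The parameter $b>1$ is close enough to $1$ that there is a complete metric $D=D_{b,o}$ on $\partial X$ (a visual metric) with $C^{-1}b^{-\langle\xi|\eta\rangle_o}\le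 D(\xi,\eta)\le Cb^{-\langle\xi|\eta\rangle_o}$ for some constant $C\geq 1$; such a $D$ is fixed and $B(\xi,r)$ denotes the closed ball in $(\partial X,D)$. $G\le\mathrm{Isom}(X)$ is strongly discrete if $\{g\in G:d(o,g(o))\le r\}$ is finite for every $r>0$. An isometry $g$ is loxodromic if it has two fixed points $g_+,g_-\in\partial X$ such that for every neighborhood $U$ of $g_-$ the iterates $g^n$ converge to $g_+$ uniformly on $\partial X\setminus U$, and $g^{-1}$ has the same property (with $g_+$ and $g_-$ exchanged). $G$ is of general type if it contains two loxodromic isometries with disjoint fixed-point sets in $\partial X$. $\delta=\inf\{s\ge0:\sum_{g\in G}b^{-s\,d(o,g(o))}<\infty\}$ is the Poincaré exponent. The limit set is $\Lambda=\{\eta\in\partial X:g_n(o)\to\eta\text{ for some sequence }(g_n)\text{ in }G\}$. For $g\in\mathrm{Isom}(X)$ and $\eta\in\partial X$, $g'(\eta)=b^{\mathcal B_\eta(o,g^{-1}(o))}$. Measures are finite and Borel. A measure $\mu$ on $\partial X$ is $s$-quasiconformal if there is $C\ge1$ with $C^{-1}\int_A(g')^s\,d\mu\le\mu(g(A))\le C\int_A(g')^s\,d\mu$ for all $g\in G$ and Borel $A\subset\partial X$; it is ergodic if for every $G$-invariant $A\subset\partial X$, $\mu(A)=0$ or $\mu(\partial X\setminus A)=0$. $\mathrm{WA}_{\Phi,\xi}$ is the set of $\eta\in\Lambda$ such that for every $K>0$ there exists $g\in G$ with $D(g(\xi),\eta)\le\Phi(Kb^{d(o,g(o))})$. With $G_\xi$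 the stabilizer of $\xi$ in $G$, $\xi$ is a parabolic fixed point of $G$ if $G_\xi(o)$ is unbounded and there is $C\ge1$ with $C^{-1}\le g'(\xi)\le C$ for all $g\in G_\xi$. It is a bounded parabolic point if moreover there is $S\subset(X\cup\partial X)\setminus\{\xi\}$ with $\xi\notin\overline S$ and $G(o)\subset\bigcup_{h\in G_\xi}h(S)$.
   Formalization: The condition that tΦ(t) is nonincreasing is required only for t>0: on all of [0,∞) it contradicts Φ>0, since the value at t=0 is 0; the theorem uses Φ only at positive arguments. *)

theory Defs
  imports "HOL-Probability.Probability_Measure" "HOL-Algebra.Group"
begin

section \<open>Gromov hyperbolic spaces and their boundary\<close>

text \<open>The space \<open>X\<close> is the whole type \<open>'a\<close>. In all functions below the base point of a
  Gromov product is the first argument, so \<open>gromov_product z x y\<close> is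
  \<open>\<langle>x|y\<rangle>\<close> seen from \<open>z\<close>.\<close>

definition gromov_product :: "'a::metric_space \<Rightarrow> 'a \<Rightarrow> 'a \<Rightarrow> real" where
  "gromov_product z x y = (dist x z + dist y z - dist x y) / 2"

definition gromov_hyperbolic_on :: "'a::metric_space set \<Rightarrow> bool" where
  "gromov_hyperbolic_on X \<longleftrightarrow>
     (\<exists>C\<ge>0. \<forall>x\<in>X. \<forall>y\<in>X. \<forall>z\<in>X. \<forall>w\<in>X.
        gromov_product w x z \<ge> min (gromov_product w x y) (gromov_product w y z) - C)"

definition gromov_sequence :: "'a::metric_space \<Rightarrow> (nat \<Rightarrow> 'a) \<Rightarrow> bool" where
  "gromov_sequence p x \<longleftrightarrow>
     filterlim (\<lambda>(n, m). gromov_product p (x n) (x m)) at_top (sequentially \<times>\<^sub>F sequentially)"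

definition gromov_equiv :: "'a::metric_space \<Rightarrow> ((nat \<Rightarrow> 'a) \<times> (nat \<Rightarrow> 'a)) set" where
  "gromov_equiv p = {(x, y). gromov_sequence p x \<and> gromov_sequence p y \<and>
     filterlim (\<lambda>n. gromov_product p (x n) (y n)) at_top sequentially}"

definition gromov_boundary :: "'a::metric_space \<Rightarrow> (nat \<Rightarrow> 'a) set set" where
  "gromov_boundary p = Collect (gromov_sequence p) // gromov_equiv p"

text \<open>Points of the bordification are \<open>Inl x\<close> with \<open>x\<close> in the space and \<open>Inr \<xi>\<close> with
  \<open>\<xi>\<close> in the boundary. The product of a boundary point with itself is infinite, hence the
  values in \<^typ>\<open>ereal\<close>.\<close>

definition bordification :: "'a::metric_space \<Rightarrow> ('a + (nat \<Rightarrow> 'a) set) set" where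
  "bordification p = range Inl \<union> Inr ` gromov_boundary p"

fun ext_gromov_product ::
  "'a::metric_space \<Rightarrow> 'a + (nat \<Rightarrow> 'a) set \<Rightarrow> 'a + (nat \<Rightarrow> 'a) set \<Rightarrow> ereal" where
  "ext_gromov_product z (Inl x) (Inl y) = ereal (gromov_product z x y)"
| "ext_gromov_product z (Inr \<xi>) (Inl y) =
     (INF x\<in>\<xi>. liminf (\<lambda>n. ereal (gromov_product z (x n) y)))"
| "ext_gromov_product z (Inl y) (Inr \<xi>) =
     (INF x\<in>\<xi>. liminf (\<lambda>n. ereal (gromov_product z (x n) y)))"
| "ext_gromov_product z (Inr \<xi>) (Inr \<eta>) =
     (INF (x, y)\<in>\<xi> \<times> \<eta>. Liminf (sequentially \<times>\<^sub>F sequentially)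
        (\<lambda>(n, m). ereal (gromov_product z (x n) (y m))))"

text \<open>Both products lie between \<open>0\<close> and \<open>dist y z\<close>, so the conversion to
  \<^typ>\<open>real\<close> loses nothing.\<close>

definition busemann :: "(nat \<Rightarrow> 'a::metric_space) set \<Rightarrow> 'a \<Rightarrow> 'a \<Rightarrow> real" where
  "busemann \<xi> y z = real_of_ereal (ext_gromov_product y (Inl z) (Inr \<xi>))
                   - real_of_ereal (ext_gromov_product z (Inl y) (Inr \<xi>))"

definition bordification_open ::
  "'a::metric_space \<Rightarrow> ('a + (nat \<Rightarrow> 'a) set) set \<Rightarrow> bool" where
  "bordification_open p S \<longleftrightarrow> S \<subseteq> bordification p \<and> open {x. Inl x \<in> S} \<and>
     (\<forall>\<xi>. Inr \<xi> \<in> S \<longrightarrow>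
        (\<exists>t>0. {y \<in> bordification p. ext_gromov_product p y (Inr \<xi>) > ereal t} \<subseteq> S))"

definition bordification_topology :: "'a::metric_space \<Rightarrow> ('a + (nat \<Rightarrow> 'a) set) topology" where
  "bordification_topology p = topology (bordification_open p)"

lemma openin_bordification_topology:
  "openin (bordification_topology p) S \<longleftrightarrow> bordification_open p S"
proof -
  have "bordification_open p (S \<inter> T)"
    if S: "bordification_open p S" and T: "bordification_open p T" for S T
    unfolding bordification_open_def
  proof (intro conjI allI impI)
    show "S \<inter> T \<subseteq> bordification p" using S by (auto simp: bordification_open_def)
    have "{x. Inl x \<in> S \<inter> T} = {x. Inl x \<in> S} \<inter> {x. Inl x \<in> T}" by auto
    then show "open {x. Inl x \<in> S \<inter> T}"
      using S T by (simp add: bordification_open_def open_Int)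
  next
    fix \<xi> assume "Inr \<xi> \<in> S \<inter> T"
    then obtain s t where "s > 0" "t > 0"
      and s: "{y \<in> bordification p. ext_gromov_product p y (Inr \<xi>) > ereal s} \<subseteq> S"
      and t: "{y \<in> bordification p. ext_gromov_product p y (Inr \<xi>) > ereal t} \<subseteq> T"
      using S T unfolding bordification_open_def by blast
    have "{y \<in> bordification p. ext_gromov_product p y (Inr \<xi>) > ereal (max s t)} \<subseteq> S \<inter> T"
    proof -
      have "ereal s \<le> ereal (max s t)" "ereal t \<le> ereal (max s t)" by simp_all
      then show ?thesis using s t by (blast intro: order.strict_trans1)
    qed
    then show "\<exists>t>0. {y \<in> bordification p. ext_gromov_product p y (Inr \<xi>) > ereal t} \<subseteq> S \<inter> T"
      using \<open>s > 0\<close> by (intro exI[of _ "max s t"]) auto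
  qed
  moreover have "bordification_open p (\<Union>\<K>)" if \<K>: "\<forall>K\<in>\<K>. bordification_open p K" for \<K>
    unfolding bordification_open_def
  proof (intro conjI allI impI)
    show "\<Union>\<K> \<subseteq> bordification p" using \<K> by (auto simp: bordification_open_def)
    have "{x. Inl x \<in> \<Union>\<K>} = (\<Union>K\<in>\<K>. {x. Inl x \<in> K})" by auto
    then show "open {x. Inl x \<in> \<Union>\<K>}"
      using \<K> by (auto simp: bordification_open_def intro!: open_UN)
  next
    fix \<xi> assume "Inr \<xi> \<in> \<Union>\<K>"
    then obtain K where K: "K \<in> \<K>" "Inr \<xi> \<in> K" by auto
    then obtain t where "t > 0"
      "{y \<in> bordification p. ext_gromov_product p y (Inr \<xi>) > ereal t} \<subseteq> K"
      using \<K> unfolding bordification_open_def by blast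
    then show "\<exists>t>0. {y \<in> bordification p. ext_gromov_product p y (Inr \<xi>) > ereal t} \<subseteq> \<Union>\<K>"
      using K by (intro exI[of _ t]) auto
  qed
  ultimately have "istopology (bordification_open p)"
    unfolding istopology_def by blast
  then show ?thesis by (simp add: bordification_topology_def)
qed

section \<open>Visual metrics\<close>

text \<open>\<open>b\<close> to the power \<open>-t\<close>, where \<open>t\<close> may be infinite.\<close>

definition ext_powr_minus :: "real \<Rightarrow> ereal \<Rightarrow> real" where
  "ext_powr_minus b t = (if t = \<infinity> then 0 else b powr (- real_of_ereal t))"

definition visual_metric ::
  "real \<Rightarrow> 'a::metric_space \<Rightarrow> ((nat \<Rightarrow> 'a) set \<Rightarrow> (nat \<Rightarrow> 'a) set \<Rightarrow> real) \<Rightarrow> bool" where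
  "visual_metric b p D \<longleftrightarrow>
     Metric_space (gromov_boundary p) D \<and>
     Metric_space.mcomplete (gromov_boundary p) D \<and>
     (\<exists>C\<ge>1. \<forall>\<xi>\<in>gromov_boundary p. \<forall>\<eta>\<in>gromov_boundary p.
        ext_powr_minus b (ext_gromov_product p (Inr \<xi>) (Inr \<eta>)) / C \<le> D \<xi> \<eta> \<and>
        D \<xi> \<eta> \<le> C * ext_powr_minus b (ext_gromov_product p (Inr \<xi>) (Inr \<eta>)))"

definition boundary_borel ::
  "'a::metric_space \<Rightarrow> ((nat \<Rightarrow> 'a) set \<Rightarrow> (nat \<Rightarrow> 'a) set \<Rightarrow> real) \<Rightarrow> (nat \<Rightarrow> 'a) set measure" where
  "boundary_borel p D =
     sigma (gromov_boundary p) {U. openin (Metric_space.mtopology (gromov_boundary p) D) U}"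

section \<open>Groups of isometries\<close>

definition isometry_group :: "('a::metric_space \<Rightarrow> 'a) monoid" where
  "isometry_group = \<lparr>carrier = {g. bij g \<and> (\<forall>x y. dist (g x) (g y) = dist x y)},
                     monoid.mult = (\<circ>), one = id\<rparr>"

lemma group_isometry_group: "group isometry_group"
proof (rule groupI)
  fix g :: "'a \<Rightarrow> 'a" assume g: "g \<in> carrier isometry_group"
  then have "bij g" by (simp add: isometry_group_def)
  have "dist (inv_into UNIV g x) (inv_into UNIV g y) = dist x y" for x y
  proof -
    have "dist (g u) (g v) = dist u v" for u v using g by (simp add: isometry_group_def)
    from this[of "inv_into UNIV g x" "inv_into UNIV g y"] show ?thesis
      using \<open>bij g\<close> by (simp add: bij_is_surj surj_f_inv_f)
  qed
  then have "inv_into UNIV g \<in> carrier isometry_group"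
    using \<open>bij g\<close> by (simp add: isometry_group_def bij_imp_bij_inv)
  moreover have "inv_into UNIV g \<circ> g = id" using \<open>bij g\<close> by (simp add: bij_is_inj)
  ultimately show "\<exists>h\<in>carrier isometry_group. h \<otimes>\<^bsub>isometry_group\<^esub> g = \<one>\<^bsub>isometry_group\<^esub>"
    by (intro bexI[of _ "inv_into UNIV g"]) (simp_all add: isometry_group_def)
qed (auto simp: isometry_group_def intro: bij_comp)

definition boundary_action :: "('a \<Rightarrow> 'a) \<Rightarrow> (nat \<Rightarrow> 'a) set \<Rightarrow> (nat \<Rightarrow> 'a) set" where
  "boundary_action g \<xi> = (\<lambda>x. g \<circ> x) ` \<xi>"

definition bordification_action ::
  "('a \<Rightarrow> 'a) \<Rightarrow> 'a + (nat \<Rightarrow> 'a) set \<Rightarrow> 'a + (nat \<Rightarrow> 'a) set" where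
  "bordification_action g = map_sum g (boundary_action g)"

definition strongly_discrete :: "'a::metric_space \<Rightarrow> ('a \<Rightarrow> 'a) set \<Rightarrow> bool" where
  "strongly_discrete p G \<longleftrightarrow> (\<forall>r>0. finite {g \<in> G. dist p (g p) \<le> r})"

definition boundary_fixed_points :: "'a::metric_space \<Rightarrow> ('a \<Rightarrow> 'a) \<Rightarrow> (nat \<Rightarrow> 'a) set set" where
  "boundary_fixed_points p g = {\<eta> \<in> gromov_boundary p. boundary_action g \<eta> = \<eta>}"

definition iterates_attracted ::
  "'a::metric_space \<Rightarrow> ((nat \<Rightarrow> 'a) set \<Rightarrow> (nat \<Rightarrow> 'a) set \<Rightarrow> real) \<Rightarrow> ('a \<Rightarrow> 'a) \<Rightarrow>
     (nat \<Rightarrow> 'a) set \<Rightarrow> (nat \<Rightarrow> 'a) set \<Rightarrow> bool" where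
  "iterates_attracted p D g \<alpha> \<omega> \<longleftrightarrow>
     (\<forall>U. openin (Metric_space.mtopology (gromov_boundary p) D) U \<and> \<alpha> \<in> U \<longrightarrow>
        (\<forall>\<epsilon>>0. \<forall>\<^sub>F n in sequentially.
           \<forall>\<eta>\<in>gromov_boundary p - U. D ((boundary_action g ^^ n) \<eta>) \<omega> < \<epsilon>))"

definition loxodromic ::
  "'a::metric_space \<Rightarrow> ((nat \<Rightarrow> 'a) set \<Rightarrow> (nat \<Rightarrow> 'a) set \<Rightarrow> real) \<Rightarrow> ('a \<Rightarrow> 'a) \<Rightarrow> bool" where
  "loxodromic p D g \<longleftrightarrow>
     (\<exists>\<omega>\<in>boundary_fixed_points p g. \<exists>\<alpha>\<in>boundary_fixed_points p g. \<omega> \<noteq> \<alpha> \<and>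
        iterates_attracted p D g \<alpha> \<omega> \<and> iterates_attracted p D (inv_into UNIV g) \<omega> \<alpha>)"

definition general_type ::
  "'a::metric_space \<Rightarrow> ((nat \<Rightarrow> 'a) set \<Rightarrow> (nat \<Rightarrow> 'a) set \<Rightarrow> real) \<Rightarrow> ('a \<Rightarrow> 'a) set \<Rightarrow> bool" where
  "general_type p D G \<longleftrightarrow>
     (\<exists>g\<in>G. \<exists>h\<in>G. loxodromic p D g \<and> loxodromic p D h \<and>
        boundary_fixed_points p g \<inter> boundary_fixed_points p h = {})"

text \<open>The exponent is \<open>\<infinity>\<close> when the series diverges for every \<open>s\<close>.\<close>

definition poincare_exponent :: "real \<Rightarrow> 'a::metric_space \<Rightarrow> ('a \<Rightarrow> 'a) set \<Rightarrow> ereal" where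
  "poincare_exponent b p G =
     (INF s\<in>{s. s \<ge> 0 \<and> (\<lambda>g. b powr (- s * dist p (g p))) summable_on G}. ereal s)"

definition limit_set :: "'a::metric_space \<Rightarrow> ('a \<Rightarrow> 'a) set \<Rightarrow> (nat \<Rightarrow> 'a) set set" where
  "limit_set p G = {\<eta> \<in> gromov_boundary p. \<exists>g :: nat \<Rightarrow> 'a \<Rightarrow> 'a. range g \<subseteq> G \<and>
     limitin (bordification_topology p) (\<lambda>n. Inl (g n p)) (Inr \<eta>) sequentially}"

definition conformal_derivative ::
  "real \<Rightarrow> 'a::metric_space \<Rightarrow> ('a \<Rightarrow> 'a) \<Rightarrow> (nat \<Rightarrow> 'a) set \<Rightarrow> real" where
  "conformal_derivative b p g \<eta> = b powr busemann \<eta> p (inv_into UNIV g p)"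

section \<open>Quasiconformal measures\<close>

definition quasiconformal ::
  "real \<Rightarrow> 'a::metric_space \<Rightarrow> ('a \<Rightarrow> 'a) set \<Rightarrow> real \<Rightarrow> (nat \<Rightarrow> 'a) set measure \<Rightarrow> bool" where
  "quasiconformal b p G s \<mu> \<longleftrightarrow>
     (\<exists>C\<ge>1. \<forall>g\<in>G. \<forall>A\<in>sets \<mu>.
        ennreal (1 / C) * (\<integral>\<^sup>+\<eta>\<in>A. ennreal (conformal_derivative b p g \<eta> powr s) \<partial>\<mu>)
          \<le> emeasure \<mu> (boundary_action g ` A) \<and>
        emeasure \<mu> (boundary_action g ` A)
          \<le> ennreal C * (\<integral>\<^sup>+\<eta>\<in>A. ennreal (conformal_derivative b p g \<eta> powr s) \<partial>\<mu>))"

definition ergodic_measure :: "('a \<Rightarrow> 'a) set \<Rightarrow> (nat \<Rightarrow> 'a) set measure \<Rightarrow> bool" where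
  "ergodic_measure G \<mu> \<longleftrightarrow>
     (\<forall>A\<in>sets \<mu>. (\<forall>g\<in>G. boundary_action g ` A = A) \<longrightarrow>
        emeasure \<mu> A = 0 \<or> emeasure \<mu> (space \<mu> - A) = 0)"

definition ball_mass ::
  "'a::metric_space \<Rightarrow> ((nat \<Rightarrow> 'a) set \<Rightarrow> (nat \<Rightarrow> 'a) set \<Rightarrow> real) \<Rightarrow>
     (nat \<Rightarrow> 'a) set measure \<Rightarrow> (nat \<Rightarrow> 'a) set \<Rightarrow> real \<Rightarrow> real" where
  "ball_mass p D \<mu> \<xi> r = measure \<mu> (Metric_space.mcball (gromov_boundary p) D \<xi> r)"

section \<open>Well approximable points and bounded parabolic points\<close>

definition well_approximable ::
  "real \<Rightarrow> 'a::metric_space \<Rightarrow> ((nat \<Rightarrow> 'a) set \<Rightarrow> (nat \<Rightarrow> 'a) set \<Rightarrow> real) \<Rightarrow> ('a \<Rightarrow> 'a) set \<Rightarrow>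
     (real \<Rightarrow> real) \<Rightarrow> (nat \<Rightarrow> 'a) set \<Rightarrow> (nat \<Rightarrow> 'a) set set" where
  "well_approximable b p D G \<Phi> \<xi> =
     {\<eta> \<in> limit_set p G. \<forall>K>0. \<exists>g\<in>G.
        D (boundary_action g \<xi>) \<eta> \<le> \<Phi> (K * b powr dist p (g p))}"

definition point_stabilizer :: "('a \<Rightarrow> 'a) set \<Rightarrow> (nat \<Rightarrow> 'a) set \<Rightarrow> ('a \<Rightarrow> 'a) set" where
  "point_stabilizer G \<xi> = {g \<in> G. boundary_action g \<xi> = \<xi>}"

definition parabolic_fixed_point ::
  "real \<Rightarrow> 'a::metric_space \<Rightarrow> ('a \<Rightarrow> 'a) set \<Rightarrow> (nat \<Rightarrow> 'a) set \<Rightarrow> bool" where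
  "parabolic_fixed_point b p G \<xi> \<longleftrightarrow>
     \<not> bounded ((\<lambda>g. g p) ` point_stabilizer G \<xi>) \<and>
     (\<exists>C\<ge>1. \<forall>g\<in>point_stabilizer G \<xi>.
        1 / C \<le> conformal_derivative b p g \<xi> \<and> conformal_derivative b p g \<xi> \<le> C)"

definition bounded_parabolic_point ::
  "real \<Rightarrow> 'a::metric_space \<Rightarrow> ('a \<Rightarrow> 'a) set \<Rightarrow> (nat \<Rightarrow> 'a) set \<Rightarrow> bool" where
  "bounded_parabolic_point b p G \<xi> \<longleftrightarrow>
     parabolic_fixed_point b p G \<xi> \<and>
     (\<exists>S \<subseteq> bordification p - {Inr \<xi>}.
        Inr \<xi> \<notin> (bordification_topology p) closure_of S \<and>
        (\<lambda>g. Inl (g p)) ` G \<subseteq> (\<Union>h\<in>point_stabilizer G \<xi>. bordification_action h ` S))"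

end

theory Submission
  imports Defs
begin

text \<open>
  Write \<open>|g|\<close> for \<open>d(p, g(p))\<close>. Up to a constant factor, \<open>g'(\<eta>)\<close> is
  \<open>b\<close> to the power \<open>2\<langle>g\<^sup>-\<^sup>1(p)|\<eta>\<rangle> - |g|\<close>, and the distortion of \<open>D\<close> under \<open>g\<close> is governed
  by the same products.

  For (iiA), \<open>g\<^sup>-\<^sup>1\<close> has almost constant derivative on the ball around \<open>g(\<xi>)\<close> of radius
  \<open>\<Phi>(K b\<^sup>|\<^sup>g\<^sup>|)\<close>, so the measure of this ball is bounded by a term of the series, and Borel--Cantelli
  applies. For (iiB), every coset of the stabilizer of \<open>\<xi>\<close> has an element \<open>k\<close> of almost minimal length
  with \<open>k'(\<xi>)\<close> comparable to \<open>b\<^sup>-\<^sup>|\<^sup>k\<^sup>|\<close>, and only these elements matter.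

  For (i), suppose that the well approximable points form a null set; by ergodicity this is the only
  alternative. Then, for \<open>K\<close> large, the union of the (enlarged) targets \<open>A\<^sub>g\<close> has measure less than
  any given \<open>\<epsilon>\<close>. Let \<open>S(R)\<close> be the partial sum of the series over \<open>|g| \<le> R\<close>. The elements whose shadow
  is contained in an enlarged target contribute at most \<open>const \<cdot> \<epsilon> S(R)\<close>: select disjoint
  shadows greedily and factor the remaining elements through the selected ones. The other
  elements contribute a bounded amount, since those meeting a given target lie along one ray. Hence
  \<open>S(R)\<close> is bounded, against the assumption. This needs \<open>\<delta> > 0\<close>, which follows from the dynamics of two
  loxodromic elements.
\<close>

section \<open>Coarse geometry of the boundary\<close>

text \<open>As \<open>X\<close> need not be geodesic or proper, there are no rays to follow and no
  compactness. Every geometric fact is therefore an inequality between Gromov products with an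
  additive error, proved along representing sequences; all errors end up in one constant
  \<open>\<sigma>\<close>. Such errors become multiplicative constants in front of
  \<open>\<Phi>\<close>. They are absorbed by enlarging its argument, since
  \<open>t * \<Phi> t\<close> is nonincreasing and \<open>K\<close> is arbitrary. The argument of
  the ball mass has no such slack, which governs how (i) is arranged. A further obstacle in (i):
  \<open>g\<close> carries a ball around \<open>\<xi>\<close> to a set of the expected size only if
  \<open>ginv g p\<close> does not lie in the direction of \<open>\<xi>\<close>. The target of
  \<open>g\<close> is therefore the image of a ball under \<open>g\<close> or under
  \<open>g \<circ> f\<close>, where \<open>f\<close> moves \<open>\<xi>\<close>. The bound by a
  small multiple of \<open>S(R)\<close> can be subtracted because strong discreteness makes
  \<open>S(R)\<close> a finite sum. A positive \<open>\<delta>\<close> is what makes a sum along one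
  ray geometric.\<close>

lemma gromov_product_commute: "gromov_product z x y = gromov_product z y x"
  by (simp add: gromov_product_def dist_commute)

lemma gromov_product_nonneg: "0 \<le> gromov_product z x y"
  using dist_triangle[of x y z] by (simp add: gromov_product_def dist_commute)

lemma gromov_product_le: "gromov_product z x y \<le> dist y z"
  using dist_triangle[of x z y] by (simp add: gromov_product_def dist_commute)

lemma gromov_product_double: "2 * gromov_product z x y = dist x z + dist y z - dist x y"
  by (simp add: gromov_product_def)

lemma gromov_product_lipschitz_base: "gromov_product z x y \<le> gromov_product w x y + dist z w"
  using dist_triangle[of x z w] dist_triangle[of y z w] dist_commute[of w z]
    gromov_product_double[of z x y] gromov_product_double[of w x y] by linarith

lemma gromov_product_lipschitz: "gromov_product z x y \<le> gromov_product z x w + dist y w"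
  using dist_triangle[of y z w] dist_triangle[of x w y]
    gromov_product_double[of z x y] gromov_product_double[of z x w] by linarith

lemma gromov_sequence_iff:
  "gromov_sequence p x \<longleftrightarrow> (\<forall>t. \<exists>N. \<forall>n\<ge>N. \<forall>m\<ge>N. t \<le> gromov_product p (x n) (x m))"
  by (simp add: gromov_sequence_def filterlim_at_top eventually_prod_sequentially)
     (metis gromov_product_commute)

lemma gromov_sequenceD:
  "gromov_sequence p x \<Longrightarrow> \<exists>N. \<forall>n\<ge>N. \<forall>m\<ge>N. t \<le> gromov_product p (x n) (x m)"
  by (simp add: gromov_sequence_iff)

section \<open>Change of base point and the action of isometries on the boundary\<close>

lemma isometry_group_iff:
  "g \<in> carrier isometry_group \<longleftrightarrow> bij g \<and> (\<forall>x y. dist (g x) (g y) = dist x y)"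
  by (simp add: isometry_group_def)

lemma gromov_product_isometry:
  assumes "g \<in> carrier isometry_group"
  shows "gromov_product (g z) (g x) (g y) = gromov_product z x y"
  using assms by (simp add: isometry_group_iff gromov_product_def)

text \<open>A new base point changes every product by at most \<open>dist p q\<close>. This lets an
  isometry, which moves \<open>p\<close>, act on classes that are formed at
  \<open>p\<close>.\<close>

lemma gromov_sequence_base:
  assumes "gromov_sequence p x"
  shows "gromov_sequence q x"
  unfolding gromov_sequence_iff
proof
  fix t
  obtain N where N: "\<And>n m. N \<le> n \<Longrightarrow> N \<le> m \<Longrightarrow> t + dist p q \<le> gromov_product p (x n) (x m)"
    using gromov_sequenceD[OF assms, of "t + dist p q"] by blast
  have "t \<le> gromov_product q (x n) (x m)" if "N \<le> n" "N \<le> m" for n m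
    using N[OF that] gromov_product_lipschitz_base[of p "x n" "x m" q] by linarith
  then show "\<exists>N. \<forall>n\<ge>N. \<forall>m\<ge>N. t \<le> gromov_product q (x n) (x m)" by blast
qed

lemma gromov_equiv_base:
  assumes "(x, y) \<in> gromov_equiv p"
  shows "(x, y) \<in> gromov_equiv q"
proof -
  have "filterlim (\<lambda>n. gromov_product q (x n) (y n)) at_top sequentially"
    unfolding filterlim_at_top
  proof
    fix t
    have "\<forall>\<^sub>F n in sequentially. t + dist p q \<le> gromov_product p (x n) (y n)"
      using assms unfolding gromov_equiv_def filterlim_at_top by blast
    then show "\<forall>\<^sub>F n in sequentially. t \<le> gromov_product q (x n) (y n)"
    proof eventually_elim
      case (elim n)
      then show ?case using gromov_product_lipschitz_base[of p "x n" "y n" q] by linarith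
    qed
  qed
  then show ?thesis
    using assms gromov_sequence_base[of p _ q] by (auto simp: gromov_equiv_def)
qed

lemma gromov_equiv_isometry:
  assumes g: "g \<in> carrier isometry_group" and "(x, y) \<in> gromov_equiv p"
  shows "(g \<circ> x, g \<circ> y) \<in> gromov_equiv p"
proof -
  have "(g \<circ> x, g \<circ> y) \<in> gromov_equiv (g p)"
    using assms(2) by (simp add: gromov_equiv_def gromov_sequence_def gromov_product_isometry[OF g])
  then show ?thesis by (rule gromov_equiv_base)
qed

lemma gromov_equiv_refl:
  assumes "gromov_sequence p x"
  shows "(x, x) \<in> gromov_equiv p"
proof -
  have "\<exists>N. \<forall>n\<ge>N. t \<le> gromov_product p (x n) (x n)" for t
    using gromov_sequenceD[OF assms, of t] by blast
  then show ?thesis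
    using assms by (simp add: gromov_equiv_def filterlim_at_top eventually_sequentially)
qed

lemma isometry_inv_into:
  assumes "g \<in> carrier isometry_group"
  shows "inv_into UNIV g \<in> carrier isometry_group"
    and "g (inv_into UNIV g x) = x" and "inv_into UNIV g (g x) = x"
proof -
  have "bij g" using assms by (simp add: isometry_group_iff)
  then show 1: "g (inv_into UNIV g x) = x" and "inv_into UNIV g (g x) = x" for x
    by (simp_all add: bij_is_surj bij_is_inj surj_f_inv_f)
  have "dist (inv_into UNIV g x) (inv_into UNIV g y) = dist x y" for x y
    using assms 1 unfolding isometry_group_iff by metis
  then show "inv_into UNIV g \<in> carrier isometry_group"
    using \<open>bij g\<close> by (simp add: isometry_group_iff bij_imp_bij_inv)
qed

lemma boundary_action_comp: "boundary_action (g \<circ> h) \<xi> = boundary_action g (boundary_action h \<xi>)"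
  by (auto simp: boundary_action_def image_image comp_assoc)

lemma boundary_action_id [simp]: "boundary_action id \<xi> = \<xi>"
  by (simp add: boundary_action_def)

lemma boundary_action_inv:
  assumes "g \<in> carrier isometry_group"
  shows "boundary_action (inv_into UNIV g) (boundary_action g \<xi>) = \<xi>"
    and "boundary_action g (boundary_action (inv_into UNIV g) \<xi>) = \<xi>"
proof -
  have "inv_into UNIV g \<circ> g = id" "g \<circ> inv_into UNIV g = id"
    using isometry_inv_into[OF assms] by auto
  then show "boundary_action (inv_into UNIV g) (boundary_action g \<xi>) = \<xi>"
    and "boundary_action g (boundary_action (inv_into UNIV g) \<xi>) = \<xi>"
    by (simp_all flip: boundary_action_comp)
qed

text \<open>The image of a class is a full class and not just part of one, because the inverse
  isometry pulls every equivalent sequence back.\<close>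

lemma boundary_action_in_boundary:
  assumes g: "g \<in> carrier isometry_group" and "\<xi> \<in> gromov_boundary p"
  shows "boundary_action g \<xi> \<in> gromov_boundary p"
proof -
  obtain x where x: "gromov_sequence p x" "\<xi> = gromov_equiv p `` {x}"
    using assms(2) by (auto simp: gromov_boundary_def elim: quotientE)
  have gx: "gromov_sequence p (g \<circ> x)"
    using gromov_equiv_isometry[OF g gromov_equiv_refl[OF x(1)]] by (simp add: gromov_equiv_def)
  have "boundary_action g \<xi> = gromov_equiv p `` {g \<circ> x}"
  proof (intro equalityI subsetI)
    fix y assume "y \<in> boundary_action g \<xi>"
    then show "y \<in> gromov_equiv p `` {g \<circ> x}"
      using gromov_equiv_isometry[OF g] x(2) by (auto simp: boundary_action_def)
  next
    fix y assume "y \<in> gromov_equiv p `` {g \<circ> x}"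
    then have "(inv_into UNIV g \<circ> (g \<circ> x), inv_into UNIV g \<circ> y) \<in> gromov_equiv p"
      using gromov_equiv_isometry[OF isometry_inv_into(1)[OF g]] by blast
    moreover have "inv_into UNIV g \<circ> (g \<circ> x) = x" "g \<circ> (inv_into UNIV g \<circ> y) = y"
      using isometry_inv_into[OF g] by auto
    ultimately show "y \<in> boundary_action g \<xi>"
      unfolding boundary_action_def x(2) by (metis Image_singleton_iff imageI)
  qed
  then show ?thesis using gx by (simp add: gromov_boundary_def quotientI)
qed

section \<open>Products with boundary points and Busemann functions, up to additive errors\<close>

definition boundary_product :: "'a::metric_space \<Rightarrow> 'a \<Rightarrow> (nat \<Rightarrow> 'a) set \<Rightarrow> real" where
  "boundary_product z y \<xi> = real_of_ereal (ext_gromov_product z (Inl y) (Inr \<xi>))"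

lemma busemann_boundary_product:
  "busemann \<xi> y z = boundary_product y z \<xi> - boundary_product z y \<xi>"
  by (simp add: busemann_def boundary_product_def)

locale hyperbolic_space =
  fixes p :: "'a::metric_space" and C :: real
  assumes C_nonneg: "0 \<le> C"
    and hyperbolic: "\<And>w x y z :: 'a. min (gromov_product w x y) (gromov_product w y z) - C \<le> gromov_product w x z"
begin

lemma boundary_nonempty: "\<xi> \<in> gromov_boundary p \<Longrightarrow> \<exists>x. x \<in> \<xi>"
  by (auto simp: gromov_boundary_def elim!: quotientE intro: gromov_equiv_refl)

text \<open>Equivalence only controls products at equal indices. Here the indices are independent:
  along the chain \<open>x n\<close>, \<open>x N\<close>, \<open>w N\<close>, \<open>y N\<close>,
  \<open>y m\<close> all products exceed \<open>t + 2 * C\<close>; merging the links on either side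
  of \<open>w N\<close> costs one \<open>C\<close>, joining the two halves another.\<close>

lemma boundary_sequences_converge:
  assumes "\<xi> \<in> gromov_boundary p" "x \<in> \<xi>" "y \<in> \<xi>"
  shows "\<exists>N. \<forall>n\<ge>N. \<forall>m\<ge>N. t \<le> gromov_product z (x n) (y m)"
proof -
  obtain w where \<xi>: "\<xi> = gromov_equiv p `` {w}"
    using assms(1) by (auto simp: gromov_boundary_def elim: quotientE)
  then have "(w, x) \<in> gromov_equiv z" "(w, y) \<in> gromov_equiv z"
    using assms(2,3) gromov_equiv_base by auto
  then have "\<forall>\<^sub>F n in sequentially. t + 2 * C \<le> gromov_product z (w n) (x n)"
    "\<forall>\<^sub>F n in sequentially. t + 2 * C \<le> gromov_product z (w n) (y n)"
    and xy: "gromov_sequence z x" "gromov_sequence z y"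
    unfolding gromov_equiv_def filterlim_at_top by blast+
  then obtain N1 N2 where N1: "\<And>n. N1 \<le> n \<Longrightarrow> t + 2 * C \<le> gromov_product z (w n) (x n)"
    and N2: "\<And>n. N2 \<le> n \<Longrightarrow> t + 2 * C \<le> gromov_product z (w n) (y n)"
    unfolding eventually_sequentially by blast
  obtain N3 where N3: "\<And>n m. N3 \<le> n \<Longrightarrow> N3 \<le> m \<Longrightarrow> t + 2 * C \<le> gromov_product z (x n) (x m)"
    using gromov_sequenceD[OF xy(1), of "t + 2 * C"] by blast
  obtain N4 where N4: "\<And>n m. N4 \<le> n \<Longrightarrow> N4 \<le> m \<Longrightarrow> t + 2 * C \<le> gromov_product z (y n) (y m)"
    using gromov_sequenceD[OF xy(2), of "t + 2 * C"] by blast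
  define N where "N = max (max N1 N2) (max N3 N4)"
  have "t \<le> gromov_product z (x n) (y m)" if "N \<le> n" "N \<le> m" for n m
  proof -
    have N: "N1 \<le> N" "N2 \<le> N" "N3 \<le> N" "N4 \<le> N" by (auto simp: N_def)
    have "t + C \<le> gromov_product z (x n) (w N)"
      using hyperbolic[of z "x n" "x N" "w N"] N1[of N] N3[of n N] N that
        gromov_product_commute[of z "w N" "x N"] C_nonneg by linarith
    moreover have "t + C \<le> gromov_product z (w N) (y m)"
      using hyperbolic[of z "w N" "y N" "y m"] N2[of N] N4[of N m] N that C_nonneg
      by linarith
    ultimately show ?thesis
      using hyperbolic[of z "x n" "w N" "y m"] by linarith
  qed
  then show ?thesis by blast
qed

lemma boundary_product_ereal:
  assumes "\<xi> \<in> gromov_boundary p"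
  shows "ereal (boundary_product z y \<xi>) = ext_gromov_product z (Inl y) (Inr \<xi>)"
    and "0 \<le> boundary_product z y \<xi>" and "boundary_product z y \<xi> \<le> dist y z"
proof -
  let ?E = "ext_gromov_product z (Inl y) (Inr \<xi>)"
  have "0 \<le> ?E"
    by (auto intro!: INF_greatest Liminf_bounded simp: gromov_product_nonneg zero_ereal_def[symmetric])
  moreover have "?E \<le> ereal (dist y z)"
  proof -
    obtain x where "x \<in> \<xi>" using boundary_nonempty[OF assms] by blast
    have "liminf (\<lambda>n. ereal (gromov_product z (x n) y)) \<le> liminf (\<lambda>n. ereal (dist y z))"
      by (intro Liminf_mono always_eventually) (simp add: gromov_product_le)
    then show ?thesis using \<open>x \<in> \<xi>\<close> by (auto simp: Liminf_const intro: INF_lower2)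
  qed
  ultimately show "ereal (boundary_product z y \<xi>) = ?E" and "0 \<le> boundary_product z y \<xi>"
    and "boundary_product z y \<xi> \<le> dist y z"
    unfolding boundary_product_def by (cases ?E; auto)+
qed

text \<open>With this estimate, the coarse identities at the boundary are read off, along a representing
  sequence, from exact identities in the space.\<close>

lemma boundary_product_approx:
  assumes "\<xi> \<in> gromov_boundary p" "x \<in> \<xi>"
  shows "\<forall>\<^sub>F n in sequentially. \<bar>gromov_product z (x n) y - boundary_product z y \<xi>\<bar> \<le> C + 1"
proof -
  let ?u = "boundary_product z y \<xi>"
  note E = boundary_product_ereal(1)[OF assms(1), of z y]
  have "ereal (?u - 1) < ext_gromov_product z (Inl y) (Inr \<xi>)"
    unfolding E[symmetric] by simp
  also have "\<dots> \<le> liminf (\<lambda>n. ereal (gromov_product z (x n) y))"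
    using assms(2) by (auto intro: INF_lower)
  finally have low: "\<forall>\<^sub>F n in sequentially. ?u - 1 < gromov_product z (x n) y"
    by (auto dest: less_LiminfD)
  have "ext_gromov_product z (Inl y) (Inr \<xi>) < ereal (?u + 1)"
    unfolding E[symmetric] by simp
  then obtain x' where x': "x' \<in> \<xi>"
    and less: "liminf (\<lambda>n. ereal (gromov_product z (x' n) y)) < ereal (?u + 1)"
    by (auto simp: INF_less_iff)
  \<comment> \<open>The product of \<open>x n\<close> and \<open>x' k\<close> is made so large that
    it cannot be the smaller one in the hyperbolic inequality for \<open>x' k\<close>,
    \<open>x n\<close>, \<open>y\<close>; so the bound must come from \<open>x n\<close> and
    \<open>y\<close>.\<close>
  obtain N where N: "\<And>n m. N \<le> n \<Longrightarrow> N \<le> m \<Longrightarrow> ?u + 1 + C \<le> gromov_product z (x n) (x' m)"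
    using boundary_sequences_converge[OF assms x', of "?u + 1 + C" z] by blast
  obtain k where k: "N \<le> k" "gromov_product z (x' k) y < ?u + 1"
  proof -
    have "\<not> (\<forall>k\<ge>N. ?u + 1 \<le> gromov_product z (x' k) y)"
    proof
      assume "\<forall>k\<ge>N. ?u + 1 \<le> gromov_product z (x' k) y"
      then have "\<forall>\<^sub>F k in sequentially. ereal (?u + 1) \<le> ereal (gromov_product z (x' k) y)"
        by (auto simp: eventually_sequentially)
      then have "ereal (?u + 1) \<le> liminf (\<lambda>n. ereal (gromov_product z (x' n) y))"
        by (rule Liminf_bounded)
      with less show False by simp
    qed
    then show ?thesis using that by (auto simp: not_le)
  qed
  have "gromov_product z (x n) y \<le> ?u + 1 + C" if "N \<le> n" for n
    using hyperbolic[of z "x' k" "x n" y] N[OF that k(1)] k(2) gromov_product_commute[of z "x n" "x' k"]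
    by linarith
  then have "\<forall>\<^sub>F n in sequentially. gromov_product z (x n) y \<le> ?u + 1 + C"
    by (auto simp: eventually_sequentially)
  with low show ?thesis by eventually_elim (use C_nonneg in auto)
qed

lemma ext_product_greater:
  assumes "x \<in> \<xi>" "y \<in> \<eta>" "ereal t < ext_gromov_product z (Inr \<xi>) (Inr \<eta>)"
  shows "\<forall>\<^sub>F n in sequentially. t < gromov_product z (x n) (y n)"
proof -
  have "ext_gromov_product z (Inr \<xi>) (Inr \<eta>) \<le> Liminf (sequentially \<times>\<^sub>F sequentially)
      (\<lambda>(n, m). ereal (gromov_product z (x n) (y m)))"
    using assms(1,2) by (auto intro: INF_lower2[of "(x, y)"])
  from less_LiminfD[OF order.strict_trans2[OF assms(3) this]] show ?thesis
    by (auto simp: eventually_prod_sequentially eventually_sequentially)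
qed

text \<open>The infimum is nearly attained by other representatives at some indices
  \<open>k\<close>, \<open>l\<close>. Replacing them by the given sequences, one at a time, costs
  \<open>C\<close> each.\<close>

lemma ext_product_less:
  assumes \<xi>: "\<xi> \<in> gromov_boundary p" "x \<in> \<xi>" and \<eta>: "\<eta> \<in> gromov_boundary p" "y \<in> \<eta>"
    and less: "ext_gromov_product z (Inr \<xi>) (Inr \<eta>) < ereal t"
  shows "\<forall>\<^sub>F n in sequentially. gromov_product z (x n) (y n) \<le> t + 2 * C"
proof -
  obtain x' y' where x': "x' \<in> \<xi>" and y': "y' \<in> \<eta>"
    and less: "Liminf (sequentially \<times>\<^sub>F sequentially)
      (\<lambda>(n, m). ereal (gromov_product z (x' n) (y' m))) < ereal t"
    using less by (auto simp: INF_less_iff)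
  obtain N1 where N1: "\<And>n m. N1 \<le> n \<Longrightarrow> N1 \<le> m \<Longrightarrow> t + 2 * C \<le> gromov_product z (x' n) (x m)"
    using boundary_sequences_converge[OF \<xi>(1) x' \<xi>(2), of "t + 2 * C" z] by blast
  obtain N2 where N2: "\<And>n m. N2 \<le> n \<Longrightarrow> N2 \<le> m \<Longrightarrow> t + 2 * C \<le> gromov_product z (y n) (y' m)"
    using boundary_sequences_converge[OF \<eta> y', of "t + 2 * C" z] by blast
  define N where "N = max N1 N2"
  obtain k l where kl: "N \<le> k" "N \<le> l" "gromov_product z (x' k) (y' l) < t"
  proof -
    have "\<not> (\<forall>k\<ge>N. \<forall>l\<ge>N. t \<le> gromov_product z (x' k) (y' l))"
    proof
      assume "\<forall>k\<ge>N. \<forall>l\<ge>N. t \<le> gromov_product z (x' k) (y' l)"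
      then have "\<forall>\<^sub>F kl in sequentially \<times>\<^sub>F sequentially.
          t \<le> gromov_product z (x' (fst kl)) (y' (snd kl))"
        by (auto simp: eventually_prod_sequentially)
      then have "ereal t \<le> Liminf (sequentially \<times>\<^sub>F sequentially)
          (\<lambda>(n, m). ereal (gromov_product z (x' n) (y' m)))"
        by (intro Liminf_bounded) (simp add: case_prod_beta)
      with less show False by simp
    qed
    then show ?thesis using that by (auto simp: not_le)
  qed
  have "gromov_product z (x n) (y n) \<le> t + 2 * C" if "N \<le> n" for n
  proof -
    have "t + 2 * C \<le> gromov_product z (x' k) (x n)" "t + 2 * C \<le> gromov_product z (y n) (y' l)"
      using N1[of k n] N2[of n l] kl that by (auto simp: N_def)
    then show ?thesis
      using hyperbolic[of z "x' k" "x n" "y' l"] hyperbolic[of z "x n" "y n" "y' l"] kl(3) C_nonneg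
      by linarith
  qed
  then show ?thesis by (auto simp: eventually_sequentially)
qed

lemma busemann_approx:
  assumes "\<xi> \<in> gromov_boundary p" "x \<in> \<xi>"
  shows "\<forall>\<^sub>F n in sequentially. \<bar>busemann \<xi> y z - (dist (x n) y - dist (x n) z)\<bar> \<le> 2 * C + 2"
  using boundary_product_approx[OF assms, of y z] boundary_product_approx[OF assms, of z y]
proof eventually_elim
  case (elim n)
  have "gromov_product y (x n) z - gromov_product z (x n) y = dist (x n) y - dist (x n) z"
    using gromov_product_double[of y "x n" z] gromov_product_double[of z "x n" y]
      dist_commute[of y z] by linarith
  then show ?case using elim unfolding busemann_boundary_product by linarith
qed

text \<open>For a point of the space in place of \<open>\<xi>\<close>, the two products seen from
  the ends \<open>y\<close> and \<open>z\<close> add up to \<open>dist y z\<close> exactly.\<close>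

lemma boundary_product_dual:
  assumes "\<xi> \<in> gromov_boundary p"
  shows "\<bar>boundary_product y z \<xi> + boundary_product z y \<xi> - dist y z\<bar> \<le> 2 * C + 2"
proof -
  obtain x where x: "x \<in> \<xi>" using boundary_nonempty[OF assms] by blast
  have "\<forall>\<^sub>F n in sequentially.
      \<bar>boundary_product y z \<xi> + boundary_product z y \<xi> - dist y z\<bar> \<le> 2 * C + 2"
    using boundary_product_approx[OF assms x, of y z] boundary_product_approx[OF assms x, of z y]
  proof eventually_elim
    case (elim n)
    have "gromov_product y (x n) z + gromov_product z (x n) y = dist y z"
      using gromov_product_double[of y "x n" z] gromov_product_double[of z "x n" y]
      dist_commute[of y z] by linarith
    then show ?case using elim by linarith
  qed
  then show ?thesis by simp
qed

lemma boundary_product_lipschitz: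
  assumes "\<xi> \<in> gromov_boundary p"
  shows "boundary_product z y \<xi> \<le> boundary_product z w \<xi> + dist y w + 2 * C + 2"
proof -
  obtain x where x: "x \<in> \<xi>" using boundary_nonempty[OF assms] by blast
  have "\<forall>\<^sub>F n in sequentially.
      boundary_product z y \<xi> \<le> boundary_product z w \<xi> + dist y w + 2 * C + 2"
    using boundary_product_approx[OF assms x, of z y] boundary_product_approx[OF assms x, of z w]
  proof eventually_elim
    case (elim n)
    then show ?case using gromov_product_lipschitz[of z "x n" y w] by linarith
  qed
  then show ?thesis by simp
qed

lemma boundary_product_lipschitz_base:
  assumes "\<xi> \<in> gromov_boundary p"
  shows "boundary_product z y \<xi> \<le> boundary_product w y \<xi> + dist z w + 2 * C + 2"
proof -
  obtain x where x: "x \<in> \<xi>" using boundary_nonempty[OF assms] by blast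
  have "\<forall>\<^sub>F n in sequentially.
      boundary_product z y \<xi> \<le> boundary_product w y \<xi> + dist z w + 2 * C + 2"
    using boundary_product_approx[OF assms x, of z y] boundary_product_approx[OF assms x, of w y]
  proof eventually_elim
    case (elim n)
    then show ?case using gromov_product_lipschitz_base[of z "x n" y w] by linarith
  qed
  then show ?thesis by simp
qed

lemma boundary_product_hyperbolic:
  assumes "\<xi> \<in> gromov_boundary p"
    and m: "m \<le> boundary_product z y \<xi>" "m \<le> boundary_product z w \<xi>"
  shows "m - (2 * C + 1) \<le> gromov_product z y w"
proof -
  obtain x where x: "x \<in> \<xi>" using boundary_nonempty[OF assms(1)] by blast
  have "\<forall>\<^sub>F n in sequentially. m - (2 * C + 1) \<le> gromov_product z y w"
    using boundary_product_approx[OF assms(1) x, of z y] boundary_product_approx[OF assms(1) x, of z w]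
  proof eventually_elim
    case (elim n)
    then show ?case
      using hyperbolic[of z y "x n" w] gromov_product_commute[of z "x n" y] m
      by linarith
  qed
  then show ?thesis by simp
qed

lemma boundary_product_isometry:
  assumes "g \<in> carrier isometry_group" "\<xi> \<in> gromov_boundary p"
  shows "boundary_product (g z) (g y) (boundary_action g \<xi>) = boundary_product z y \<xi>"
  using gromov_product_isometry[OF assms(1)]
  by (simp add: boundary_product_def boundary_action_def image_image)

lemma busemann_isometry:
  assumes "g \<in> carrier isometry_group" "\<xi> \<in> gromov_boundary p"
  shows "busemann (boundary_action g \<xi>) (g y) (g z) = busemann \<xi> y z"
  by (simp add: busemann_boundary_product boundary_product_isometry[OF assms])

text \<open>Differences of distances satisfy the cocycle identity exactly, so the error is three
  times that of \<open>busemann_approx\<close>.\<close>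

lemma busemann_cocycle:
  assumes "\<xi> \<in> gromov_boundary p"
  shows "\<bar>busemann \<xi> y z - (busemann \<xi> y w + busemann \<xi> w z)\<bar> \<le> 6 * C + 6"
proof -
  obtain x where x: "x \<in> \<xi>" using boundary_nonempty[OF assms] by blast
  have "\<forall>\<^sub>F n in sequentially.
      \<bar>busemann \<xi> y z - (busemann \<xi> y w + busemann \<xi> w z)\<bar> \<le> 6 * C + 6"
    using busemann_approx[OF assms x, of y z] busemann_approx[OF assms x, of y w]
      busemann_approx[OF assms x, of w z]
    by eventually_elim linarith
  then show ?thesis by simp
qed

lemma busemann_estimate:
  assumes "\<xi> \<in> gromov_boundary p"
  shows "\<bar>busemann \<xi> y z - (2 * boundary_product y z \<xi> - dist y z)\<bar> \<le> 2 * C + 2"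
  using boundary_product_dual[OF assms, of y z] unfolding busemann_boundary_product by linarith

end

section \<open>The visual metric and its distortion under isometries\<close>

locale visual_boundary = hyperbolic_space p C + Metric_space "gromov_boundary p" D
  for p :: "'a::metric_space" and C D +
  fixes b V :: real
  assumes b_gt_1: "1 < b" and V_ge_1: "1 \<le> V"
    and visual_lower: "\<xi> \<in> gromov_boundary p \<Longrightarrow> \<eta> \<in> gromov_boundary p \<Longrightarrow>
        ext_powr_minus b (ext_gromov_product p (Inr \<xi>) (Inr \<eta>)) \<le> V * D \<xi> \<eta>"
    and visual_upper: "\<xi> \<in> gromov_boundary p \<Longrightarrow> \<eta> \<in> gromov_boundary p \<Longrightarrow>
        D \<xi> \<eta> \<le> V * ext_powr_minus b (ext_gromov_product p (Inr \<xi>) (Inr \<eta>))"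
begin

text \<open>\<open>log b V\<close> is the visual constant moved into the exponent, \<open>1\<close>
  makes an inequality strict, and \<open>2 * C\<close> pays for
  \<open>ext_product_less\<close>.\<close>

definition vis :: real where "vis = log b V + 1 + 2 * C"

text \<open>One error that dominates those of all later coarse estimates, so that they combine
  without separate constants.\<close>

definition \<sigma> :: real where "\<sigma> = 2 * vis + 6 * C + 6"

lemma vis_nonneg: "0 \<le> vis"
  using b_gt_1 V_ge_1 C_nonneg by (simp add: vis_def)

lemma \<sigma>_nonneg: "0 \<le> \<sigma>"
  using vis_nonneg C_nonneg by (simp add: \<sigma>_def)

lemma ext_product_nonneg: "0 \<le> ext_gromov_product p (Inr \<xi>) (Inr \<eta>)"
  by (auto intro!: INF_greatest Liminf_bounded
      simp: gromov_product_nonneg zero_ereal_def[symmetric] case_prod_beta)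

text \<open>With \<open>visual_far\<close>, the bridge between \<open>D\<close> and products. Both
  speak about given representatives at equal indices, so that they combine with
  \<open>boundary_product_approx\<close> at one large \<open>n\<close>.\<close>

lemma visual_close:
  assumes "\<xi> \<in> gromov_boundary p" "\<eta> \<in> gromov_boundary p" "x \<in> \<xi>" "y \<in> \<eta>"
    and "D \<xi> \<eta> \<le> b powr (- t)"
  shows "\<forall>\<^sub>F n in sequentially. t - vis \<le> gromov_product p (x n) (y n)"
proof -
  let ?Q = "ext_gromov_product p (Inr \<xi>) (Inr \<eta>)"
  have "ext_powr_minus b ?Q \<le> V * b powr (- t)"
    using visual_lower[OF assms(1,2)] assms(5) V_ge_1 mult_left_mono[of "D \<xi> \<eta>" "b powr (- t)" V] by linarith
  also have "\<dots> = b powr (log b V - t)"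
    using b_gt_1 V_ge_1 by (simp add: powr_diff powr_minus_divide)
  finally have *: "ext_powr_minus b ?Q \<le> b powr (log b V - t)" .
  have "ereal (t - vis) < ?Q"
  proof (cases ?Q)
    case (real q)
    then have "- q \<le> log b V - t"
      using * b_gt_1 by (simp add: ext_powr_minus_def)
    then show ?thesis using real C_nonneg by (simp add: vis_def)
  qed (use ext_product_nonneg[of \<xi> \<eta>] in auto)
  from ext_product_greater[OF assms(3,4) this] show ?thesis
    by (rule eventually_mono) simp
qed

lemma visual_far:
  assumes "\<xi> \<in> gromov_boundary p" "\<eta> \<in> gromov_boundary p" "x \<in> \<xi>" "y \<in> \<eta>"
    and "b powr (- t) \<le> D \<xi> \<eta>"
  shows "\<forall>\<^sub>F n in sequentially. gromov_product p (x n) (y n) \<le> t + vis"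
proof -
  let ?Q = "ext_gromov_product p (Inr \<xi>) (Inr \<eta>)"
  have pos: "0 < b powr (- t)" using b_gt_1 by simp
  have *: "b powr (- t) \<le> V * ext_powr_minus b ?Q"
    using visual_upper[OF assms(1,2)] assms(5) by linarith
  have "?Q < ereal (t + log b V + 1)"
  proof (cases ?Q)
    case (real q)
    then have "V * ext_powr_minus b ?Q = b powr (log b V - q)"
      using b_gt_1 V_ge_1 by (simp add: ext_powr_minus_def powr_diff powr_minus_divide)
    then have "- t \<le> log b V - q" using * b_gt_1 by simp
    then show ?thesis using real by simp
  next
    case PInf
    then show ?thesis using * pos by (simp add: ext_powr_minus_def)
  qed (use ext_product_nonneg[of \<xi> \<eta>] in auto)
  from ext_product_less[OF assms(1,3,2,4) this] show ?thesis
    by (rule eventually_mono) (simp add: vis_def)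
qed

lemma boundary_product_near:
  assumes "\<xi> \<in> gromov_boundary p" "\<eta> \<in> gromov_boundary p"
    and m: "D \<xi> \<eta> \<le> b powr (- m)" "m \<le> boundary_product p z \<xi>"
  shows "m - \<sigma> \<le> boundary_product p z \<eta>"
proof -
  obtain x y where xy: "x \<in> \<xi>" "y \<in> \<eta>"
    using boundary_nonempty[OF assms(1)] boundary_nonempty[OF assms(2)] by blast
  have "\<forall>\<^sub>F n in sequentially. m - \<sigma> \<le> boundary_product p z \<eta>"
    using boundary_product_approx[OF assms(1) xy(1), of p z]
      boundary_product_approx[OF assms(2) xy(2), of p z]
      visual_close[OF assms(1,2) xy m(1)]
  proof eventually_elim
    case (elim n)
    then show ?case
      using hyperbolic[of p "y n" "x n" z] gromov_product_commute[of p "x n" "y n"]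
        vis_nonneg C_nonneg m(2) unfolding \<sigma>_def by linarith
  qed
  then show ?thesis by simp
qed

lemma visual_dist_le:
  assumes "\<xi> \<in> gromov_boundary p" "\<eta> \<in> gromov_boundary p"
    and m: "m \<le> boundary_product p z \<xi>" "m \<le> boundary_product p z \<eta>"
  shows "D \<xi> \<eta> \<le> b powr (\<sigma> - m)"
proof (rule ccontr)
  assume "\<not> ?thesis"
  then have far: "b powr (- (m - \<sigma>)) \<le> D \<xi> \<eta>" by simp
  obtain x y where xy: "x \<in> \<xi>" "y \<in> \<eta>"
    using boundary_nonempty[OF assms(1)] boundary_nonempty[OF assms(2)] by blast
  have "\<forall>\<^sub>F n in sequentially. False"
    using boundary_product_approx[OF assms(1) xy(1), of p z]
      boundary_product_approx[OF assms(2) xy(2), of p z] visual_far[OF assms(1,2) xy far]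
  proof eventually_elim
    case (elim n)
    then show ?case
      using hyperbolic[of p "x n" z "y n"] gromov_product_commute[of p "y n" z]
        vis_nonneg C_nonneg m unfolding \<sigma>_def by linarith
  qed
  then show False by simp
qed

text \<open>A geometric mean value inequality: up to a constant, the factor is the square root of
  the product of the derivatives of \<open>g\<close> at \<open>\<xi>\<close> and
  \<open>\<eta>\<close>.\<close>

lemma visual_dist_isometry:
  assumes g: "g \<in> carrier isometry_group"
    and "\<xi> \<in> gromov_boundary p" "\<eta> \<in> gromov_boundary p"
  shows "D (boundary_action g \<xi>) (boundary_action g \<eta>) \<le> b powr (\<sigma>
      + boundary_product p (inv_into UNIV g p) \<xi> + boundary_product p (inv_into UNIV g p) \<eta>
      - dist p (g p)) * D \<xi> \<eta>"
proof (rule ccontr)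
  let ?z = "inv_into UNIV g p"
  define u where "u = boundary_product p ?z \<xi>"
  define v where "v = boundary_product p ?z \<eta>"
  note in_boundary = boundary_action_in_boundary[OF g]
  assume "\<not> ?thesis"
  then have gt: "b powr (\<sigma> + u + v - dist p (g p)) * D \<xi> \<eta>
      < D (boundary_action g \<xi>) (boundary_action g \<eta>)"
    by (simp add: u_def v_def)
  then have "\<xi> \<noteq> \<eta>" using assms(2,3) in_boundary by auto
  then have pos: "0 < D \<xi> \<eta>" using assms(2,3) nonneg[of \<xi> \<eta>] zero[of \<xi> \<eta>] by linarith
  define t where "t = - log b (D \<xi> \<eta>)"
  have t: "D \<xi> \<eta> = b powr (- t)" using pos b_gt_1 by (simp add: t_def)
  have far: "b powr (- (t - u - v + dist p (g p) - \<sigma>)) \<le> D (boundary_action g \<xi>) (boundary_action g \<eta>)"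
    using gt unfolding t by (simp add: algebra_simps flip: powr_add)
  obtain x y where xy: "x \<in> \<xi>" "y \<in> \<eta>"
    using boundary_nonempty[OF assms(2)] boundary_nonempty[OF assms(3)] by blast
  then have gxy: "g \<circ> x \<in> boundary_action g \<xi>" "g \<circ> y \<in> boundary_action g \<eta>"
    by (auto simp: boundary_action_def)
  have z: "g ?z = p" by (rule isometry_inv_into(2)[OF g])
  have dz: "dist p ?z = dist p (g p)"
    using g z unfolding isometry_group_iff by (metis dist_commute)
  have "\<forall>\<^sub>F n in sequentially. False"
    using boundary_product_approx[OF assms(2) xy(1), of p ?z]
      boundary_product_approx[OF assms(3) xy(2), of p ?z]
      visual_far[OF in_boundary[OF assms(2)] in_boundary[OF assms(3)] gxy far]
      visual_close[OF assms(2,3) xy eq_refl[OF t]]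
  proof eventually_elim
    case (elim n)
    have "gromov_product p (g (x n)) (g (y n)) = gromov_product ?z (x n) (y n)"
      using gromov_product_isometry[OF g, of ?z] z by simp
    \<comment> \<open>Moving the base point from \<open>p\<close> to \<open>?z\<close> is an exact
      identity in the space; all errors come from passing to the boundary.\<close>
    also have "\<dots> = gromov_product p (x n) (y n) - gromov_product p (x n) ?z
        - gromov_product p (y n) ?z + dist p ?z"
      using gromov_product_double[of ?z "x n" "y n"] gromov_product_double[of p "x n" "y n"]
        gromov_product_double[of p "x n" ?z] gromov_product_double[of p "y n" ?z]
        dist_commute[of p ?z] by linarith
    finally show ?case
      using elim t dz vis_nonneg C_nonneg unfolding \<sigma>_def u_def v_def comp_def by linarith
  qed
  then show False by simp
qed

text \<open>Products with \<open>g p\<close> describe shadows, products with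
  \<open>inv_into UNIV g p\<close> describe derivatives. Duality, transported by \<open>g\<close>,
  translates between the two.\<close>

lemma boundary_product_orbit:
  assumes g: "g \<in> carrier isometry_group" and \<xi>: "\<xi> \<in> gromov_boundary p"
  shows "\<bar>boundary_product p (g p) (boundary_action g \<xi>)
      + boundary_product p (inv_into UNIV g p) \<xi> - dist p (g p)\<bar> \<le> \<sigma>"
proof -
  let ?z = "inv_into UNIV g p"
  have z: "g ?z = p" by (rule isometry_inv_into(2)[OF g])
  then have "boundary_product p (g p) (boundary_action g \<xi>) = boundary_product ?z p \<xi>"
    using boundary_product_isometry[OF assms, of ?z p] by simp
  moreover have "dist p ?z = dist p (g p)"
    using g z unfolding isometry_group_iff by (metis dist_commute)
  ultimately show ?thesis
    using boundary_product_dual[OF \<xi>, of p ?z] vis_nonneg C_nonneg unfolding \<sigma>_def by linarith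
qed

lemma conformal_derivative_bounds:
  assumes g: "g \<in> carrier isometry_group" and \<xi>: "\<xi> \<in> gromov_boundary p"
  shows "b powr (2 * boundary_product p (inv_into UNIV g p) \<xi> - dist p (g p) - \<sigma>)
      \<le> conformal_derivative b p g \<xi>"
    and "conformal_derivative b p g \<xi>
      \<le> b powr (2 * boundary_product p (inv_into UNIV g p) \<xi> - dist p (g p) + \<sigma>)"
proof -
  let ?z = "inv_into UNIV g p"
  have "dist p ?z = dist p (g p)"
    using g isometry_inv_into(2)[OF g, of p] unfolding isometry_group_iff by (metis dist_commute)
  then have "\<bar>busemann \<xi> p ?z - (2 * boundary_product p ?z \<xi> - dist p (g p))\<bar> \<le> \<sigma>"
    using busemann_estimate[OF \<xi>, of p ?z] vis_nonneg C_nonneg unfolding \<sigma>_def by linarith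
  then show "b powr (2 * boundary_product p ?z \<xi> - dist p (g p) - \<sigma>) \<le> conformal_derivative b p g \<xi>"
    and "conformal_derivative b p g \<xi> \<le> b powr (2 * boundary_product p ?z \<xi> - dist p (g p) + \<sigma>)"
    using b_gt_1 unfolding conformal_derivative_def by (auto intro!: powr_mono)
qed

end

section \<open>Quasiconformal measures\<close>

text \<open>Borel--Cantelli over a countable index set. The premise \<open>cover\<close> expresses
  that each point of \<open>N\<close> lies in infinitely many \<open>B k\<close>; if
  \<open>T\<close> is finite, removing all of it leaves \<open>N\<close> empty.\<close>

lemma null_sets_eventually_in_union:
  fixes B :: "'b \<Rightarrow> 'c set" and f :: "'b \<Rightarrow> real"
  assumes "finite_measure M" and T: "countable T" and N: "N \<in> sets M"
    and B: "\<And>k. k \<in> T \<Longrightarrow> B k \<in> sets M" and le: "\<And>k. k \<in> T \<Longrightarrow> measure M (B k) \<le> f k"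
    and f: "f summable_on T"
    and cover: "\<And>F. finite F \<Longrightarrow> F \<subseteq> T \<Longrightarrow> N \<subseteq> (\<Union>k\<in>T - F. B k)"
  shows "N \<in> null_sets M"
proof (cases "finite T")
  case True
  then have "N = {}" using cover[of T] by auto
  then show ?thesis by simp
next
  case False
  interpret finite_measure M by fact
  define e where "e = from_nat_into T"
  have e: "bij_betw e UNIV T" unfolding e_def using T False by (rule bij_betw_from_nat_into)
  then have eT: "e n \<in> T" for n by (auto simp: bij_betw_def)
  have "(\<lambda>n. f (e n)) summable_on UNIV"
    using summable_on_reindex_bij_betw[OF e, of f] f by simp
  then have "summable (\<lambda>n. f (e n))" by (rule summable_on_imp_summable)
  then have "summable (\<lambda>n. measure M (B (e n)))"
    by (rule summable_comparison_test') (use le eT in auto)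
  then have null: "limsup (\<lambda>n. B (e n)) \<in> null_sets M"
    using B eT by (intro borel_cantelli_limsup1) (auto simp: emeasure_finite less_top[symmetric])
  have "N \<subseteq> limsup (\<lambda>n. B (e n))"
  proof
    fix x assume x: "x \<in> N"
    have "\<exists>m\<ge>n. x \<in> B (e m)" for n
    proof -
      have "x \<in> (\<Union>k\<in>T - e ` {..<n}. B k)"
        using cover[of "e ` {..<n}"] eT x by auto
      then obtain k where k: "k \<in> T" "k \<notin> e ` {..<n}" "x \<in> B k" by auto
      then obtain m where "k = e m" using e by (auto simp: bij_betw_def)
      with k show ?thesis by (intro exI[of _ m]) auto
    qed
    then show "x \<in> limsup (\<lambda>n. B (e n))" by (auto simp: limsup_INF_SUP)
  qed
  with null N show ?thesis by (rule null_sets_subset)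
qed

text \<open>Vitali selection: take an element with least \<open>N\<close>, drop everything that
  meets it, and repeat. In the applications \<open>N\<close> is the length, so larger shadows are
  chosen first.\<close>

lemma greedy_disjoint:
  fixes N :: "'b \<Rightarrow> real" and V :: "'b \<Rightarrow> 'c set"
  assumes "finite H" "\<And>h. h \<in> H \<Longrightarrow> V h \<noteq> {}"
  shows "\<exists>I\<subseteq>H. disjoint_family_on V I \<and> (\<forall>h\<in>H. \<exists>i\<in>I. V i \<inter> V h \<noteq> {} \<and> N i \<le> N h)"
  using assms
proof (induction H rule: finite_psubset_induct)
  case (psubset H)
  show ?case
  proof (cases "H = {}")
    case True
    then show ?thesis by (auto simp: disjoint_family_on_def)
  next
    case False
    define i where "i = arg_min_on N H"
    have i: "i \<in> H" "\<And>h. h \<in> H \<Longrightarrow> N i \<le> N h"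
      unfolding i_def using arg_min_if_finite[OF psubset.hyps(1) False, of N] by (auto simp: not_less)
    define H' where "H' = {h \<in> H. V i \<inter> V h = {}}"
    have "H' \<subset> H" using i(1) psubset.prems by (auto simp: H'_def)
    then have "\<exists>I\<subseteq>H'. disjoint_family_on V I \<and> (\<forall>h\<in>H'. \<exists>j\<in>I. V j \<inter> V h \<noteq> {} \<and> N j \<le> N h)"
      using psubset.prems by (intro psubset.IH) auto
    then obtain I where I: "I \<subseteq> H'" "disjoint_family_on V I"
      "\<And>h. h \<in> H' \<Longrightarrow> \<exists>j\<in>I. V j \<inter> V h \<noteq> {} \<and> N j \<le> N h"
      by blast
    have "disjoint_family_on V (insert i I)"
      using I(1,2) unfolding H'_def disjoint_family_on_def by auto
    moreover have "\<exists>j\<in>insert i I. V j \<inter> V h \<noteq> {} \<and> N j \<le> N h" if "h \<in> H" for h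
      using I(3)[of h] i(2)[OF that] that by (cases "h \<in> H'") (auto simp: H'_def)
    moreover have "insert i I \<subseteq> H" using I(1) i(1) by (auto simp: H'_def)
    ultimately show ?thesis by (intro exI[of _ "insert i I"]) blast
  qed
qed

lemma greedy_disjoint_map:
  fixes N :: "'b \<Rightarrow> real" and V :: "'b \<Rightarrow> 'c set"
  assumes "finite H" "\<forall>h\<in>H. V h \<noteq> {}"
  obtains I \<pi> where "I \<subseteq> H" "disjoint_family_on V I"
    "\<And>h. h \<in> H \<Longrightarrow> \<pi> h \<in> I \<and> V (\<pi> h) \<inter> V h \<noteq> {} \<and> N (\<pi> h) \<le> N h"
proof -
  have "\<exists>I\<subseteq>H. disjoint_family_on V I \<and> (\<forall>h\<in>H. \<exists>i\<in>I. V i \<inter> V h \<noteq> {} \<and> N i \<le> N h)"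
    by (rule greedy_disjoint) (use assms in auto)
  then obtain I where I: "I \<subseteq> H" "disjoint_family_on V I"
    "\<forall>h\<in>H. \<exists>i\<in>I. V i \<inter> V h \<noteq> {} \<and> N i \<le> N h"
    by (elim exE conjE)
  from I(3) have "\<forall>h\<in>H. \<exists>i. i \<in> I \<and> V i \<inter> V h \<noteq> {} \<and> N i \<le> N h" by blast
  then obtain \<pi> where "\<forall>h\<in>H. \<pi> h \<in> I \<and> V (\<pi> h) \<inter> V h \<noteq> {} \<and> N (\<pi> h) \<le> N h"
    by (rule bchoice[elim_format]) blast
  with I(1,2) show thesis by (intro that[of I \<pi>]) auto
qed

section \<open>The group, its quasiconformal measure and \<Phi>\<close>

locale quasiconformal_action = visual_boundary p C D b V + prob_space \<mu>
  for p :: "'a::metric_space" and C D b V and \<mu> :: "(nat \<Rightarrow> 'a) set measure" +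
  fixes G :: "('a \<Rightarrow> 'a) set" and \<delta> Q :: real and \<xi> :: "(nat \<Rightarrow> 'a) set" and \<Phi> :: "real \<Rightarrow> real"
  assumes isometry: "\<And>g. g \<in> G \<Longrightarrow> g \<in> carrier isometry_group"
    and id_in_G: "id \<in> G"
    and comp_in_G: "\<And>g h. g \<in> G \<Longrightarrow> h \<in> G \<Longrightarrow> g \<circ> h \<in> G"
    and inv_in_G: "\<And>g. g \<in> G \<Longrightarrow> inv_into UNIV g \<in> G"
    and discrete: "strongly_discrete p G"
    and \<xi>_in: "\<xi> \<in> gromov_boundary p"
    and \<delta>_nonneg: "0 \<le> \<delta>"
    and Q_ge_1: "1 \<le> Q"
    and sets_\<mu>: "sets \<mu> = sets (boundary_borel p D)"
    and quasi_lower: "\<And>g A. g \<in> G \<Longrightarrow> A \<in> sets \<mu> \<Longrightarrow>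
        ennreal (1 / Q) * (\<integral>\<^sup>+\<eta>\<in>A. ennreal (conformal_derivative b p g \<eta> powr \<delta>) \<partial>\<mu>)
          \<le> emeasure \<mu> (boundary_action g ` A)"
    and quasi_upper: "\<And>g A. g \<in> G \<Longrightarrow> A \<in> sets \<mu> \<Longrightarrow> emeasure \<mu> (boundary_action g ` A)
          \<le> ennreal Q * (\<integral>\<^sup>+\<eta>\<in>A. ennreal (conformal_derivative b p g \<eta> powr \<delta>) \<partial>\<mu>)"
    and \<mu>_\<xi>: "measure \<mu> {\<xi>} = 0"
    and \<Phi>_pos: "\<And>t. t \<ge> 0 \<Longrightarrow> \<Phi> t > 0"
    and \<Phi>_mono: "antimono_on {0<..} (\<lambda>t. t * \<Phi> t)"
begin

abbreviation len :: "('a \<Rightarrow> 'a) \<Rightarrow> real" where "len g \<equiv> dist p (g p)"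

abbreviation ginv :: "('a \<Rightarrow> 'a) \<Rightarrow> 'a \<Rightarrow> 'a" where "ginv g \<equiv> inv_into UNIV g"

lemma powr_le: "s \<le> t \<Longrightarrow> b powr s \<le> b powr t"
  using b_gt_1 by (simp add: powr_mono)

lemma powr_pos: "0 < b powr t"
  using b_gt_1 by simp

lemma act_in: "g \<in> G \<Longrightarrow> \<eta> \<in> gromov_boundary p \<Longrightarrow> boundary_action g \<eta> \<in> gromov_boundary p"
  by (simp add: boundary_action_in_boundary isometry)

lemma act_inv [simp]:
  assumes "g \<in> G"
  shows "boundary_action (ginv g) (boundary_action g \<eta>) = \<eta>"
    and "boundary_action g (boundary_action (ginv g) \<eta>) = \<eta>"
  using boundary_action_inv[OF isometry[OF assms]] by auto

lemma ginv_apply [simp]: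
  assumes "g \<in> G"
  shows "g (ginv g x) = x" and "ginv g (g x) = x"
  using isometry_inv_into[OF isometry[OF assms]] by auto

lemma ginv_ginv [simp]: "g \<in> G \<Longrightarrow> ginv (ginv g) = g"
  using isometry by (simp add: isometry_group_iff inv_inv_eq)

lemma dist_isometry [simp]: "g \<in> G \<Longrightarrow> dist (g x) (g y) = dist x y"
  using isometry by (simp add: isometry_group_iff)

lemma len_ginv [simp]: "g \<in> G \<Longrightarrow> len (ginv g) = len g"
  using dist_isometry[of g p "ginv g p"] by (simp add: dist_commute)

lemma len_comp_ginv: "g \<in> G \<Longrightarrow> len (ginv g \<circ> h) = dist (g p) (h p)"
  using dist_isometry[of g p "ginv g (h p)"] by simp

lemma finite_len_le: "finite {g \<in> G. len g \<le> r}"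
proof -
  have "finite {g \<in> G. len g \<le> max r 1}"
    using discrete unfolding strongly_discrete_def by (meson less_max_iff_disj zero_less_one)
  then show ?thesis by (rule rev_finite_subset) auto
qed

lemma countable_G: "countable G"
proof -
  have "G \<subseteq> (\<Union>n. {g \<in> G. len g \<le> real n})"
  proof
    fix g assume "g \<in> G"
    moreover obtain n where "len g \<le> real n" using real_arch_simple by blast
    ultimately show "g \<in> (\<Union>n. {g \<in> G. len g \<le> real n})" by blast
  qed
  moreover have "countable (\<Union>n. {g \<in> G. len g \<le> real n})"
    by (intro countable_UN) (simp_all add: countable_finite finite_len_le)
  ultimately show ?thesis by (rule countable_subset)
qed

section \<open>Measurability of the boundary action\<close>

lemma space_\<mu>: "space \<mu> = gromov_boundary p"
proof -
  have "space \<mu> = space (boundary_borel p D)" using sets_\<mu> by (rule sets_eq_imp_space_eq)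
  then show ?thesis
    by (simp add: boundary_borel_def space_measure_of_conv)
qed

lemma open_sets: "openin mtopology U \<Longrightarrow> U \<in> sets \<mu>"
  unfolding sets_\<mu> boundary_borel_def
  using openin_subset by (subst sets_measure_of) fastforce+

lemma closed_sets: "closedin mtopology S \<Longrightarrow> S \<in> sets \<mu>"
proof -
  assume S: "closedin mtopology S"
  then have "space \<mu> - (gromov_boundary p - S) \<in> sets \<mu>"
    by (intro sets.compl_sets open_sets) (simp add: closedin_def)
  moreover have "space \<mu> - (gromov_boundary p - S) = S"
    using closedin_subset[OF S] space_\<mu> by auto
  ultimately show ?thesis by simp
qed

lemma mcball_sets [measurable]: "mcball \<eta> r \<in> sets \<mu>"
  by (simp add: closed_sets)

lemma singleton_sets:
  assumes "\<eta> \<in> gromov_boundary p"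
  shows "{\<eta>} \<in> sets \<mu>"
proof -
  have "mcball \<eta> 0 = {\<eta>}"
    using assms nonneg[of \<eta>] zero[OF assms] by (auto simp: order_antisym_conv)
  then show ?thesis using mcball_sets by metis
qed

lemma visual_dist_lipschitz:
  assumes "g \<in> G" "\<eta> \<in> gromov_boundary p" "\<zeta> \<in> gromov_boundary p"
  shows "D (boundary_action g \<eta>) (boundary_action g \<zeta>) \<le> b powr (\<sigma> + len g) * D \<eta> \<zeta>"
proof -
  have "boundary_product p (ginv g p) \<eta> \<le> len g" "boundary_product p (ginv g p) \<zeta> \<le> len g"
    using boundary_product_ereal(3)[OF assms(2), of p "ginv g p"]
      boundary_product_ereal(3)[OF assms(3), of p "ginv g p"] len_ginv[OF assms(1)]
    by (simp_all add: dist_commute)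
  then have "b powr (\<sigma> + boundary_product p (ginv g p) \<eta> + boundary_product p (ginv g p) \<zeta> - len g)
      \<le> b powr (\<sigma> + len g)"
    by (intro powr_le) linarith
  then show ?thesis
    using visual_dist_isometry[OF isometry[OF assms(1)] assms(2,3)] nonneg[of \<eta> \<zeta>]
      mult_right_mono order_trans by blast
qed

lemma act_vimage_open:
  assumes g: "g \<in> G" and U: "openin mtopology U"
  shows "openin mtopology (boundary_action g -` U \<inter> gromov_boundary p)"
  unfolding openin_mtopology
proof (intro conjI allI impI)
  fix \<eta> assume "\<eta> \<in> boundary_action g -` U \<inter> gromov_boundary p"
  then have \<eta>: "\<eta> \<in> gromov_boundary p" "boundary_action g \<eta> \<in> U" by auto
  then obtain r where r: "0 < r" "mball (boundary_action g \<eta>) r \<subseteq> U"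
    using U unfolding openin_mtopology by blast
  define L where "L = b powr (\<sigma> + len g)"
  have L: "0 < L" unfolding L_def by (rule powr_pos)
  have "mball \<eta> (r / L) \<subseteq> boundary_action g -` U \<inter> gromov_boundary p"
  proof
    fix \<zeta> assume \<zeta>: "\<zeta> \<in> mball \<eta> (r / L)"
    then have "D (boundary_action g \<eta>) (boundary_action g \<zeta>) \<le> L * D \<eta> \<zeta>"
      using visual_dist_lipschitz[OF g \<eta>(1)] by (simp add: L_def)
    also have "\<dots> < r" using \<zeta> L by (simp add: field_simps)
    finally show "\<zeta> \<in> boundary_action g -` U \<inter> gromov_boundary p"
      using r(2) \<zeta> \<eta>(1) act_in[OF g] by auto
  qed
  then show "\<exists>r>0. mball \<eta> r \<subseteq> boundary_action g -` U \<inter> gromov_boundary p"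
    using r(1) L by (intro exI[of _ "r / L"]) simp
qed auto

lemma act_measurable: "g \<in> G \<Longrightarrow> boundary_action g \<in> measurable \<mu> \<mu>"
proof -
  assume g: "g \<in> G"
  have "boundary_action g \<in> measurable \<mu> (boundary_borel p D)"
    unfolding boundary_borel_def
  proof (rule measurable_measure_of)
    show "{U. openin mtopology U} \<subseteq> Pow (gromov_boundary p)"
      using openin_subset by fastforce
    show "boundary_action g \<in> space \<mu> \<rightarrow> gromov_boundary p"
      using act_in[OF g] space_\<mu> by auto
    show "boundary_action g -` U \<inter> space \<mu> \<in> sets \<mu>" if "U \<in> {U. openin mtopology U}" for U
      using act_vimage_open[OF g] that open_sets space_\<mu> by simp
  qed
  then show ?thesis using measurable_cong_sets[OF refl sets_\<mu>] by blast
qed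

lemma act_image_sets [measurable]:
  assumes g: "g \<in> G" and A: "A \<in> sets \<mu>"
  shows "boundary_action g ` A \<in> sets \<mu>"
proof -
  have "A \<subseteq> gromov_boundary p" using sets.sets_into_space[OF A] space_\<mu> by simp
  then have "boundary_action g ` A \<subseteq> boundary_action (ginv g) -` A \<inter> space \<mu>"
    using g act_in[OF g] space_\<mu> by auto
  moreover have "\<eta> \<in> boundary_action g ` A" if "boundary_action (ginv g) \<eta> \<in> A" for \<eta>
    using imageI[OF that, of "boundary_action g"] g by simp
  ultimately have "boundary_action g ` A = boundary_action (ginv g) -` A \<inter> space \<mu>"
    by blast
  then show ?thesis
    using measurable_sets[OF act_measurable[OF inv_in_G[OF g]] A] by simp
qed

section \<open>Masses of images and the decay of \<Phi>\<close>

lemma measure_act_upper: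
  assumes g: "g \<in> G" and A: "A \<in> sets \<mu>" and c: "0 \<le> c"
    and le: "\<And>\<eta>. \<eta> \<in> A \<Longrightarrow> conformal_derivative b p g \<eta> \<le> c"
  shows "prob (boundary_action g ` A) \<le> Q * c powr \<delta> * prob A"
proof -
  have pos: "0 \<le> conformal_derivative b p g \<eta>" for \<eta> by (simp add: conformal_derivative_def)
  have "(\<integral>\<^sup>+\<eta>\<in>A. ennreal (conformal_derivative b p g \<eta> powr \<delta>) \<partial>\<mu>)
      \<le> (\<integral>\<^sup>+\<eta>. ennreal (c powr \<delta>) * indicator A \<eta> \<partial>\<mu>)"
    using le pos \<delta>_nonneg
    by (intro nn_integral_mono) (auto simp: indicator_def intro!: ennreal_leI powr_mono2)
  also have "\<dots> = ennreal (c powr \<delta>) * emeasure \<mu> A"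
    using A by (rule nn_integral_cmult_indicator)
  finally have "emeasure \<mu> (boundary_action g ` A)
      \<le> ennreal Q * (ennreal (c powr \<delta>) * emeasure \<mu> A)"
    using quasi_upper[OF g A] by (meson mult_left_mono order_trans zero_le)
  also have "\<dots> = ennreal (Q * c powr \<delta> * prob A)"
    using Q_ge_1 by (simp add: emeasure_eq_measure ennreal_mult' mult.assoc)
  finally show ?thesis
    using Q_ge_1 by (simp add: emeasure_eq_measure)
qed

lemma measure_act_lower:
  assumes g: "g \<in> G" and A: "A \<in> sets \<mu>" and c: "0 \<le> c"
    and le: "\<And>\<eta>. \<eta> \<in> A \<Longrightarrow> c \<le> conformal_derivative b p g \<eta>"
  shows "c powr \<delta> * prob A / Q \<le> prob (boundary_action g ` A)"
proof -
  have "ennreal (c powr \<delta> * prob A / Q) = ennreal (1 / Q) * (ennreal (c powr \<delta>) * emeasure \<mu> A)"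
    using Q_ge_1 by (simp add: emeasure_eq_measure flip: ennreal_mult')
  also have "ennreal (c powr \<delta>) * emeasure \<mu> A = (\<integral>\<^sup>+\<eta>. ennreal (c powr \<delta>) * indicator A \<eta> \<partial>\<mu>)"
    using A by (rule nn_integral_cmult_indicator[symmetric])
  also have "ennreal (1 / Q) * (\<integral>\<^sup>+\<eta>. ennreal (c powr \<delta>) * indicator A \<eta> \<partial>\<mu>)
     \<le> ennreal (1 / Q) * (\<integral>\<^sup>+\<eta>\<in>A. ennreal (conformal_derivative b p g \<eta> powr \<delta>) \<partial>\<mu>)"
    using le c \<delta>_nonneg
    by (intro mult_left_mono nn_integral_mono)
      (auto simp: indicator_def intro!: ennreal_leI powr_mono2)
  also have "\<dots> \<le> emeasure \<mu> (boundary_action g ` A)" by (rule quasi_lower[OF g A])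
  finally show ?thesis by (simp add: emeasure_eq_measure)
qed

text \<open>The form in which monotonicity of \<open>t * \<Phi> t\<close> is used throughout: a
  factor outside \<open>\<Phi>\<close> is traded for a larger argument, that is, for a larger
  \<open>K\<close>.\<close>

lemma \<Phi>_scale:
  assumes "1 \<le> c" "0 < t"
  shows "c * \<Phi> (c * t) \<le> \<Phi> t"
proof -
  have "t \<le> c * t" using assms by simp
  then have "c * t * \<Phi> (c * t) \<le> t * \<Phi> t"
    using \<Phi>_mono assms by (auto simp: monotone_on_def)
  then have "t * (c * \<Phi> (c * t)) \<le> t * \<Phi> t" by (simp add: ac_simps)
  then show ?thesis using assms(2) by simp
qed

lemma \<Phi>_antimono:
  assumes "0 < s" "s \<le> t"
  shows "\<Phi> t \<le> \<Phi> s"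
proof -
  have c: "1 \<le> t / s" using assms by simp
  have pos: "0 < \<Phi> t" using assms by (intro \<Phi>_pos) simp
  have "\<Phi> t \<le> (t / s) * \<Phi> t" using c pos mult_right_mono[of 1 "t / s" "\<Phi> t"] by simp
  also have "\<dots> \<le> \<Phi> s" using \<Phi>_scale[OF c, of s] assms by simp
  finally show ?thesis .
qed

abbreviation mass :: "real \<Rightarrow> real" where "mass \<equiv> ball_mass p D \<mu> \<xi>"

lemma mass_mono: "r \<le> s \<Longrightarrow> mass r \<le> mass s"
  unfolding ball_mass_def by (intro finite_measure_mono mcball_subset_concentric mcball_sets)

lemma mass_nonneg: "0 \<le> mass r"
  by (simp add: ball_mass_def)

subsection \<open>The convergence case\<close>

text \<open>The set \<open>WA\<close> with the group replaced by a subset and without the restriction to the limit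
  set. Since the limit set has full measure, its invariance is never needed.\<close>

definition approximated :: "('a \<Rightarrow> 'a) set \<Rightarrow> (nat \<Rightarrow> 'a) set set" where
  "approximated T = {\<eta> \<in> gromov_boundary p. \<forall>K>0. \<exists>g\<in>T.
     D (boundary_action g \<xi>) \<eta> \<le> \<Phi> (K * b powr len g)}"

text \<open>The condition becomes stronger as \<open>K\<close> grows, so integers suffice, and
  countable operations on balls give measurability.\<close>

lemma approximated_eq:
  assumes "T \<subseteq> G"
  shows "approximated T =
    (\<Inter>n. \<Union>g\<in>T. mcball (boundary_action g \<xi>) (\<Phi> (real (Suc n) * b powr len g)))"
proof (intro equalityI subsetI)
  fix \<eta> assume \<eta>: "\<eta> \<in> approximated T"
  have \<eta>_in: "\<eta> \<in> gromov_boundary p" using \<eta> by (simp add: approximated_def)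
  show "\<eta> \<in> (\<Inter>n. \<Union>g\<in>T. mcball (boundary_action g \<xi>) (\<Phi> (real (Suc n) * b powr len g)))"
  proof (rule INT_I)
    fix n
    have "0 < real (Suc n)" by simp
    then obtain g where g: "g \<in> T" "D (boundary_action g \<xi>) \<eta> \<le> \<Phi> (real (Suc n) * b powr len g)"
      using \<eta> unfolding approximated_def by blast
    have "g \<in> G" using g(1) assms by blast
    then show "\<eta> \<in> (\<Union>g\<in>T. mcball (boundary_action g \<xi>) (\<Phi> (real (Suc n) * b powr len g)))"
      using g \<eta>_in act_in[OF _ \<xi>_in, of g] by (intro UN_I[of g]) (simp_all del: of_nat_Suc)
  qed
next
  fix \<eta> assume \<eta>: "\<eta> \<in> (\<Inter>n. \<Union>g\<in>T. mcball (boundary_action g \<xi>) (\<Phi> (real (Suc n) * b powr len g)))"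
  then have "\<eta> \<in> gromov_boundary p" by auto
  moreover have "\<exists>g\<in>T. D (boundary_action g \<xi>) \<eta> \<le> \<Phi> (K * b powr len g)" if "0 < K" for K
  proof -
    obtain n where n: "K \<le> real (Suc n)" using real_arch_simple[of K] by (metis le_SucI of_nat_le_iff order_refl order_trans)
    obtain g where g: "g \<in> T" "D (boundary_action g \<xi>) \<eta> \<le> \<Phi> (real (Suc n) * b powr len g)"
      using \<eta> by (auto simp del: of_nat_Suc)
    have "\<Phi> (real (Suc n) * b powr len g) \<le> \<Phi> (K * b powr len g)"
      using n \<open>0 < K\<close> powr_pos by (intro \<Phi>_antimono mult_pos_pos mult_right_mono) auto
    with g show ?thesis by (intro bexI[of _ g]) auto
  qed
  ultimately show "\<eta> \<in> approximated T" by (simp add: approximated_def)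
qed

lemma approximated_sets:
  assumes "T \<subseteq> G"
  shows "approximated T \<in> sets \<mu>"
  unfolding approximated_eq[OF assms]
  using countable_subset[OF assms countable_G] by (intro sets.countable_INT sets.countable_UN'') auto

text \<open>\<open>K'\<close> carries two factors: \<open>L\<close> absorbs the Lipschitz constant
  of \<open>g\<close> on the boundary, and \<open>b powr len g\<close> absorbs the change of length
  from \<open>h\<close> to \<open>g \<circ> h\<close>.\<close>

lemma approximated_invariant:
  assumes g: "g \<in> G"
  shows "boundary_action g ` approximated G = approximated G"
proof -
  have sub: "boundary_action g \<eta> \<in> approximated G" if g: "g \<in> G" and \<eta>: "\<eta> \<in> approximated G" for g \<eta>
  proof -
    have \<eta>_in: "\<eta> \<in> gromov_boundary p" using \<eta> by (simp add: approximated_def)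
    define L where "L = b powr (\<sigma> + len g)"
    have L: "1 \<le> L" using \<sigma>_nonneg b_gt_1 by (simp add: L_def ge_one_powr_ge_zero)
    have "\<exists>k\<in>G. D (boundary_action k \<xi>) (boundary_action g \<eta>) \<le> \<Phi> (K * b powr len k)" if "0 < K" for K
    proof -
      define K' where "K' = L * (K * b powr len g)"
      have "0 < K'" using L that powr_pos by (simp add: K'_def)
      then obtain h where h: "h \<in> G" "D (boundary_action h \<xi>) \<eta> \<le> \<Phi> (K' * b powr len h)"
        using \<eta> unfolding approximated_def by blast
      have "D (boundary_action (g \<circ> h) \<xi>) (boundary_action g \<eta>) \<le> L * D (boundary_action h \<xi>) \<eta>"
        unfolding L_def boundary_action_comp
        using g h \<eta>_in act_in \<xi>_in by (intro visual_dist_lipschitz) auto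
      also have "\<dots> \<le> L * \<Phi> (K' * b powr len h)" using h L by simp
      also have "\<dots> = L * \<Phi> (L * (K * b powr (len g + len h)))"
        by (simp add: K'_def powr_add ac_simps)
      also have "\<dots> \<le> \<Phi> (K * b powr (len g + len h))"
        using L that powr_pos by (intro \<Phi>_scale) simp_all
      also have "\<dots> \<le> \<Phi> (K * b powr len (g \<circ> h))"
      proof -
        have "len (g \<circ> h) \<le> len g + len h"
          using dist_triangle[of p "g (h p)" "g p"] g by (simp add: dist_commute)
        then show ?thesis using that powr_pos
          by (intro \<Phi>_antimono mult_pos_pos mult_left_mono powr_le) auto
      qed
      finally show ?thesis using comp_in_G[OF g h(1)] by blast
    qed
    then show ?thesis using act_in[OF g \<eta>_in] by (simp add: approximated_def)
  qed
  show ?thesis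
  proof (intro equalityI subsetI)
    fix \<eta> assume "\<eta> \<in> boundary_action g ` approximated G"
    then show "\<eta> \<in> approximated G" using sub[OF g] by auto
  next
    fix \<eta> assume "\<eta> \<in> approximated G"
    then have "boundary_action (ginv g) \<eta> \<in> approximated G" using sub[OF inv_in_G[OF g]] by simp
    then show "\<eta> \<in> boundary_action g ` approximated G"
      using act_inv(2)[OF g, of \<eta>] by (metis imageI)
  qed
qed

lemma boundary_product_le_len:
  "g \<in> G \<Longrightarrow> \<eta> \<in> gromov_boundary p \<Longrightarrow> boundary_product p (g p) \<eta> \<le> len g"
  using boundary_product_ereal(3)[of \<eta> p "g p"] by (simp add: dist_commute)

lemma boundary_product_dual_len:
  assumes "g \<in> G" "\<eta> \<in> gromov_boundary p"
  shows "boundary_product p (g p) (boundary_action g \<eta>) \<le> len g - boundary_product p (ginv g p) \<eta> + \<sigma>"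
    and "len g - boundary_product p (ginv g p) \<eta> - \<sigma> \<le> boundary_product p (g p) (boundary_action g \<eta>)"
  using boundary_product_orbit[OF isometry[OF assms(1)] assms(2)] by linarith+

text \<open>Boundary points at distance \<open>O(b\<^sup>-\<^sup>|\<^sup>g\<^sup>|)\<close> see \<open>g(p)\<close> under comparable
  products, so the derivative of \<open>g\<^sup>-\<^sup>1\<close> is constant up to a factor on such balls.\<close>

lemma measure_ball_orbit_le:
  assumes g: "g \<in> G" and \<kappa>: "0 \<le> \<kappa>" and r: "r \<le> b powr (\<kappa> - len g)"
  shows "prob (mcball (boundary_action g \<xi>) r)
    \<le> Q * (b powr (2 * \<kappa> + 8 * \<sigma>) * conformal_derivative b p g \<xi>) powr \<delta>
        * mass (b powr (5 * \<sigma> + \<kappa>) * r / conformal_derivative b p g \<xi>)"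
proof -
  let ?B = "mcball (boundary_action g \<xi>) r"
  let ?A = "boundary_action (ginv g) ` ?B"
  let ?d = "conformal_derivative b p g"
  let ?x = "g p" and ?z = "ginv g p"
  note ig = inv_in_G[OF g]
  have g\<xi>: "boundary_action g \<xi> \<in> gromov_boundary p" using act_in[OF g \<xi>_in] .
  define u where "u = boundary_product p ?x (boundary_action g \<xi>)"
  define v where "v = boundary_product p ?z \<xi>"
  have uv: "u \<le> len g - v + \<sigma>" "len g - v - \<sigma> \<le> u"
    using boundary_product_dual_len[OF g \<xi>_in] by (simp_all add: u_def v_def)
  have u_le: "u \<le> len g" unfolding u_def by (rule boundary_product_le_len[OF g g\<xi>])
  have d\<xi>: "b powr (2 * v - len g - \<sigma>) \<le> ?d \<xi>" "?d \<xi> \<le> b powr (2 * v - len g + \<sigma>)"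
    using conformal_derivative_bounds[OF isometry[OF g] \<xi>_in] by (simp_all add: v_def)
  have d_pos: "0 < ?d \<xi>" using d\<xi>(1) powr_pos less_le_trans by blast
  \<comment> \<open>\<open>boundary_product_near\<close> is applied in both directions. It is
    available because both products are at most \<open>len g\<close>, while the radius is at most
    \<open>b powr (\<kappa> - len g)\<close>.\<close>
  have near: "\<bar>boundary_product p ?x \<eta> - u\<bar> \<le> \<kappa> + \<sigma>" if \<eta>: "\<eta> \<in> ?B" for \<eta>
  proof -
    have \<eta>': "\<eta> \<in> gromov_boundary p" "D (boundary_action g \<xi>) \<eta> \<le> r" using \<eta> by auto
    have "D (boundary_action g \<xi>) \<eta> \<le> b powr (- (u - \<kappa>))"
      using \<eta>'(2) r powr_le[of "\<kappa> - len g" "- (u - \<kappa>)"] u_le by linarith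
    from boundary_product_near[OF g\<xi> \<eta>'(1) this, of ?x] \<kappa>
    have 1: "u - \<kappa> - \<sigma> \<le> boundary_product p ?x \<eta>" by (simp add: u_def)
    let ?w = "boundary_product p ?x \<eta>"
    have "?w \<le> len g" by (rule boundary_product_le_len[OF g \<eta>'(1)])
    then have "D \<eta> (boundary_action g \<xi>) \<le> b powr (- (?w - \<kappa>))"
      using \<eta>'(2) r powr_le[of "\<kappa> - len g" "- (?w - \<kappa>)"] commute[of \<eta>] by simp
    from boundary_product_near[OF \<eta>'(1) g\<xi> this, of ?x] \<kappa>
    have 2: "?w - \<kappa> - \<sigma> \<le> u" by (simp add: u_def)
    from 1 2 show ?thesis by linarith
  qed
  have A: "?A \<in> sets \<mu>" using act_image_sets[OF ig] mcball_sets by blast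
  \<comment> \<open>The ball is viewed as the \<open>g\<close>-image of \<open>?A\<close>. This
    reduces its mass to the size of the derivative of \<open>g\<close> on \<open>?A\<close> and to a
    ball around \<open>\<xi>\<close> that contains \<open>?A\<close>.\<close>
  have B: "boundary_action g ` ?A = ?B" using g by (simp add: image_image)
  have "?A \<subseteq> mcball \<xi> (b powr (5 * \<sigma> + \<kappa>) * r / ?d \<xi>)"
  proof
    fix \<eta>' assume "\<eta>' \<in> ?A"
    then obtain \<eta> where \<eta>: "\<eta> \<in> ?B" "\<eta>' = boundary_action (ginv g) \<eta>" by blast
    have \<eta>_in: "\<eta> \<in> gromov_boundary p" using \<eta>(1) by simp
    have "D \<xi> \<eta>' \<le> b powr (\<sigma> + u + boundary_product p ?x \<eta> - len g) * D (boundary_action g \<xi>) \<eta>"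
      using visual_dist_isometry[OF isometry[OF ig] g\<xi> \<eta>_in] g \<eta>(2) by (simp add: u_def)
    also have "\<dots> \<le> b powr (5 * \<sigma> + \<kappa> - (2 * v - len g + \<sigma>)) * r"
      using near[OF \<eta>(1)] uv \<eta>(1) powr_pos
      by (intro mult_mono powr_le) (auto intro: less_imp_le)
    also have "\<dots> = b powr (5 * \<sigma> + \<kappa>) * r / b powr (2 * v - len g + \<sigma>)"
      by (simp only: powr_diff times_divide_eq_left)
    also have "\<dots> \<le> b powr (5 * \<sigma> + \<kappa>) * r / ?d \<xi>"
    proof -
      have "D (boundary_action g \<xi>) \<eta> \<le> r" using \<eta>(1) by simp
      then have "0 \<le> r" using nonneg[of "boundary_action g \<xi>" \<eta>] by linarith
      then show ?thesis using d\<xi>(2) d_pos powr_pos by (intro divide_left_mono) auto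
    qed
    finally show "\<eta>' \<in> mcball \<xi> (b powr (5 * \<sigma> + \<kappa>) * r / ?d \<xi>)"
      using \<xi>_in \<eta>(2) act_in[OF ig \<eta>_in] by simp
  qed
  then have mA: "prob ?A \<le> mass (b powr (5 * \<sigma> + \<kappa>) * r / ?d \<xi>)"
    unfolding ball_mass_def by (intro finite_measure_mono mcball_sets)
  have "?d \<eta>' \<le> b powr (2 * \<kappa> + 8 * \<sigma>) * ?d \<xi>" if \<eta>'A: "\<eta>' \<in> ?A" for \<eta>'
  proof -
    obtain \<eta> where \<eta>: "\<eta> \<in> ?B" "\<eta>' = boundary_action (ginv g) \<eta>" using \<eta>'A by blast
    have \<eta>'_in: "\<eta>' \<in> gromov_boundary p" "boundary_action g \<eta>' = \<eta>"
      using \<eta> act_in[OF ig] g by auto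
    have "?d \<eta>' \<le> b powr (2 * boundary_product p ?z \<eta>' - len g + \<sigma>)"
      using conformal_derivative_bounds(2)[OF isometry[OF g] \<eta>'_in(1)] .
    also have "\<dots> \<le> b powr (2 * \<kappa> + 8 * \<sigma> + (2 * v - len g - \<sigma>))"
      using near[OF \<eta>(1)] uv boundary_product_dual_len[OF g \<eta>'_in(1), unfolded \<eta>'_in(2)]
      by (intro powr_le) linarith
    also have "\<dots> \<le> b powr (2 * \<kappa> + 8 * \<sigma>) * ?d \<xi>"
      using mult_left_mono[OF d\<xi>(1) less_imp_le[OF powr_pos[of "2 * \<kappa> + 8 * \<sigma>"]]]
      by (simp only: powr_add[symmetric])
    finally show ?thesis .
  qed
  then have "prob (boundary_action g ` ?A)
      \<le> Q * (b powr (2 * \<kappa> + 8 * \<sigma>) * ?d \<xi>) powr \<delta> * prob ?A"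
    using d_pos by (intro measure_act_upper[OF g A]) auto
  also have "\<dots> \<le> Q * (b powr (2 * \<kappa> + 8 * \<sigma>) * ?d \<xi>) powr \<delta>
      * mass (b powr (5 * \<sigma> + \<kappa>) * r / ?d \<xi>)"
    using mA Q_ge_1 by (intro mult_left_mono) auto
  finally show ?thesis unfolding B .
qed

text \<open>A point of the orbit of \<open>\<xi>\<close> is approximated for every \<open>K\<close>
  by one single element, so it need not lie in infinitely many balls. These points are removed
  before Borel--Cantelli.\<close>

lemma orbit_point_null:
  assumes g: "g \<in> G"
  shows "{boundary_action g \<xi>} \<in> null_sets \<mu>"
proof -
  note sing = singleton_sets[OF \<xi>_in]
  have "prob (boundary_action g ` {\<xi>}) \<le> Q * conformal_derivative b p g \<xi> powr \<delta> * prob {\<xi>}"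
    by (intro measure_act_upper[OF g sing]) (auto simp: conformal_derivative_def)
  then have "prob {boundary_action g \<xi>} \<le> 0" using \<mu>_\<xi> by simp
  then show ?thesis
    using act_image_sets[OF g sing] by (auto simp: null_sets_def emeasure_eq_measure measure_le_0_iff)
qed

lemma \<Phi>_small:
  assumes "0 < e"
  obtains K where "1 \<le> K" "\<And>t. K \<le> t \<Longrightarrow> \<Phi> t < e"
proof
  define K where "K = max 1 (\<Phi> 1 / e + 1)"
  show "1 \<le> K" by (simp add: K_def)
  fix t assume t: "K \<le> t"
  have "t * \<Phi> t \<le> \<Phi> 1" using \<Phi>_scale[of t 1] t by (simp add: K_def)
  moreover have "\<Phi> 1 / e < t" using t by (simp add: K_def)
  then have "\<Phi> 1 < t * e" using assms by (simp add: field_simps)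
  ultimately have "t * \<Phi> t < t * e" by linarith
  then show "\<Phi> t < e" using t by (simp add: K_def)
qed

text \<open>Stated for a subset \<open>T\<close>, because in the parabolic case the derivative is
  controlled only on chosen coset elements.\<close>

lemma approximated_null:
  assumes T: "T \<subseteq> G" and K: "0 < K"
    and sum: "(\<lambda>g. conformal_derivative b p g \<xi> powr \<delta> *
        mass (\<Phi> (K * b powr len g) / conformal_derivative b p g \<xi>)) summable_on T"
  shows "approximated T \<in> null_sets \<mu>"
proof -
  \<comment> \<open>Since \<open>\<Phi> (K * b powr len g)\<close> is at most
    \<open>\<Phi> K / b powr len g\<close>, this \<open>\<kappa>\<close> meets the radius condition
    of \<open>measure_ball_orbit_le\<close>.\<close>
  define \<kappa> where "\<kappa> = log b (max 1 (\<Phi> K))"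
  have \<kappa>: "0 \<le> \<kappa>" "\<Phi> K \<le> b powr \<kappa>" using b_gt_1 by (auto simp: \<kappa>_def)
  \<comment> \<open>The factor by which \<open>measure_ball_orbit_le\<close> enlarges the radius;
    the argument of \<open>\<Phi>\<close> in \<open>B\<close> is multiplied by it in
    advance.\<close>
  define c where "c = b powr (5 * \<sigma> + \<kappa>)"
  have c: "1 \<le> c" using b_gt_1 \<sigma>_nonneg \<kappa>(1) by (simp add: c_def ge_one_powr_ge_zero)
  let ?d = "\<lambda>g. conformal_derivative b p g \<xi>"
  define B where "B g = mcball (boundary_action g \<xi>) (\<Phi> (c * (K * b powr len g)))" for g
  have d_pos: "0 < ?d g" for g using powr_pos by (simp add: conformal_derivative_def)
  have one_le: "1 \<le> b powr len g" for g :: "'a \<Rightarrow> 'a"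
    using b_gt_1 by (simp add: ge_one_powr_ge_zero)
  have B_le: "prob (B g) \<le> (Q * (b powr (2 * \<kappa> + 8 * \<sigma>)) powr \<delta>) *
      (?d g powr \<delta> * mass (\<Phi> (K * b powr len g) / ?d g))" if g: "g \<in> T" for g
  proof -
    have t: "0 < K * b powr len g" using K powr_pos by simp
    have scale: "c * \<Phi> (c * (K * b powr len g)) \<le> \<Phi> (K * b powr len g)"
      by (rule \<Phi>_scale[OF c t])
    have pos: "0 < \<Phi> (c * (K * b powr len g))" using t c by (intro \<Phi>_pos) auto
    have "\<Phi> (c * (K * b powr len g)) \<le> \<Phi> (K * b powr len g)"
      using scale mult_right_mono[OF c less_imp_le[OF pos]] by linarith
    also have "\<dots> \<le> \<Phi> K / b powr len g"
      using \<Phi>_scale[OF one_le K, of g] powr_pos[of "len g"] by (simp add: field_simps)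
    also have "\<dots> \<le> b powr (\<kappa> - len g)"
      using \<kappa>(2) powr_pos[of "len g"] by (simp add: powr_diff divide_right_mono)
    finally have "prob (B g) \<le> Q * (b powr (2 * \<kappa> + 8 * \<sigma>) * ?d g) powr \<delta>
        * mass (c * \<Phi> (c * (K * b powr len g)) / ?d g)"
      unfolding B_def c_def using T g \<kappa>(1) by (intro measure_ball_orbit_le) auto
    also have "\<dots> \<le> Q * (b powr (2 * \<kappa> + 8 * \<sigma>) * ?d g) powr \<delta> * mass (\<Phi> (K * b powr len g) / ?d g)"
      using scale d_pos[of g] Q_ge_1 by (intro mult_left_mono mass_mono divide_right_mono) auto
    finally show ?thesis using d_pos[of g] by (simp add: powr_mult ac_simps)
  qed
  define N where "N = approximated T - (\<Union>g\<in>G. {boundary_action g \<xi>})"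
  have orbit: "(\<Union>g\<in>G. {boundary_action g \<xi>}) \<in> null_sets \<mu>"
    using countable_G orbit_point_null by (intro null_sets_UN') auto
  have "N \<in> null_sets \<mu>"
  proof (rule null_sets_eventually_in_union[where B = B and T = T and
        f = "\<lambda>g. (Q * (b powr (2 * \<kappa> + 8 * \<sigma>)) powr \<delta>) *
          (?d g powr \<delta> * mass (\<Phi> (K * b powr len g) / ?d g))"])
    show "finite_measure \<mu>" by (rule finite_measure_axioms)
    show "countable T" by (rule countable_subset[OF T countable_G])
    show "N \<in> sets \<mu>" using orbit approximated_sets[OF T] by (auto simp: N_def)
    show "(\<lambda>g. (Q * (b powr (2 * \<kappa> + 8 * \<sigma>)) powr \<delta>) *
          (?d g powr \<delta> * mass (\<Phi> (K * b powr len g) / ?d g))) summable_on T"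
      using sum by (rule summable_on_cmult_right)
    fix F assume F: "finite F" "F \<subseteq> T"
    show "N \<subseteq> (\<Union>k\<in>T - F. B k)"
    proof
      fix \<eta> assume \<eta>: "\<eta> \<in> N"
      have \<eta>_in: "\<eta> \<in> gromov_boundary p" using \<eta> by (simp add: N_def approximated_def)
      \<comment> \<open>Off the orbit, \<open>\<eta>\<close> has positive distance to the finitely
        many centres from \<open>F\<close>. Once \<open>\<Phi>\<close> falls below \<open>e\<close>,
        the approximating element lies outside \<open>F\<close>.\<close>
      define e where "e = Min (insert 1 ((\<lambda>g. D (boundary_action g \<xi>) \<eta>) ` F))"
      have "0 < D (boundary_action g \<xi>) \<eta>" if "g \<in> F" for g
      proof -
        have "g \<in> G" using that F T by auto
        then have "boundary_action g \<xi> \<noteq> \<eta>" using \<eta> by (auto simp: N_def)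
        then show ?thesis
          using mdist_pos_less[OF _ act_in[OF \<open>g \<in> G\<close> \<xi>_in] \<eta>_in] by simp
      qed
      then have "0 < e" using F by (simp add: e_def)
      then obtain K1 where K1: "1 \<le> K1" "\<And>t. K1 \<le> t \<Longrightarrow> \<Phi> t < e" using \<Phi>_small by blast
      define K2 where "K2 = max K1 (c * K)"
      have "0 < K2" using K1(1) by (simp add: K2_def)
      then obtain g where g: "g \<in> T" "D (boundary_action g \<xi>) \<eta> \<le> \<Phi> (K2 * b powr len g)"
        using \<eta> unfolding N_def approximated_def by blast
      have "K2 \<le> K2 * b powr len g" using one_le[of g] \<open>0 < K2\<close> by simp
      then have "\<Phi> (K2 * b powr len g) < e" by (intro K1(2)) (simp add: K2_def)
      then have "D (boundary_action g \<xi>) \<eta> < e" using g(2) by simp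
      then have "g \<notin> F" using F unfolding e_def by (auto simp: Min_gr_iff)
      moreover have "\<Phi> (K2 * b powr len g) \<le> \<Phi> (c * (K * b powr len g))"
      proof -
        have "c * K * b powr len g \<le> K2 * b powr len g"
          by (intro mult_right_mono) (auto simp: K2_def)
        then show ?thesis using c K powr_pos by (intro \<Phi>_antimono) (auto simp: ac_simps)
      qed
      ultimately show "\<eta> \<in> (\<Union>k\<in>T - F. B k)"
        using g \<eta>_in T act_in[OF _ \<xi>_in, of g] by (intro UN_I[of g]) (auto simp: B_def)
    qed
  qed (use B_le in \<open>auto simp: B_def\<close>)
  then have "N \<union> (\<Union>g\<in>G. {boundary_action g \<xi>}) \<in> null_sets \<mu>" using orbit by (rule null_sets.Un)
  then show ?thesis
    by (rule null_sets_subset) (auto simp: N_def approximated_sets[OF T])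
qed

section \<open>Bounded parabolic points\<close>

text \<open>Write \<open>ginv g p = h y\<close> with \<open>y\<close> from \<open>S\<close> and put
  \<open>k = g \<circ> h\<close>. Then \<open>ginv k p = y\<close> keeps away from
  \<open>\<xi>\<close>, which bounds the product. As \<open>h\<close> preserves horospheres at
  \<open>\<xi>\<close> up to a constant, \<open>y\<close> has about the Busemann height of
  \<open>ginv g p\<close>; for points away from \<open>\<xi>\<close> this height determines the
  distance to \<open>p\<close>.\<close>

lemma bounded_parabolic_minimal:
  assumes "bounded_parabolic_point b p G \<xi>"
  shows "\<exists>t\<ge>0. \<exists>c\<ge>0. \<forall>g\<in>G. \<exists>k\<in>G. boundary_product p (ginv k p) \<xi> \<le> t \<and>
    boundary_action k \<xi> = boundary_action g \<xi> \<and> len k \<le> len g + c"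
proof -
  obtain S where S: "S \<subseteq> bordification p - {Inr \<xi>}"
      "Inr \<xi> \<notin> bordification_topology p closure_of S"
      "(\<lambda>g. Inl (g p)) ` G \<subseteq> (\<Union>h\<in>point_stabilizer G \<xi>. bordification_action h ` S)"
    using assms unfolding bounded_parabolic_point_def by blast
  obtain E where E: "1 \<le> E" "\<And>h. h \<in> point_stabilizer G \<xi> \<Longrightarrow> 1 / E \<le> conformal_derivative b p h \<xi>"
    using assms unfolding bounded_parabolic_point_def parabolic_fixed_point_def by blast
  \<comment> \<open>Lying outside a closure gives a separating neighbourhood only for points of the
    underlying topological space, so \<open>Inr \<xi>\<close> must be placed there first.\<close>
  have "openin (bordification_topology p) (bordification p)"
    unfolding openin_bordification_topology bordification_open_def
    by (auto simp: bordification_def intro: exI[of _ "1::real"])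
  then have "Inr \<xi> \<in> topspace (bordification_topology p)"
    using openin_subset[of "bordification_topology p" "bordification p"] \<xi>_in
    unfolding bordification_def by blast
  then obtain U where U: "Inr \<xi> \<in> U" "openin (bordification_topology p) U" "U \<inter> S = {}"
    using S(2) unfolding in_closure_of by blast
  then obtain t where t: "0 < t"
      "{y \<in> bordification p. ext_gromov_product p y (Inr \<xi>) > ereal t} \<subseteq> U"
    unfolding openin_bordification_topology bordification_open_def by blast
  have S_le: "boundary_product p y \<xi> \<le> t" if "Inl y \<in> S" for y
  proof (rule ccontr)
    assume "\<not> ?thesis"
    then have "ereal t < ext_gromov_product p (Inl y) (Inr \<xi>)"
      unfolding boundary_product_ereal(1)[OF \<xi>_in, symmetric] by simp
    moreover have "Inl y \<in> bordification p" by (simp add: bordification_def)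
    ultimately show False using t(2) U(3) that by blast
  qed
  \<comment> \<open>The errors of two \<open>busemann_estimate\<close>s and one
    \<open>busemann_cocycle\<close>, together with the product bound \<open>t\<close> and the
    derivative bound \<open>E\<close> of the stabilizer.\<close>
  define c where "c = 2 * t + 10 * C + 10 + log b E"
  have "0 \<le> log b E" using E(1) b_gt_1 by simp
  then have c: "0 \<le> c" using t(1) C_nonneg by (simp add: c_def)
  have "\<exists>k\<in>G. boundary_product p (ginv k p) \<xi> \<le> t \<and> boundary_action k \<xi> = boundary_action g \<xi>
      \<and> len k \<le> len g + c" if g: "g \<in> G" for g
  proof -
    have "Inl (ginv g p) \<in> (\<lambda>g. Inl (g p)) ` G" using inv_in_G[OF g] by blast
    then obtain h y where h: "h \<in> point_stabilizer G \<xi>" and y: "Inl y \<in> S" "h y = ginv g p"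
    proof -
      assume *: "\<And>h y. h \<in> point_stabilizer G \<xi> \<Longrightarrow> Inl y \<in> S \<Longrightarrow> h y = ginv g p \<Longrightarrow> thesis"
      assume "Inl (ginv g p) \<in> (\<lambda>g. Inl (g p)) ` G"
      then obtain h s where hs: "h \<in> point_stabilizer G \<xi>" "s \<in> S"
          "Inl (ginv g p) = bordification_action h s"
        using S(3) by blast
      show thesis
        using hs by (cases s) (auto simp: bordification_action_def intro: *)
    qed
    have hG: "h \<in> G" and h\<xi>: "boundary_action h \<xi> = \<xi>"
      using h by (auto simp: point_stabilizer_def)
    define k where "k = g \<circ> h"
    have kG: "k \<in> G" using comp_in_G[OF g hG] by (simp add: k_def)
    have "k y = p" using g y(2) by (simp add: k_def)
    then have ky: "ginv k p = y" using ginv_apply(2)[OF kG, of y] by simp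
    have dy: "dist p y = len k" using len_ginv[OF kG] ky by simp
    have dx: "dist p (ginv g p) = len g" using len_ginv[OF g] .
    have "1 / E \<le> b powr busemann \<xi> p (ginv h p)"
      using E(2)[OF h] by (simp add: conformal_derivative_def)
    then have "log b (1 / E) \<le> busemann \<xi> p (ginv h p)"
      using E(1) b_gt_1 by (simp add: log_le_iff)
    then have hder: "- log b E \<le> busemann \<xi> p (ginv h p)"
      using E(1) b_gt_1 by (simp add: log_divide)
    have "busemann \<xi> (ginv h p) y = busemann \<xi> p (ginv g p)"
      using busemann_isometry[OF isometry[OF hG] \<xi>_in, of "ginv h p" y] h\<xi> y(2) hG by simp
    then have "len k \<le> len g + c"
      using busemann_estimate[OF \<xi>_in, of p y] busemann_estimate[OF \<xi>_in, of p "ginv g p"]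
        busemann_cocycle[OF \<xi>_in, of p y "ginv h p"] hder S_le[OF y(1)] dy dx
        boundary_product_ereal(2)[OF \<xi>_in, of p "ginv g p"]
      unfolding c_def by linarith
    then show ?thesis
      using kG S_le[OF y(1)] ky h\<xi> by (intro bexI[of _ k]) (auto simp: k_def boundary_action_comp)
  qed
  then show ?thesis using t(1) c by (intro exI[of _ t] conjI exI[of _ c]) auto
qed

lemma approximated_null_parabolic:
  assumes par: "bounded_parabolic_point b p G \<xi>" and K: "0 < K"
    and sum: "(\<lambda>g. b powr (- \<delta> * len g) * mass (b powr len g * \<Phi> (K * b powr len g))) summable_on G"
  shows "approximated G \<in> null_sets \<mu>"
proof -
  obtain t c where t: "0 \<le> t" and c: "0 \<le> c" and min: "\<And>g. g \<in> G \<Longrightarrow> \<exists>k\<in>G.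
      boundary_product p (ginv k p) \<xi> \<le> t \<and> boundary_action k \<xi> = boundary_action g \<xi> \<and>
      len k \<le> len g + c"
    using bounded_parabolic_minimal[OF par] by blast
  define T where "T = {k \<in> G. boundary_product p (ginv k p) \<xi> \<le> t}"
  have T: "T \<subseteq> G" by (auto simp: T_def)
  let ?d = "\<lambda>g. conformal_derivative b p g \<xi>"
  have "approximated G \<subseteq> approximated T"
  proof
    fix \<eta> assume \<eta>: "\<eta> \<in> approximated G"
    have "\<exists>k\<in>T. D (boundary_action k \<xi>) \<eta> \<le> \<Phi> (L * b powr len k)" if L: "0 < L" for L
    proof -
      have "0 < L * b powr c" using L powr_pos by simp
      then obtain g where g: "g \<in> G" "D (boundary_action g \<xi>) \<eta> \<le> \<Phi> (L * b powr c * b powr len g)"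
        using \<eta> unfolding approximated_def by blast
      obtain k where k: "k \<in> T" "boundary_action k \<xi> = boundary_action g \<xi>" "len k \<le> len g + c"
        using min[OF g(1)] by (auto simp: T_def)
      have "\<Phi> (L * b powr (c + len g)) \<le> \<Phi> (L * b powr len k)"
        using k(3) L powr_pos by (intro \<Phi>_antimono mult_pos_pos mult_left_mono powr_le) auto
      then show ?thesis using g(2) k by (intro bexI[of _ k]) (simp_all add: powr_add ac_simps)
    qed
    then show "\<eta> \<in> approximated T" using \<eta> by (simp add: approximated_def)
  qed
  moreover have "approximated T \<in> null_sets \<mu>"
  proof (rule approximated_null[OF T])
    \<comment> \<open>Dividing by the derivative costs a factor \<open>b powr \<sigma>\<close> in
      the radius, which \<open>\<Phi>_scale\<close> absorbs when \<open>K\<close> becomes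
      \<open>s * K\<close>.\<close>
    define s where "s = b powr \<sigma>"
    have s: "1 \<le> s" using \<sigma>_nonneg b_gt_1 by (simp add: s_def ge_one_powr_ge_zero)
    show "0 < s * K" using s K by simp
    have "(\<lambda>g. b powr (- \<delta> * len g) * mass (b powr len g * \<Phi> (K * b powr len g))) summable_on T"
      using sum T by (rule summable_on_subset_banach)
    then have major: "(\<lambda>g. b powr ((2 * t + \<sigma>) * \<delta>) * (b powr (- \<delta> * len g) *
        mass (b powr len g * \<Phi> (K * b powr len g)))) summable_on T"
      by (rule summable_on_cmult_right)
    show "(\<lambda>g. ?d g powr \<delta> * mass (\<Phi> (s * K * b powr len g) / ?d g)) summable_on T"
    proof (rule summable_on_comparison_test[OF major])
      fix g assume g: "g \<in> T"
      have gG: "g \<in> G" and u: "boundary_product p (ginv g p) \<xi> \<le> t"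
        using g by (auto simp: T_def)
      note d = conformal_derivative_bounds[OF isometry[OF gG] \<xi>_in]
      have d_ge: "b powr (- len g - \<sigma>) \<le> ?d g"
        using d(1) powr_le[of "- len g - \<sigma>" "2 * boundary_product p (ginv g p) \<xi> - len g - \<sigma>"]
          boundary_product_ereal(2)[OF \<xi>_in, of p "ginv g p"] by linarith
      have d_le: "?d g \<le> b powr (2 * t + \<sigma> - len g)"
        using d(2) powr_le[of "2 * boundary_product p (ginv g p) \<xi> - len g + \<sigma>" "2 * t + \<sigma> - len g"] u
        by linarith
      have d_pos: "0 < ?d g" using d_ge powr_pos less_le_trans by blast
      have "?d g powr \<delta> \<le> (b powr (2 * t + \<sigma> - len g)) powr \<delta>"
        using d_le d_pos \<delta>_nonneg by (intro powr_mono2) auto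
      also have "\<dots> = b powr ((2 * t + \<sigma>) * \<delta>) * b powr (- \<delta> * len g)"
        unfolding powr_powr powr_add[symmetric]
        by (rule arg_cong[where f = "\<lambda>t. b powr t"]) algebra
      finally have 1: "?d g powr \<delta> \<le> b powr ((2 * t + \<sigma>) * \<delta>) * b powr (- \<delta> * len g)" .
      have pos: "0 < \<Phi> (s * K * b powr len g)" using s K powr_pos by (intro \<Phi>_pos) simp
      have "\<Phi> (s * K * b powr len g) / ?d g \<le> \<Phi> (s * K * b powr len g) / b powr (- len g - \<sigma>)"
        using d_ge pos powr_pos d_pos by (intro divide_left_mono) auto
      also have "\<dots> = b powr len g * (s * \<Phi> (s * (K * b powr len g)))"
        by (simp add: s_def powr_diff powr_minus field_simps)
      also have "\<dots> \<le> b powr len g * \<Phi> (K * b powr len g)"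
        using s K powr_pos by (intro mult_left_mono \<Phi>_scale) auto
      finally have 2: "mass (\<Phi> (s * K * b powr len g) / ?d g)
          \<le> mass (b powr len g * \<Phi> (K * b powr len g))"
        by (rule mass_mono)
      show "?d g powr \<delta> * mass (\<Phi> (s * K * b powr len g) / ?d g) \<le> b powr ((2 * t + \<sigma>) * \<delta>) *
          (b powr (- \<delta> * len g) * mass (b powr len g * \<Phi> (K * b powr len g)))"
        using mult_mono[OF 1 2] mass_nonneg by (simp add: mult.assoc)
    qed (simp add: mass_nonneg)
  qed
  ultimately show ?thesis
    using null_sets_subset[OF _ approximated_sets[OF order_refl]] by blast
qed

subsection \<open>Shadows\<close>

text \<open>The product never exceeds \<open>len g\<close>. Being within \<open>s\<close> of this
  bound replaces the requirement that a geodesic ray from \<open>p\<close> pass near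
  \<open>g p\<close>.\<close>

definition shadow :: "real \<Rightarrow> ('a \<Rightarrow> 'a) \<Rightarrow> (nat \<Rightarrow> 'a) set set" where
  "shadow s g = {\<eta> \<in> gromov_boundary p. len g - s \<le> boundary_product p (g p) \<eta>}"

lemma shadow_mono: "s \<le> s' \<Longrightarrow> shadow s g \<subseteq> shadow s' g"
  by (auto simp: shadow_def)

text \<open>Orbit points that share a shadow point lie near one ray from \<open>p\<close>, so their
  distance is nearly the difference of their lengths.\<close>

lemma shadow_meet:
  assumes "g \<in> G" "h \<in> G" "\<eta> \<in> shadow s g" "\<eta> \<in> shadow s h" "len g \<le> len h"
  shows "len (ginv g \<circ> h) \<le> len h - len g + 2 * s + 2 * \<sigma>"
proof -
  have "len g - s - (2 * C + 1) \<le> gromov_product p (g p) (h p)"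
    using assms by (intro boundary_product_hyperbolic[of \<eta>]) (auto simp: shadow_def)
  then have "len g - s - \<sigma> \<le> gromov_product p (g p) (h p)"
    using vis_nonneg C_nonneg by (simp add: \<sigma>_def)
  moreover have "2 * gromov_product p (g p) (h p) = len g + len h - dist (g p) (h p)"
    using gromov_product_double[of p "g p" "h p"] by (simp add: dist_commute)
  ultimately show ?thesis using len_comp_ginv[OF assms(1), of h] by linarith
qed

lemma shadow_diam:
  assumes "\<eta> \<in> shadow s g" "\<zeta> \<in> shadow s g"
  shows "D \<eta> \<zeta> \<le> b powr (\<sigma> + s - len g)"
  using visual_dist_le[of \<eta> \<zeta> "len g - s" "g p"] assms
  by (simp add: shadow_def algebra_simps)

lemma shadow_near:
  assumes "\<eta> \<in> shadow s g" "\<zeta> \<in> gromov_boundary p" "D \<eta> \<zeta> \<le> b powr (\<kappa> - len g)"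
    and "0 \<le> \<kappa>" "0 \<le> s"
  shows "\<zeta> \<in> shadow (s + \<kappa> + \<sigma>) g"
proof -
  have \<eta>: "\<eta> \<in> gromov_boundary p" "len g - s \<le> boundary_product p (g p) \<eta>"
    using assms(1) by (auto simp: shadow_def)
  have "b powr (\<kappa> - len g) \<le> b powr (- (len g - s - \<kappa>))"
    using assms(5) by (intro powr_le) simp
  then have "len g - s - \<kappa> - \<sigma> \<le> boundary_product p (g p) \<zeta>"
    using assms \<eta> by (intro boundary_product_near[OF \<eta>(1)]) auto
  then show ?thesis using assms(2) by (simp add: shadow_def)
qed

lemma inj_ginv_comp: "g \<in> G \<Longrightarrow> inj_on (\<lambda>h. ginv g \<circ> h) A"
  by (rule inj_onI) (metis fun.map_id comp_apply comp_assoc ext ginv_apply(1))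

text \<open>Translating by the inverse of a shortest element moves the family into one ball of the
  group, whose size depends neither on \<open>a\<close> nor on \<open>\<zeta>\<close>.\<close>

lemma shadow_card:
  assumes "finite H" "H \<subseteq> {h \<in> G. \<zeta> \<in> shadow s h \<and> a \<le> len h \<and> len h < a + 1}"
  shows "card H \<le> card {g \<in> G. len g \<le> 1 + 2 * s + 2 * \<sigma>}"
proof (cases "H = {}")
  case False
  define g where "g = arg_min_on len H"
  have g: "g \<in> H" "\<And>h. h \<in> H \<Longrightarrow> len g \<le> len h"
    unfolding g_def using arg_min_if_finite[OF assms(1) False, of len] by (auto simp: not_less)
  have "(\<lambda>h. ginv g \<circ> h) ` H \<subseteq> {g \<in> G. len g \<le> 1 + 2 * s + 2 * \<sigma>}"
  proof (intro image_subsetI CollectI conjI)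
    fix h assume h: "h \<in> H"
    show "ginv g \<circ> h \<in> G" using g(1) h assms(2) by (intro comp_in_G inv_in_G) auto
    have "len (ginv g \<circ> h) \<le> len h - len g + 2 * s + 2 * \<sigma>"
      using g h assms(2) by (intro shadow_meet[of g h \<zeta>]) auto
    moreover have "len h < a + 1" "a \<le> len g" using g(1) h assms(2) by auto
    ultimately show "len (ginv g \<circ> h) \<le> 1 + 2 * s + 2 * \<sigma>" by linarith
  qed
  moreover have "inj_on (\<lambda>h. ginv g \<circ> h) H" using g(1) assms(2) by (intro inj_ginv_comp) auto
  ultimately show ?thesis using finite_len_le by (intro card_inj_on_le)
qed simp

text \<open>Each unit layer of lengths has boundedly many elements, so the sum is dominated by a
  geometric series of ratio \<open>b powr (- \<delta>)\<close>, which is below \<open>1\<close> as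
  \<open>\<delta>\<close> is positive.\<close>

lemma shadow_sum:
  assumes \<delta>: "0 < \<delta>"
  shows "\<exists>M\<ge>0. \<forall>\<zeta> a H. finite H \<longrightarrow> H \<subseteq> {h \<in> G. \<zeta> \<in> shadow s h \<and> a \<le> len h} \<longrightarrow>
    (\<Sum>h\<in>H. b powr (- \<delta> * len h)) \<le> M * b powr (- \<delta> * a)"
proof -
  define m where "m = real (card {g \<in> G. len g \<le> 1 + 2 * s + 2 * \<sigma>})"
  define q where "q = b powr (- \<delta>)"
  have q: "0 < q" "q < 1" using \<delta> b_gt_1 powr_less_mono[of "- \<delta>" 0 b] by (simp_all add: q_def)
  have "(\<Sum>h\<in>H. b powr (- \<delta> * len h)) \<le> m / (1 - q) * b powr (- \<delta> * a)"
    if H: "finite H" "H \<subseteq> {h \<in> G. \<zeta> \<in> shadow s h \<and> a \<le> len h}" for \<zeta> a H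
  proof -
    define n where "n h = nat \<lfloor>len h - a\<rfloor>" for h :: "'a \<Rightarrow> 'a"
    have n: "a + real (n h) \<le> len h" "len h < a + real (n h) + 1" if "h \<in> H" for h
    proof -
      have "0 \<le> len h - a" using that H(2) by auto
      then have "real (n h) = of_int \<lfloor>len h - a\<rfloor>" by (simp add: n_def)
      then show "a + real (n h) \<le> len h" "len h < a + real (n h) + 1"
        using floor_correct[of "len h - a"] by linarith+
    qed
    have "(\<Sum>h\<in>H. b powr (- \<delta> * len h)) = (\<Sum>i\<in>n ` H. \<Sum>h | h \<in> H \<and> n h = i. b powr (- \<delta> * len h))"
      by (rule sum.image_gen[OF H(1)])
    also have "\<dots> \<le> (\<Sum>i\<in>n ` H. m * b powr (- \<delta> * a) * q ^ i)"
    proof (rule sum_mono)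
      fix i
      let ?H = "{h \<in> H. n h = i}"
      have "?H \<subseteq> {h \<in> G. \<zeta> \<in> shadow s h \<and> a + real i \<le> len h \<and> len h < (a + real i) + 1}"
        using H(2) n by auto
      then have card: "real (card ?H) \<le> m"
        using shadow_card[of ?H \<zeta> s "a + real i"] H(1) by (simp add: m_def)
      have "(\<Sum>h\<in>?H. b powr (- \<delta> * len h)) \<le> (\<Sum>h\<in>?H. b powr (- \<delta> * (a + real i)))"
        using n \<delta> by (intro sum_mono powr_le) auto
      also have "\<dots> \<le> m * b powr (- \<delta> * (a + real i))"
        using card by (simp add: mult_right_mono)
      also have "b powr (- \<delta> * (a + real i)) = b powr (- \<delta> * a) * q ^ i"
        unfolding q_def using b_gt_1
        by (simp add: powr_add[symmetric] powr_realpow[symmetric] powr_powr algebra_simps)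
      finally show "(\<Sum>h | h \<in> H \<and> n h = i. b powr (- \<delta> * len h)) \<le> m * b powr (- \<delta> * a) * q ^ i"
        by (simp add: mult.assoc)
    qed
    also have "\<dots> = m * b powr (- \<delta> * a) * (\<Sum>i\<in>n ` H. q ^ i)"
      by (simp add: sum_distrib_left)
    also have "\<dots> \<le> m * b powr (- \<delta> * a) * (1 / (1 - q))"
    proof (rule mult_left_mono)
      have "(\<Sum>i\<in>n ` H. q ^ i) \<le> (\<Sum>i. q ^ i)"
        using q H(1) by (intro sum_le_suminf summable_geometric) auto
      then show "(\<Sum>i\<in>n ` H. q ^ i) \<le> 1 / (1 - q)" using q by (simp add: suminf_geometric)
      show "0 \<le> m * b powr (- \<delta> * a)" by (simp add: m_def)
    qed
    finally show ?thesis by (simp add: ac_simps)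
  qed
  moreover have "0 \<le> m / (1 - q)" using q by (simp add: m_def)
  ultimately show ?thesis by blast
qed

section \<open>Masses of shadows and of contracted balls\<close>

text \<open>The lower half of Sullivan's shadow lemma. Points that \<open>g\<close> may fail to
  bring into the shadow lie in the direction of \<open>ginv g p\<close>, hence in a small ball. Its
  complement has definite mass, and \<open>g\<close> contracts mass by no more than about
  \<open>b powr (- \<delta> * len g)\<close>.\<close>

lemma shadow_lower:
  assumes mass_pos: "\<And>r. 0 < r \<Longrightarrow> 0 < mass r"
  shows "\<exists>s\<ge>0. \<exists>c>0. \<forall>g\<in>G. \<exists>T\<in>sets \<mu>. T \<subseteq> shadow s g \<and> c * b powr (- \<delta> * len g) \<le> prob T"
proof -
  obtain r where r: "0 < r" "mass r < 1"
  proof -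
    have "(\<lambda>n. prob (mcball \<xi> (1 / real (Suc n)))) \<longlonglongrightarrow> prob (\<Inter>n. mcball \<xi> (1 / real (Suc n)))"
      by (intro finite_Lim_measure_decseq)
        (auto simp: decseq_def intro!: mcball_subset_concentric divide_left_mono)
    moreover have "(\<Inter>n. mcball \<xi> (1 / real (Suc n))) = {\<xi>}"
    proof (intro equalityI subsetI)
      fix \<eta> assume \<eta>: "\<eta> \<in> (\<Inter>n. mcball \<xi> (1 / real (Suc n)))"
      then have "\<eta> \<in> gromov_boundary p" "\<And>n. D \<xi> \<eta> \<le> 1 / real (Suc n)" by auto
      then have "D \<xi> \<eta> \<le> 0"
        by (intro LIMSEQ_le_const[OF LIMSEQ_inverse_real_of_nat]) (auto simp: inverse_eq_divide)
      then show "\<eta> \<in> {\<xi>}"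
        using zero[OF \<xi>_in \<open>\<eta> \<in> gromov_boundary p\<close>] nonneg[of \<xi> \<eta>] by auto
    qed (use \<xi>_in in auto)
    ultimately have "(\<lambda>n. mass (1 / real (Suc n))) \<longlonglongrightarrow> 0"
      using \<mu>_\<xi> by (simp add: ball_mass_def)
    then have "\<forall>\<^sub>F n in sequentially. mass (1 / real (Suc n)) < 1"
      by (rule order_tendstoD) simp
    then obtain n where "mass (1 / real (Suc n)) < 1"
      by (auto simp: eventually_sequentially)
    then show thesis using that[of "1 / real (Suc n)"] by simp
  qed
  define e where "e = min (mass (r / 6)) (1 - mass r)"
  have e: "0 < e" using mass_pos[of "r / 6"] r by (simp add: e_def)
  \<comment> \<open>A ball of radius \<open>r / 6\<close> centred near \<open>\<xi>\<close> lies in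
    \<open>mcball \<xi> r\<close>, which does not have full mass; one centred farther away misses
    \<open>mcball \<xi> (r / 6)\<close>, which has positive mass.\<close>
  have compl: "e \<le> prob (space \<mu> - mcball \<eta> (r / 6))" if \<eta>: "\<eta> \<in> gromov_boundary p" for \<eta>
  proof (cases "D \<eta> \<xi> \<le> r / 3")
    case True
    have "mcball \<eta> (r / 6) \<subseteq> mcball \<xi> r"
      using True r(1) \<xi>_in by (intro mcball_subset) auto
    then have "prob (mcball \<eta> (r / 6)) \<le> mass r"
      unfolding ball_mass_def by (intro finite_measure_mono mcball_sets)
    then show ?thesis by (simp add: prob_compl[OF mcball_sets] e_def)
  next
    case False
    have "mcball \<xi> (r / 6) \<subseteq> space \<mu> - mcball \<eta> (r / 6)"
    proof
      fix \<zeta> assume \<zeta>: "\<zeta> \<in> mcball \<xi> (r / 6)"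
      then have "D \<eta> \<xi> \<le> D \<eta> \<zeta> + D \<xi> \<zeta>"
        using triangle[of \<eta> \<zeta> \<xi>] \<eta> \<xi>_in commute[of \<zeta> \<xi>] by simp
      then show "\<zeta> \<in> space \<mu> - mcball \<eta> (r / 6)" using False \<zeta> space_\<mu> by auto
    qed
    then have "mass (r / 6) \<le> prob (space \<mu> - mcball \<eta> (r / 6))"
      unfolding ball_mass_def
      by (intro finite_measure_mono sets.compl_sets mcball_sets)
    then show ?thesis by (simp add: e_def)
  qed
  \<comment> \<open>Two boundary points whose products with the same point exceed \<open>s\<close>
    are within \<open>r / 6\<close> of each other.\<close>
  define s where "s = max 0 (\<sigma> - log b (r / 6))"
  have s: "0 \<le> s" "b powr (\<sigma> - s) \<le> r / 6"
  proof -
    show "0 \<le> s" by (simp add: s_def)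
    have "b powr (\<sigma> - s) \<le> b powr log b (r / 6)" by (intro powr_le) (simp add: s_def)
    then show "b powr (\<sigma> - s) \<le> r / 6" using r(1) b_gt_1 by simp
  qed
  have "\<exists>T\<in>sets \<mu>. T \<subseteq> shadow (s + \<sigma>) g \<and> (b powr (- \<sigma> * \<delta>) * e / Q) * b powr (- \<delta> * len g) \<le> prob T"
    if g: "g \<in> G" for g
  proof -
    obtain A where A: "A \<in> sets \<mu>" "e \<le> prob A"
      "\<And>\<eta>. \<eta> \<in> A \<Longrightarrow> boundary_product p (ginv g p) \<eta> \<le> s"
    proof (cases "\<exists>\<eta>\<in>gromov_boundary p. s < boundary_product p (ginv g p) \<eta>")
      case True
      then obtain \<zeta> where \<zeta>: "\<zeta> \<in> gromov_boundary p" "s < boundary_product p (ginv g p) \<zeta>" by blast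
      have "boundary_product p (ginv g p) \<eta> \<le> s" if \<eta>: "\<eta> \<in> space \<mu> - mcball \<zeta> (r / 6)" for \<eta>
      proof (rule ccontr)
        assume "\<not> ?thesis"
        then have "D \<zeta> \<eta> \<le> b powr (\<sigma> - s)"
          using \<eta> \<zeta> space_\<mu> by (intro visual_dist_le[of _ _ _ "ginv g p"]) auto
        then show False using \<eta> \<zeta> s(2) space_\<mu> by auto
      qed
      then show thesis using that[of "space \<mu> - mcball \<zeta> (r / 6)"] compl[OF \<zeta>(1)] by auto
    next
      case False
      have "e \<le> 1" using mass_nonneg[of r] by (simp add: e_def)
      then have "e \<le> prob (space \<mu>)" by (simp add: prob_space)
      then show thesis using False space_\<mu> by (intro that[OF sets.top]) (auto simp: not_less)
    qed
    have A_sub: "A \<subseteq> gromov_boundary p" using sets.sets_into_space[OF A(1)] space_\<mu> by simp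
    have "boundary_action g ` A \<subseteq> shadow (s + \<sigma>) g"
    proof
      fix \<eta> assume "\<eta> \<in> boundary_action g ` A"
      then obtain \<zeta> where \<zeta>: "\<zeta> \<in> A" "\<eta> = boundary_action g \<zeta>" by blast
      then show "\<eta> \<in> shadow (s + \<sigma>) g"
        using boundary_product_dual_len(2)[OF g, of \<zeta>] A(3)[of \<zeta>] A_sub act_in[OF g, of \<zeta>]
        by (auto simp: shadow_def)
    qed
    moreover have "(b powr (- \<sigma> * \<delta>) * e / Q) * b powr (- \<delta> * len g) \<le> prob (boundary_action g ` A)"
    proof -
      have "b powr (- \<sigma> - len g) \<le> conformal_derivative b p g \<eta>" if "\<eta> \<in> A" for \<eta>
        using conformal_derivative_bounds(1)[OF isometry[OF g], of \<eta>] that A_sub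
          boundary_product_ereal(2)[of \<eta> p "ginv g p"]
          powr_le[of "- \<sigma> - len g" "2 * boundary_product p (ginv g p) \<eta> - len g - \<sigma>"]
        by fastforce
      then have "(b powr (- \<sigma> - len g)) powr \<delta> * prob A / Q \<le> prob (boundary_action g ` A)"
        by (intro measure_act_lower[OF g A(1)]) auto
      moreover have "(b powr (- \<sigma> - len g)) powr \<delta> = b powr (- \<sigma> * \<delta>) * b powr (- \<delta> * len g)"
        unfolding powr_powr powr_add[symmetric]
        by (rule arg_cong[where f = "\<lambda>t. b powr t"]) algebra
      moreover have "b powr (- \<sigma> * \<delta>) * b powr (- \<delta> * len g) * e / Q
          \<le> b powr (- \<sigma> * \<delta>) * b powr (- \<delta> * len g) * prob A / Q"
        using A(2) Q_ge_1 by (intro divide_right_mono mult_left_mono) auto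
      ultimately show ?thesis by (simp add: ac_simps)
    qed
    ultimately show ?thesis using act_image_sets[OF g A(1)] by blast
  qed
  moreover have "0 < b powr (- \<sigma> * \<delta>) * e / Q" using e Q_ge_1 powr_pos by simp
  ultimately show ?thesis
    using s(1) \<sigma>_nonneg by (intro exI[of _ "s + \<sigma>"] conjI exI[of _ "b powr (- \<sigma> * \<delta>) * e / Q"]) auto
qed

text \<open>Since \<open>g\<^sup>-\<^sup>1(p)\<close> cannot look close to both \<open>\<xi>\<close> and \<open>f(\<xi>)\<close>, one of \<open>g\<close> and
  \<open>g f\<close> has derivative comparable to \<open>b\<^sup>-\<^sup>|\<^sup>g\<^sup>|\<close> near \<open>\<xi>\<close>.\<close>

lemma contracting_translate:
  assumes f: "f \<in> G" "boundary_action f \<xi> \<noteq> \<xi>"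
  shows "\<exists>v. \<forall>g\<in>G. \<exists>k\<in>G. dist (g p) (k p) \<le> len f \<and> boundary_product p (ginv k p) \<xi> \<le> v"
proof -
  have f\<xi>: "boundary_action f \<xi> \<in> gromov_boundary p" by (rule act_in[OF f(1) \<xi>_in])
  define d where "d = D \<xi> (boundary_action f \<xi>)"
  have d: "0 < d"
    using f(2) zero[OF \<xi>_in f\<xi>] nonneg[of \<xi> "boundary_action f \<xi>"]
    unfolding d_def by (metis order_less_le)
  \<comment> \<open>If both products exceeded \<open>m + 1\<close>, \<open>visual_dist_le\<close>
    would put \<open>\<xi>\<close> and \<open>f(\<xi>)\<close> closer together than
    \<open>d\<close>.\<close>
  define m where "m = \<sigma> - log b d"
  define v where "v = m + 1 + len f + \<sigma>"
  have "\<exists>k\<in>G. dist (g p) (k p) \<le> len f \<and> boundary_product p (ginv k p) \<xi> \<le> v" if g: "g \<in> G" for g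
  proof (cases "boundary_product p (ginv g p) \<xi> \<le> m + 1")
    case True
    then have "boundary_product p (ginv g p) \<xi> \<le> v"
      using \<sigma>_nonneg zero_le_dist[of p "f p"] unfolding v_def by linarith
    then show ?thesis using g by (intro bexI[of _ g]) auto
  next
    case False
    have less: "boundary_product p (ginv g p) (boundary_action f \<xi>) \<le> m + 1"
    proof (rule ccontr)
      assume "\<not> ?thesis"
      then have "d \<le> b powr (\<sigma> - (m + 1))"
        unfolding d_def using False by (intro visual_dist_le[OF \<xi>_in f\<xi>, of _ "ginv g p"]) auto
      also have "\<dots> < b powr log b d" using b_gt_1 by (intro powr_less_mono) (auto simp: m_def)
      finally show False using d b_gt_1 by simp
    qed
    define k where "k = g \<circ> f"
    have k: "k \<in> G" using comp_in_G[OF g f(1)] by (simp add: k_def)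
    have "f (ginv k p) = ginv g p"
    proof -
      have "g (f (ginv k p)) = p" using ginv_apply(1)[OF k, of p] by (simp add: k_def)
      then show ?thesis using ginv_apply(2)[OF g, of "f (ginv k p)"] by simp
    qed
    then have "boundary_product p (ginv k p) \<xi> = boundary_product (f p) (ginv g p) (boundary_action f \<xi>)"
      using boundary_product_isometry[OF isometry[OF f(1)] \<xi>_in, of p "ginv k p"] by simp
    also have "\<dots> \<le> boundary_product p (ginv g p) (boundary_action f \<xi>) + len f + \<sigma>"
      using boundary_product_lipschitz_base[OF f\<xi>, of "f p" "ginv g p" p]
        dist_commute[of p "f p"] vis_nonneg C_nonneg unfolding \<sigma>_def by linarith
    finally have "boundary_product p (ginv k p) \<xi> \<le> v" using less by (simp add: v_def)
    moreover have "dist (g p) (k p) = len f" using g by (simp add: k_def)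
    ultimately show ?thesis using k by (intro bexI[of _ k]) auto
  qed
  then show ?thesis by blast
qed

text \<open>The radius is so small that all points of the ball inherit from \<open>\<xi>\<close> a
  bounded product with \<open>ginv k p\<close>. Thus \<open>k\<close> contracts the whole ball by
  about \<open>b powr (- len g)\<close>; the three claims locate the image, bound its extent and
  bound its mass from below.\<close>

lemma contracted_ball:
  assumes g: "g \<in> G" and k: "k \<in> G" and gk: "dist (g p) (k p) \<le> l"
    and v: "boundary_product p (ginv k p) \<xi> \<le> v" and r: "r \<le> b powr (- (v + \<sigma> + 1))"
  shows "boundary_action k ` mcball \<xi> r \<subseteq> shadow (v + 3 * \<sigma> + 2 * l) g"
    and "boundary_action k ` mcball \<xi> r
      \<subseteq> mcball (boundary_action k \<xi>) (b powr (2 * v + 2 * \<sigma> + l) * (r * b powr (- len g)))"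
    and "b powr (- (\<sigma> + l) * \<delta>) / Q * (b powr (- \<delta> * len g) * mass r)
      \<le> prob (boundary_action k ` mcball \<xi> r)"
proof -
  have len: "len k \<le> len g + l" "len g \<le> len k + l"
    using gk dist_triangle[of p "k p" "g p"] dist_triangle[of p "g p" "k p"] dist_commute[of "g p" "k p"]
    by linarith+
  have small: "boundary_product p (ginv k p) \<eta> \<le> v + \<sigma>" if \<eta>: "\<eta> \<in> mcball \<xi> r" for \<eta>
  proof (rule ccontr)
    assume *: "\<not> ?thesis"
    \<comment> \<open>Capped at \<open>v + \<sigma> + 1\<close>, the largest value for which the
      radius permits \<open>boundary_product_near\<close>.\<close>
    define m where "m = min (v + \<sigma> + 1) (boundary_product p (ginv k p) \<eta>)"
    have \<eta>_in: "\<eta> \<in> gromov_boundary p" "D \<eta> \<xi> \<le> r" using \<eta> commute[of \<eta> \<xi>] by auto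
    have m: "v + \<sigma> < m" "m \<le> v + \<sigma> + 1" "m \<le> boundary_product p (ginv k p) \<eta>"
      using * by (auto simp: m_def)
    have "D \<eta> \<xi> \<le> b powr (- m)"
      using \<eta>_in(2) r powr_le[of "- (v + \<sigma> + 1)" "- m"] m(2) by linarith
    then have "m - \<sigma> \<le> boundary_product p (ginv k p) \<xi>"
      using m(3) by (intro boundary_product_near[OF \<eta>_in(1) \<xi>_in])
    then show False using v m(1) by linarith
  qed
  have v_nonneg: "0 \<le> v" using v boundary_product_ereal(2)[OF \<xi>_in, of p "ginv k p"] by linarith
  show "boundary_action k ` mcball \<xi> r \<subseteq> shadow (v + 3 * \<sigma> + 2 * l) g"
  proof
    fix \<eta> assume "\<eta> \<in> boundary_action k ` mcball \<xi> r"
    then obtain \<zeta> where \<zeta>: "\<zeta> \<in> mcball \<xi> r" "\<eta> = boundary_action k \<zeta>" by blast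
    then have \<zeta>_in: "\<zeta> \<in> gromov_boundary p" and \<eta>_in: "\<eta> \<in> gromov_boundary p"
      using act_in[OF k, of \<zeta>] by auto
    have "len k - (v + \<sigma>) - \<sigma> \<le> boundary_product p (k p) \<eta>"
      using boundary_product_dual_len(2)[OF k \<zeta>_in] small[OF \<zeta>(1)] \<zeta>(2) by simp
    moreover have "boundary_product p (k p) \<eta> \<le> boundary_product p (g p) \<eta> + l + \<sigma>"
      using boundary_product_lipschitz[OF \<eta>_in, of p "k p" "g p"] gk dist_commute[of "g p" "k p"]
        vis_nonneg C_nonneg unfolding \<sigma>_def by linarith
    ultimately have "len g - (v + 3 * \<sigma> + 2 * l) \<le> boundary_product p (g p) \<eta>"
      using len by linarith
    then show "\<eta> \<in> shadow (v + 3 * \<sigma> + 2 * l) g" using \<eta>_in by (simp add: shadow_def)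
  qed
  show "boundary_action k ` mcball \<xi> r
      \<subseteq> mcball (boundary_action k \<xi>) (b powr (2 * v + 2 * \<sigma> + l) * (r * b powr (- len g)))"
  proof
    fix \<eta> assume "\<eta> \<in> boundary_action k ` mcball \<xi> r"
    then obtain \<zeta> where \<zeta>: "\<zeta> \<in> mcball \<xi> r" "\<eta> = boundary_action k \<zeta>" by blast
    have \<zeta>_in: "\<zeta> \<in> gromov_boundary p" "D \<xi> \<zeta> \<le> r" using \<zeta>(1) by auto
    have "D (boundary_action k \<xi>) \<eta> \<le> b powr (\<sigma> + boundary_product p (ginv k p) \<xi>
        + boundary_product p (ginv k p) \<zeta> - len k) * D \<xi> \<zeta>"
      unfolding \<zeta>(2) by (rule visual_dist_isometry[OF isometry[OF k] \<xi>_in \<zeta>_in(1)])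
    also have "\<dots> \<le> b powr (2 * v + 2 * \<sigma> + l - len g) * r"
      using v small[OF \<zeta>(1)] len \<zeta>_in(2) by (intro mult_mono powr_le) auto
    also have "\<dots> = b powr (2 * v + 2 * \<sigma> + l) * (r * b powr (- len g))"
      by (simp add: powr_diff powr_minus_divide)
    finally show "\<eta> \<in> mcball (boundary_action k \<xi>) (b powr (2 * v + 2 * \<sigma> + l) * (r * b powr (- len g)))"
      using act_in[OF k] \<xi>_in \<zeta>_in(1) \<zeta>(2) by simp
  qed
  have "b powr (- (\<sigma> + l) - len g) \<le> conformal_derivative b p k \<eta>" if \<eta>: "\<eta> \<in> mcball \<xi> r" for \<eta>
  proof -
    have \<eta>_in: "\<eta> \<in> gromov_boundary p" using \<eta> by simp
    have "- (\<sigma> + l) - len g \<le> 2 * boundary_product p (ginv k p) \<eta> - len k - \<sigma>"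
      using len boundary_product_ereal(2)[OF \<eta>_in, of p "ginv k p"] by linarith
    from powr_le[OF this] conformal_derivative_bounds(1)[OF isometry[OF k] \<eta>_in]
    show ?thesis by linarith
  qed
  then have "(b powr (- (\<sigma> + l) - len g)) powr \<delta> * prob (mcball \<xi> r) / Q
      \<le> prob (boundary_action k ` mcball \<xi> r)"
    by (intro measure_act_lower[OF k mcball_sets]) auto
  moreover have "(b powr (- (\<sigma> + l) - len g)) powr \<delta> = b powr (- (\<sigma> + l) * \<delta>) * b powr (- \<delta> * len g)"
    unfolding powr_powr powr_add[symmetric]
        by (rule arg_cong[where f = "\<lambda>t. b powr t"]) algebra
  ultimately show "b powr (- (\<sigma> + l) * \<delta>) / Q * (b powr (- \<delta> * len g) * mass r)
      \<le> prob (boundary_action k ` mcball \<xi> r)"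
    by (simp add: ball_mass_def)
qed

subsection \<open>The divergence case\<close>

text \<open>Every \<open>h\<close> in the family factors as \<open>h = i k\<close>, where \<open>i\<close> runs over the indices of a maximal
  disjoint subfamily of shadows and \<open>|k| \<le> |h|\<close>, \<open>|h| \<ge> |i| + |k| - const\<close>. No constant is lost inside
  the decreasing weight \<open>w\<close>, which matters because the masses of balls need not be doubling.\<close>

lemma sum_shadow_orbit_le:
  fixes w :: "real \<Rightarrow> real"
  assumes H: "finite H" "H \<subseteq> G"
    and len_ge: "\<And>h. h \<in> H \<Longrightarrow> 2 * s + 2 * \<sigma> \<le> len h" and len_le: "\<And>h. h \<in> H \<Longrightarrow> len h \<le> R"
    and T: "\<And>h. h \<in> H \<Longrightarrow> T h \<in> sets \<mu>" "\<And>h. h \<in> H \<Longrightarrow> T h \<subseteq> shadow s h"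
      "\<And>h. h \<in> H \<Longrightarrow> T h \<subseteq> E"
      "\<And>h. h \<in> H \<Longrightarrow> c * b powr (- \<delta> * len h) \<le> prob (T h)"
    and c: "0 < c" and E: "E \<in> sets \<mu>"
    and w: "\<And>t. 0 \<le> w t" "\<And>t t'. t \<le> t' \<Longrightarrow> w t' \<le> w t"
  shows "(\<Sum>h\<in>H. b powr (- \<delta> * len h) * w (len h))
    \<le> b powr (\<delta> * (2 * s + 2 * \<sigma>)) / c * prob E *
      (\<Sum>k\<in>{g \<in> G. len g \<le> R}. b powr (- \<delta> * len k) * w (len k))"
proof -
  let ?f = "\<lambda>k. b powr (- \<delta> * len k) * w (len k)"
  define S where "S = (\<Sum>k\<in>{g \<in> G. len g \<le> R}. ?f k)"
  define B where "B = b powr (\<delta> * (2 * s + 2 * \<sigma>))"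
  have S: "0 \<le> S" unfolding S_def using w(1) by (intro sum_nonneg) auto
  have B: "0 < B" unfolding B_def by (rule powr_pos)
  have nonempty: "\<forall>h\<in>H. T h \<noteq> {}"
  proof (intro ballI notI)
    fix h assume "h \<in> H"
    assume "T h = {}"
    then have "c * b powr (- \<delta> * len h) \<le> 0" using T(4)[OF \<open>h \<in> H\<close>] by simp
    then show False using c powr_pos[of "- \<delta> * len h"] by (simp add: mult_le_0_iff)
  qed
  obtain I \<pi> where I: "I \<subseteq> H" "disjoint_family_on T I"
    and \<pi>: "\<And>h. h \<in> H \<Longrightarrow> \<pi> h \<in> I \<and> T (\<pi> h) \<inter> T h \<noteq> {} \<and> len (\<pi> h) \<le> len h"
    by (rule greedy_disjoint_map[where V = T and N = len, OF H(1) nonempty]) (rule that)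
  have "finite I" using I(1) H(1) by (rule finite_subset)
  have part: "(\<Sum>h | h \<in> H \<and> \<pi> h = i. ?f h) \<le> B * b powr (- \<delta> * len i) * S" if i: "i \<in> I" for i
  proof -
    let ?H = "{h \<in> H. \<pi> h = i}"
    have iG: "i \<in> G" using i I(1) H(2) by blast
    have "(\<Sum>h\<in>?H. ?f h) \<le> (\<Sum>h\<in>?H. B * b powr (- \<delta> * len i) * ?f (ginv i \<circ> h))"
    proof (rule sum_mono)
      fix h assume h: "h \<in> ?H"
      obtain \<eta> where "\<eta> \<in> T i" "\<eta> \<in> T h" using \<pi>[of h] h by blast
      then have l: "len (ginv i \<circ> h) \<le> len h - len i + 2 * s + 2 * \<sigma>"
        using \<pi>[of h] h H(2) iG T(2) i I(1) by (intro shadow_meet[of i h \<eta>]) auto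
      have "- (\<delta> * len h) \<le> \<delta> * (2 * s + 2 * \<sigma>) - \<delta> * len i - \<delta> * len (ginv i \<circ> h)"
        using mult_left_mono[OF l \<delta>_nonneg] by (simp add: algebra_simps)
      then have "b powr (- \<delta> * len h) \<le> B * b powr (- \<delta> * len i) * b powr (- \<delta> * len (ginv i \<circ> h))"
        unfolding B_def by (simp only: powr_add[symmetric]) (intro powr_le, simp)
      \<comment> \<open>The lower bound on \<open>len i\<close> cancels the error of
        \<open>shadow_meet\<close>, so \<open>ginv i \<circ> h\<close> is no longer than
        \<open>h\<close>. The same bound keeps it in the range of the sum \<open>S\<close>.\<close>
      moreover have "w (len h) \<le> w (len (ginv i \<circ> h))"
        using l len_ge[of i] i I(1) by (intro w(2)) auto
      ultimately have "?f h \<le> (B * b powr (- \<delta> * len i) * b powr (- \<delta> * len (ginv i \<circ> h)))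
          * w (len (ginv i \<circ> h))"
        using w(1) B by (intro mult_mono) auto
      then show "?f h \<le> B * b powr (- \<delta> * len i) * ?f (ginv i \<circ> h)" by (simp only: mult.assoc)
    qed
    also have "\<dots> = B * b powr (- \<delta> * len i) * (\<Sum>k\<in>(\<lambda>h. ginv i \<circ> h) ` ?H. ?f k)"
      by (simp add: sum.reindex[OF inj_ginv_comp[OF iG]] sum_distrib_left)
    also have "\<dots> \<le> B * b powr (- \<delta> * len i) * S"
    proof (intro mult_left_mono)
      have "(\<lambda>h. ginv i \<circ> h) ` ?H \<subseteq> {g \<in> G. len g \<le> R}"
      proof (intro image_subsetI CollectI conjI)
        fix h assume h: "h \<in> ?H"
        show "ginv i \<circ> h \<in> G" using h H(2) iG by (intro comp_in_G inv_in_G) auto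
        obtain \<eta> where "\<eta> \<in> T i" "\<eta> \<in> T h" using \<pi>[of h] h by blast
        then have l: "len (ginv i \<circ> h) \<le> len h - len i + 2 * s + 2 * \<sigma>"
          using \<pi>[of h] h H(2) iG T(2) i I(1) by (intro shadow_meet[of i h \<eta>]) auto
        then show "len (ginv i \<circ> h) \<le> R"
          using len_ge[of i] len_le[of h] i h I(1) by fastforce
      qed
      then show "(\<Sum>k\<in>(\<lambda>h. ginv i \<circ> h) ` ?H. ?f k) \<le> S"
        unfolding S_def using w(1) finite_len_le by (intro sum_mono2) auto
    qed (use B in simp)
    finally show ?thesis .
  qed
  have "(\<Sum>h\<in>H. ?f h) = (\<Sum>i\<in>I. \<Sum>h | h \<in> H \<and> \<pi> h = i. ?f h)"
    using \<pi> by (intro sum.group[symmetric] H(1) \<open>finite I\<close>) auto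
  also have "\<dots> \<le> (\<Sum>i\<in>I. B * b powr (- \<delta> * len i) * S)" by (rule sum_mono) (rule part)
  \<comment> \<open>The lower mass bound turns the sum over \<open>I\<close> into the mass of a
    disjoint union inside \<open>E\<close>; this produces the small factor.\<close>
  also have "\<dots> \<le> (\<Sum>i\<in>I. B / c * S * prob (T i))"
  proof (rule sum_mono)
    fix i assume "i \<in> I"
    then have "b powr (- \<delta> * len i) \<le> prob (T i) / c"
      using T(4)[of i] I(1) c by (auto simp: field_simps)
    then have "(B * S) * b powr (- \<delta> * len i) \<le> (B * S) * (prob (T i) / c)"
      using B S by (intro mult_left_mono) auto
    then show "B * b powr (- \<delta> * len i) * S \<le> B / c * S * prob (T i)" by (simp add: ac_simps)
  qed
  also have "\<dots> = B / c * S * prob (\<Union>i\<in>I. T i)"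
    using I(1,2) T(1) \<open>finite I\<close>
    by (subst finite_measure_finite_Union) (auto simp: sum_distrib_left)
  also have "\<dots> \<le> B / c * S * prob E"
    using B c S T(3) I(1) E by (intro mult_left_mono finite_measure_mono) auto
  finally show ?thesis by (simp add: B_def S_def ac_simps)
qed

text \<open>All \<open>h\<close> that are not absorbed by the target of \<open>i\<close> look from \<open>p\<close> towards the single point
  \<open>z i\<close>, so they contribute a geometric series.\<close>

lemma sum_separated_le:
  fixes w :: "real \<Rightarrow> real"
  assumes H: "finite H" "H \<subseteq> G"
    and A: "\<And>h. h \<in> H \<Longrightarrow> A h \<in> sets \<mu>" "\<forall>h\<in>H. A h \<noteq> {}"
      "\<And>h. h \<in> H \<Longrightarrow> A h \<subseteq> shadow s h"
      "\<And>h. h \<in> H \<Longrightarrow> e * (b powr (- \<delta> * len h) * w (len h)) \<le> prob (A h)"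
    and ball: "\<And>h. h \<in> H \<Longrightarrow> A h \<subseteq> mcball (z h) (\<rho> h)"
    and sep: "\<And>i h. i \<in> H \<Longrightarrow> h \<in> H \<Longrightarrow> A i \<inter> A h \<noteq> {} \<Longrightarrow> len i \<le> len h \<Longrightarrow>
        \<rho> i \<le> b powr (\<kappa> - len h)"
    and pos: "0 < e" "0 \<le> s" "0 \<le> \<kappa>" "0 \<le> M"
    and M: "\<And>\<zeta> a H. finite H \<Longrightarrow> H \<subseteq> {h \<in> G. \<zeta> \<in> shadow (s + \<kappa> + \<sigma>) h \<and> a \<le> len h} \<Longrightarrow>
        (\<Sum>h\<in>H. b powr (- \<delta> * len h)) \<le> M * b powr (- \<delta> * a)"
    and w: "\<And>t. 0 \<le> w t" "\<And>t t'. t \<le> t' \<Longrightarrow> w t' \<le> w t"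
  shows "(\<Sum>h\<in>H. b powr (- \<delta> * len h) * w (len h)) \<le> M / e"
proof -
  let ?f = "\<lambda>k. b powr (- \<delta> * len k) * w (len k)"
  obtain I \<pi> where I: "I \<subseteq> H" "disjoint_family_on A I"
    and \<pi>: "\<And>h. h \<in> H \<Longrightarrow> \<pi> h \<in> I \<and> A (\<pi> h) \<inter> A h \<noteq> {} \<and> len (\<pi> h) \<le> len h"
    by (rule greedy_disjoint_map[where V = A and N = len, OF H(1) A(2)]) (rule that)
  have "finite I" using I(1) H(1) by (rule finite_subset)
  have part: "(\<Sum>h | h \<in> H \<and> \<pi> h = i. ?f h) \<le> M / e * prob (A i)" if i: "i \<in> I" for i
  proof -
    let ?H = "{h \<in> H. \<pi> h = i}"
    have iH: "i \<in> H" using i I(1) by blast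
    \<comment> \<open>The two targets share a point \<open>\<eta>\<close>. The centre
      \<open>z i\<close> is within \<open>\<rho> i\<close> of it, and \<open>sep\<close> makes this
      at most comparable to the shadow of \<open>h\<close>.\<close>
    have "z i \<in> shadow (s + \<kappa> + \<sigma>) h" if h: "h \<in> ?H" for h
    proof -
      obtain \<eta> where \<eta>: "\<eta> \<in> A i" "\<eta> \<in> A h" using \<pi>[of h] h by blast
      have "\<eta> \<in> mcball (z i) (\<rho> i)" using ball[OF iH] \<eta>(1) by blast
      then have zi: "z i \<in> gromov_boundary p" "D \<eta> (z i) \<le> \<rho> i" using commute[of \<eta>] by auto
      moreover have "\<rho> i \<le> b powr (\<kappa> - len h)" using sep[OF iH, of h] \<pi>[of h] h by auto
      moreover have "\<eta> \<in> shadow s h" using A(3)[of h] \<eta>(2) h by auto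
      ultimately show ?thesis using pos by (intro shadow_near[of \<eta>]) auto
    qed
    then have H_sub: "?H \<subseteq> {h \<in> G. z i \<in> shadow (s + \<kappa> + \<sigma>) h \<and> len i \<le> len h}"
      using \<pi> H(2) by auto
    have "(\<Sum>h\<in>?H. ?f h) \<le> (\<Sum>h\<in>?H. b powr (- \<delta> * len h) * w (len i))"
      using \<pi> w by (intro sum_mono mult_left_mono) auto
    also have "\<dots> = (\<Sum>h\<in>?H. b powr (- \<delta> * len h)) * w (len i)"
      by (simp add: sum_distrib_right)
    \<comment> \<open>With \<open>a = len i\<close>, the whole group of \<open>i\<close> costs at
      most \<open>M\<close> times the single term of \<open>i\<close>, which the mass of
      \<open>A i\<close> dominates.\<close>
    also have "\<dots> \<le> M * b powr (- \<delta> * len i) * w (len i)"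
      using M[OF _ H_sub] H(1) w(1) by (intro mult_right_mono) auto
    also have "\<dots> = M / e * (e * ?f i)" using pos(1) by simp
    also have "\<dots> \<le> M / e * prob (A i)"
      using A(4)[OF iH] pos by (intro mult_left_mono) auto
    finally show ?thesis .
  qed
  have "(\<Sum>h\<in>H. ?f h) = (\<Sum>i\<in>I. \<Sum>h | h \<in> H \<and> \<pi> h = i. ?f h)"
    using \<pi> by (intro sum.group[symmetric] H(1) \<open>finite I\<close>) auto
  also have "\<dots> \<le> (\<Sum>i\<in>I. M / e * prob (A i))" by (rule sum_mono) (rule part)
  also have "\<dots> = M / e * prob (\<Union>i\<in>I. A i)"
    using I(1,2) A(1) \<open>finite I\<close>
    by (subst finite_measure_finite_Union) (auto simp: sum_distrib_left)
  also have "\<dots> \<le> M / e * 1" using pos by (intro mult_left_mono prob_le_1) auto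
  finally show ?thesis by simp
qed

lemma approximated_not_null:
  assumes \<delta>: "0 < \<delta>" and f: "f \<in> G" "boundary_action f \<xi> \<noteq> \<xi>"
    and div: "\<And>K. 0 < K \<Longrightarrow> \<not> (\<lambda>g. b powr (- \<delta> * len g) *
      mass (b powr len g * \<Phi> (K * b powr len g))) summable_on G"
  shows "approximated G \<notin> null_sets \<mu>"
proof
  assume null: "approximated G \<in> null_sets \<mu>"
  define w where "w K t = mass (b powr t * \<Phi> (K * b powr t))" for K t
  have w_nonneg: "0 \<le> w K t" for K t by (simp add: w_def mass_nonneg)
  have w_mono: "w K t' \<le> w K t" if "0 < K" "t \<le> t'" for K t t'
  proof -
    have "1 \<le> b powr (t' - t)" using that b_gt_1 by (simp add: ge_one_powr_ge_zero)
    then have "b powr (t' - t) * \<Phi> (b powr (t' - t) * (K * b powr t)) \<le> \<Phi> (K * b powr t)"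
      using that powr_pos by (intro \<Phi>_scale) auto
    moreover have "b powr (t' - t) * (K * b powr t) = K * b powr t'"
      using b_gt_1 by (simp add: powr_diff)
    ultimately have "b powr t * (b powr (t' - t) * \<Phi> (K * b powr t')) \<le> b powr t * \<Phi> (K * b powr t)"
      using powr_pos by (intro mult_left_mono) auto
    moreover have "b powr t * (b powr (t' - t) * \<Phi> (K * b powr t')) = b powr t' * \<Phi> (K * b powr t')"
      using b_gt_1 by (simp add: powr_diff)
    ultimately show ?thesis unfolding w_def by (intro mass_mono) simp
  qed
  have radius: "b powr len g * \<Phi> (K * b powr len g) \<le> \<Phi> 1 / K" if "1 \<le> K" for g :: "'a \<Rightarrow> 'a" and K
  proof -
    have "1 \<le> b powr len g" using b_gt_1 by (simp add: ge_one_powr_ge_zero)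
    then have "1 \<le> K * b powr len g" using that mult_mono[of 1 K 1 "b powr len g"] by simp
    from \<Phi>_scale[OF this, of 1] have "K * b powr len g * \<Phi> (K * b powr len g) \<le> \<Phi> 1" by simp
    then show ?thesis using that by (simp add: field_simps)
  qed
  \<comment> \<open>Otherwise all radii in the series are at most \<open>r\<close> for large
    \<open>K\<close>, every term vanishes, and the series converges.\<close>
  have mass_pos: "0 < mass r" if r: "0 < r" for r
  proof (rule ccontr)
    assume "\<not> ?thesis"
    then have zero: "mass r = 0" using mass_nonneg[of r] by linarith
    define K where "K = max 1 (\<Phi> 1 / r)"
    have K: "1 \<le> K" by (simp add: K_def)
    have "\<Phi> 1 / r \<le> K" by (simp add: K_def)
    then have "\<Phi> 1 / K \<le> r" using K r by (simp add: field_simps)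
    then have "mass (b powr len g * \<Phi> (K * b powr len g)) = 0" for g :: "'a \<Rightarrow> 'a"
      using mass_mono[OF order_trans[OF radius[OF K, of g]]] zero mass_nonneg
      by (metis order_antisym)
    then have "(\<lambda>g. b powr (- \<delta> * len g) * mass (b powr len g * \<Phi> (K * b powr len g))) summable_on G"
      by simp
    then show False using div[of K] K by simp
  qed
  obtain s1 c1 where s1: "0 \<le> s1" "0 < c1" and "\<forall>g\<in>G. \<exists>T\<in>sets \<mu>. T \<subseteq> shadow s1 g \<and>
      c1 * b powr (- \<delta> * len g) \<le> prob T"
    using shadow_lower[OF mass_pos] by blast
  then have "\<forall>g\<in>G. \<exists>T. T \<in> sets \<mu> \<and> T \<subseteq> shadow s1 g \<and> c1 * b powr (- \<delta> * len g) \<le> prob T"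
    by blast
  from bchoice[OF this] obtain T where T: "\<And>g. g \<in> G \<Longrightarrow> T g \<in> sets \<mu>"
      "\<And>g. g \<in> G \<Longrightarrow> T g \<subseteq> shadow s1 g"
      "\<And>g. g \<in> G \<Longrightarrow> c1 * b powr (- \<delta> * len g) \<le> prob (T g)"
    by blast
  define l where "l = len f"
  obtain v where "\<forall>g\<in>G. \<exists>k. k \<in> G \<and> dist (g p) (k p) \<le> l \<and> boundary_product p (ginv k p) \<xi> \<le> v"
    using contracting_translate[OF f] unfolding l_def by blast
  from bchoice[OF this] obtain k where k: "\<And>g. g \<in> G \<Longrightarrow> k g \<in> G"
      "\<And>g. g \<in> G \<Longrightarrow> dist (g p) (k g p) \<le> l"
      "\<And>g. g \<in> G \<Longrightarrow> boundary_product p (ginv (k g) p) \<xi> \<le> v"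
    by blast
  define z where "z g = boundary_action (k g) \<xi>" for g
  have z_in: "z g \<in> gromov_boundary p" if "g \<in> G" for g
    unfolding z_def using act_in[OF k(1)[OF that] \<xi>_in] .
  define s where "s = max s1 (v + 3 * \<sigma> + 2 * l)"
  have s: "0 \<le> s" "s1 \<le> s" "v + 3 * \<sigma> + 2 * l \<le> s" using s1(1) by (auto simp: s_def)
  define c2 where "c2 = b powr (2 * v + 2 * \<sigma> + l)"
  \<comment> \<open>Enlarges a target so that it contains every shadow meeting it that is not larger
    than itself: \<open>c2\<close> covers the target, \<open>b powr (\<sigma> + s)\<close> the
    diameter of the shadow.\<close>
  define c3 where "c3 = c2 + b powr (\<sigma> + s)"
  have c2: "0 < c2" unfolding c2_def by (rule powr_pos)
  have c3: "0 < c3" unfolding c3_def by (rule add_pos_pos[OF c2 powr_pos])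
  define e where "e = b powr (- (\<sigma> + l) * \<delta>) / Q"
  have e: "0 < e" unfolding e_def using powr_pos Q_ge_1 by (intro divide_pos_pos) auto
  define \<kappa> where "\<kappa> = log b (max 1 c2)"
  have \<kappa>: "0 \<le> \<kappa>" "c2 \<le> b powr \<kappa>" using b_gt_1 by (auto simp: \<kappa>_def)
  obtain M where M: "0 \<le> M" "\<And>\<zeta> a H. finite H \<Longrightarrow>
      H \<subseteq> {h \<in> G. \<zeta> \<in> shadow (s + \<kappa> + \<sigma>) h \<and> a \<le> len h} \<Longrightarrow>
      (\<Sum>h\<in>H. b powr (- \<delta> * len h)) \<le> M * b powr (- \<delta> * a)"
    using shadow_sum[OF \<delta>, of "s + \<kappa> + \<sigma>"] by blast
  define R0 where "R0 = 2 * s + 2 * \<sigma>"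
  define B where "B = b powr (\<delta> * (2 * s + 2 * \<sigma>))"
  have B: "0 < B" unfolding B_def by (rule powr_pos)
  \<comment> \<open>The union of the enlarged targets, with \<open>Suc n\<close> as
    \<open>K\<close>. These sets decrease to a subset of the null set \<open>approximated G\<close>,
    so their masses tend to \<open>0\<close>.\<close>
  define E where "E n = (\<Union>g\<in>{g \<in> G. R0 \<le> len g}.
      mcball (z g) (c3 * \<Phi> (real (Suc n) * b powr len g)))" for n
  have E_sets: "E n \<in> sets \<mu>" for n
    unfolding E_def using countable_subset[OF _ countable_G]
    by (intro sets.countable_UN'') auto
  have "decseq E"
    unfolding decseq_def
  proof (intro allI impI)
    fix m n :: nat assume "m \<le> n"
    then have "c3 * \<Phi> (real (Suc n) * b powr len g) \<le> c3 * \<Phi> (real (Suc m) * b powr len g)"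
      for g :: "'a \<Rightarrow> 'a"
      using c3 powr_pos by (intro mult_left_mono \<Phi>_antimono mult_right_mono mult_pos_pos) auto
    then show "E n \<subseteq> E m"
      unfolding E_def by (intro UN_mono order_refl mcball_subset_concentric)
  qed
  then have "(\<lambda>n. prob (E n)) \<longlonglongrightarrow> prob (\<Inter>n. E n)"
    using E_sets by (intro finite_Lim_measure_decseq) auto
  moreover have "(\<Inter>n. E n) \<subseteq> approximated G"
  proof
    fix \<eta> assume \<eta>: "\<eta> \<in> (\<Inter>n. E n)"
    then have \<eta>_in: "\<eta> \<in> gromov_boundary p" by (auto simp: E_def)
    have "\<exists>h\<in>G. D (boundary_action h \<xi>) \<eta> \<le> \<Phi> (K * b powr len h)" if K: "0 < K" for K
    proof -
      \<comment> \<open>\<open>c\<close> absorbs the enlargement of the target,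
        \<open>b powr l\<close> the passage from \<open>g\<close> to \<open>k g\<close>.\<close>
      define c where "c = max 1 c3"
      obtain n where n: "c * (K * b powr l) \<le> real n" using real_arch_simple by blast
      have "\<eta> \<in> E n" using \<eta> by blast
      then obtain g where g: "g \<in> G" "D (z g) \<eta> \<le> c3 * \<Phi> (real (Suc n) * b powr len g)"
        unfolding E_def by (auto simp del: of_nat_Suc)
      have c: "1 \<le> c" "c3 \<le> c" by (auto simp: c_def)
      have pos: "0 < K * b powr (len g + l)" using K powr_pos by simp
      have "0 < \<Phi> (real (Suc n) * b powr len g)"
        using powr_pos[of "len g"] by (intro \<Phi>_pos) simp
      then have "c3 * \<Phi> (real (Suc n) * b powr len g) \<le> c * \<Phi> (real (Suc n) * b powr len g)"
        using c(2) by (intro mult_right_mono) auto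
      also have "\<dots> \<le> c * \<Phi> (c * (K * b powr (len g + l)))"
      proof -
        have "c * (K * b powr l) * b powr len g \<le> real (Suc n) * b powr len g"
          using n by (intro mult_right_mono) auto
        then have "c * (K * b powr (len g + l)) \<le> real (Suc n) * b powr len g"
          by (simp add: powr_add ac_simps)
        then show ?thesis using c pos by (intro mult_left_mono \<Phi>_antimono) auto
      qed
      also have "\<dots> \<le> \<Phi> (K * b powr (len g + l))" by (rule \<Phi>_scale[OF c(1) pos])
      also have "\<dots> \<le> \<Phi> (K * b powr len (k g))"
      proof -
        have "len (k g) \<le> len g + l"
          using k(2)[OF g(1)] dist_triangle[of p "k g p" "g p"] by linarith
        then show ?thesis using K powr_pos
          by (intro \<Phi>_antimono mult_pos_pos mult_left_mono powr_le) auto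
      qed
      finally show ?thesis using g k(1)[OF g(1)] unfolding z_def by (intro bexI[of _ "k g"]) auto
    qed
    then show "\<eta> \<in> approximated G" using \<eta>_in by (simp add: approximated_def)
  qed
  then have "prob (\<Inter>n. E n) \<le> prob (approximated G)"
    using null by (intro finite_measure_mono) auto
  then have "prob (\<Inter>n. E n) = 0"
    using measure_eq_0_null_sets[OF null] measure_nonneg[of \<mu> "\<Inter>n. E n"] by linarith
  ultimately have "(\<lambda>n. prob (E n)) \<longlonglongrightarrow> 0" by simp
  then have "\<forall>\<^sub>F n in sequentially. prob (E n) < c1 / (2 * B)"
    using s1(2) B by (intro order_tendstoD) auto
  \<comment> \<open>A second demand on \<open>n\<close>: the radii must be small enough for
    \<open>contracted_ball\<close>. The first makes the factor of \<open>S R\<close> equal to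
    \<open>1 / 2\<close>.\<close>
  moreover obtain n0 where n0: "\<Phi> 1 / b powr (- (v + \<sigma> + 1)) \<le> real n0"
    using real_arch_simple by blast
  ultimately obtain n where n: "n0 \<le> n" "prob (E n) < c1 / (2 * B)"
    using eventually_conj[OF _ eventually_ge_at_top[of n0]] eventually_happens'[OF sequentially_bot]
    by (metis (mono_tags, lifting))
  define K where "K = real (Suc n)"
  have K: "1 \<le> K" "0 < K" by (simp_all add: K_def)
  define r where "r g = b powr len g * \<Phi> (K * b powr len g)" for g
  have r_pos: "0 \<le> r g" for g
    unfolding r_def using \<Phi>_pos[of "K * b powr len g"] K(2) powr_pos by (intro mult_nonneg_nonneg) auto
  have r_le: "r g \<le> b powr (- (v + \<sigma> + 1))" for g
  proof -
    have "\<Phi> 1 / b powr (- (v + \<sigma> + 1)) \<le> K" using n0 n(1) by (simp add: K_def)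
    then have "\<Phi> 1 / K \<le> b powr (- (v + \<sigma> + 1))"
      using K(2) powr_pos[of "- (v + \<sigma> + 1)"] by (simp only: divide_le_eq mult.commute if_True)
    then show ?thesis using radius[OF K(1), of g] unfolding r_def by linarith
  qed
  define A where "A g = boundary_action (k g) ` mcball \<xi> (r g)" for g
  define \<rho> where "\<rho> g = c2 * \<Phi> (K * b powr len g)" for g
  have A_sets: "A g \<in> sets \<mu>" if "g \<in> G" for g
    unfolding A_def using act_image_sets[OF k(1)[OF that] mcball_sets] .
  have A_shadow: "A g \<subseteq> shadow s g" if "g \<in> G" for g
    unfolding A_def using contracted_ball(1)[OF that k(1)[OF that] k(2)[OF that] k(3)[OF that] r_le]
      shadow_mono[OF s(3)] by blast
  have A_ball: "A g \<subseteq> mcball (z g) (\<rho> g)" if "g \<in> G" for g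
  proof -
    have "r g * b powr (- len g) = \<Phi> (K * b powr len g)"
      using b_gt_1 by (simp add: r_def powr_minus)
    with contracted_ball(2)[OF that k(1)[OF that] k(2)[OF that] k(3)[OF that] r_le[of g]]
    show ?thesis unfolding A_def z_def \<rho>_def c2_def by (simp only:)
  qed
  have A_mass: "e * (b powr (- \<delta> * len g) * w K (len g)) \<le> prob (A g)" if "g \<in> G" for g
    using contracted_ball(3)[OF that k(1)[OF that] k(2)[OF that] k(3)[OF that] r_le[of g]]
    unfolding A_def e_def w_def r_def by simp
  have A_nonempty: "A g \<noteq> {}" for g
    using \<xi>_in r_pos[of g] by (auto simp: A_def mcball_eq_empty)
  let ?f = "\<lambda>g. b powr (- \<delta> * len g) * w K (len g)"
  have f_nonneg: "0 \<le> ?f g" for g using w_nonneg by simp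
  define S where "S R = (\<Sum>g\<in>{g \<in> G. len g \<le> R}. ?f g)" for R
  have S_nonneg: "0 \<le> S R" for R unfolding S_def using f_nonneg by (intro sum_nonneg) auto
  \<comment> \<open>The finite sum \<open>S R\<close> satisfies
    \<open>S R \<le> S R0 + S R / 2 + M / e\<close>, and half of it can be subtracted.\<close>
  have S_le: "S R \<le> 2 * S R0 + 2 * (M / e)" for R
  proof -
    define H where "H = {g \<in> G. R0 \<le> len g \<and> len g \<le> R}"
    \<comment> \<open>A shadow that meets a target of at least its own scale lies in the enlarged
      target. Otherwise every target it meets is smaller, and then its centre lies in a slightly
      larger shadow of \<open>h\<close>.\<close>
    define covered where "covered h \<longleftrightarrow> (\<exists>g\<in>G. R0 \<le> len g \<and> shadow s h \<inter> A g \<noteq> {} \<and>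
        b powr (- len h) \<le> \<Phi> (K * b powr len g))" for h
    have H: "finite H" "H \<subseteq> G"
      unfolding H_def by (auto intro: finite_subset[OF _ finite_len_le[of R]])
    have "(\<Sum>h\<in>{h \<in> H. covered h}. ?f h) \<le> B / c1 * prob (E n) * S R"
      unfolding B_def S_def
    proof (rule sum_shadow_orbit_le)
      fix h assume h: "h \<in> {h \<in> H. covered h}"
      then have hG: "h \<in> G" using H by blast
      show "T h \<in> sets \<mu>" "T h \<subseteq> shadow s h" "c1 * b powr (- \<delta> * len h) \<le> prob (T h)"
        using T[OF hG] shadow_mono[OF s(2)] by blast+
      show "2 * s + 2 * \<sigma> \<le> len h" "len h \<le> R" using h by (auto simp: H_def R0_def)
      obtain g \<zeta> where g: "g \<in> G" "R0 \<le> len g" "\<zeta> \<in> shadow s h" "\<zeta> \<in> A g"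
          "b powr (- len h) \<le> \<Phi> (K * b powr len g)"
        using h by (auto simp: covered_def)
      show "T h \<subseteq> E n"
      proof
        fix \<eta> assume "\<eta> \<in> T h"
        then have \<eta>: "\<eta> \<in> shadow s h" using T(2)[OF hG] shadow_mono[OF s(2)] by blast
        then have \<eta>_in: "\<eta> \<in> gromov_boundary p" by (simp add: shadow_def)
        have \<zeta>_in: "\<zeta> \<in> gromov_boundary p" using g(3) by (simp add: shadow_def)
        have "D (z g) \<eta> \<le> D (z g) \<zeta> + D \<zeta> \<eta>"
          by (rule triangle[OF z_in[OF g(1)] \<zeta>_in \<eta>_in])
        also have "D (z g) \<zeta> \<le> \<rho> g" using A_ball[OF g(1)] g(4) by auto
        also have "D \<zeta> \<eta> \<le> b powr (\<sigma> + s - len h)" by (rule shadow_diam[OF g(3) \<eta>])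
        also have "\<dots> = b powr (\<sigma> + s) * b powr (- len h)" by (simp flip: powr_add)
        also have "\<dots> \<le> b powr (\<sigma> + s) * \<Phi> (K * b powr len g)"
          using g(5) by (intro mult_left_mono) auto
        finally have "D (z g) \<eta> \<le> c3 * \<Phi> (K * b powr len g)"
          by (simp add: \<rho>_def c3_def algebra_simps)
        then have "\<eta> \<in> mcball (z g) (c3 * \<Phi> (real (Suc n) * b powr len g))"
          using z_in[OF g(1)] \<eta>_in unfolding K_def by (simp del: of_nat_Suc)
        then show "\<eta> \<in> E n" using g(1,2) unfolding E_def by blast
      qed
    qed (use H s1(2) E_sets w_nonneg w_mono K(2) in auto)
    also have "\<dots> \<le> 1 / 2 * S R"
    proof (rule mult_right_mono)
      show "B / c1 * prob (E n) \<le> 1 / 2" using n(2) B s1(2) by (simp add: field_simps)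
    qed (rule S_nonneg)
    finally have 1: "(\<Sum>h\<in>{h \<in> H. covered h}. ?f h) \<le> 1 / 2 * S R" .
    have 2: "(\<Sum>h\<in>{h \<in> H. \<not> covered h}. ?f h) \<le> M / e"
    proof (rule sum_separated_le[where A = A and z = z and \<rho> = \<rho> and \<kappa> = \<kappa> and s = s])
      fix i h assume i: "i \<in> {h \<in> H. \<not> covered h}" and h: "h \<in> {h \<in> H. \<not> covered h}"
        and meet: "A i \<inter> A h \<noteq> {}"
      have "i \<in> G" "h \<in> G" "R0 \<le> len i" using i h H by (auto simp: H_def)
      moreover have "shadow s h \<inter> A i \<noteq> {}" using meet A_shadow[OF \<open>h \<in> G\<close>] by blast
      ultimately have "\<Phi> (K * b powr len i) \<le> b powr (- len h)"
        using h unfolding covered_def by (auto simp: not_le intro: less_imp_le)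
      then have "\<rho> i \<le> b powr \<kappa> * b powr (- len h)"
        unfolding \<rho>_def using \<kappa>(2) c2 powr_pos \<Phi>_pos[of "K * b powr len i"] K(2)
        by (intro mult_mono) auto
      then show "\<rho> i \<le> b powr (\<kappa> - len h)" by (simp flip: powr_add)
    next
      fix h assume "h \<in> {h \<in> H. \<not> covered h}"
      then have hG: "h \<in> G" using H by blast
      show "A h \<in> sets \<mu>" "A h \<subseteq> shadow s h" "A h \<subseteq> mcball (z h) (\<rho> h)"
          "e * (b powr (- \<delta> * len h) * w K (len h)) \<le> prob (A h)"
        using A_sets[OF hG] A_shadow[OF hG] A_ball[OF hG] A_mass[OF hG] by blast+
    next
      fix \<zeta> a H assume "finite H" "H \<subseteq> {h \<in> G. \<zeta> \<in> shadow (s + \<kappa> + \<sigma>) h \<and> a \<le> len h}"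
      then show "(\<Sum>h\<in>H. b powr (- \<delta> * len h)) \<le> M * b powr (- \<delta> * a)" by (rule M(2))
    qed (use H A_nonempty e s(1) \<kappa>(1) M(1) w_nonneg w_mono K(2) in auto)
    let ?L = "{g \<in> G. len g \<le> R0}" and ?X = "{h \<in> H. covered h}" and ?Y = "{h \<in> H. \<not> covered h}"
    have fin: "finite ?L" "finite ?X" "finite ?Y" using H(1) finite_len_le by simp_all
    have "S R \<le> (\<Sum>h\<in>?L \<union> (?X \<union> ?Y). ?f h)"
      unfolding S_def
    proof (rule sum_mono2)
      show "finite (?L \<union> (?X \<union> ?Y))" using fin by blast
      show "{g \<in> G. len g \<le> R} \<subseteq> ?L \<union> (?X \<union> ?Y)" by (auto simp: H_def)
    qed (rule f_nonneg)
    \<comment> \<open>Elements of length exactly \<open>R0\<close> lie in both pieces, hence the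
      subtracted intersection.\<close>
    also have "\<dots> = S R0 + (\<Sum>h\<in>?X \<union> ?Y. ?f h) - (\<Sum>h\<in>?L \<inter> (?X \<union> ?Y). ?f h)"
      unfolding S_def using fin by (intro sum_Un) blast+
    also have "\<dots> \<le> S R0 + (\<Sum>h\<in>?X \<union> ?Y. ?f h)"
      using sum_nonneg[of "?L \<inter> (?X \<union> ?Y)" ?f] f_nonneg by fastforce
    also have "(\<Sum>h\<in>?X \<union> ?Y. ?f h) = (\<Sum>h\<in>?X. ?f h) + (\<Sum>h\<in>?Y. ?f h)"
      using fin(2,3) by (intro sum.union_disjoint) auto
    finally show ?thesis using 1 2 by linarith
  qed
  have "?f summable_on G"
  proof (rule nonneg_bdd_above_summable_on)
    show "bdd_above (sum ?f ` {F. F \<subseteq> G \<and> finite F})"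
    proof (rule bdd_aboveI2)
      fix F assume F: "F \<in> {F. F \<subseteq> G \<and> finite F}"
      define R where "R = Max (insert 0 (len ` F))"
      have "F \<subseteq> {g \<in> G. len g \<le> R}" using F by (auto simp: R_def)
      then have "sum ?f F \<le> S R"
        unfolding S_def using f_nonneg finite_len_le by (intro sum_mono2) auto
      also note S_le
      finally show "sum ?f F \<le> 2 * S R0 + 2 * (M / e)" .
    qed
  qed (use f_nonneg in auto)
  then show False using div[OF K(2)] by (simp add: w_def)
qed

section \<open>Positivity of the exponent\<close>

lemma act_funpow: "(boundary_action g ^^ n) \<eta> = boundary_action (g ^^ n) \<eta>"
proof (induction n)
  case 0
  show ?case unfolding funpow.simps(1) boundary_action_id by simp
next
  case (Suc n)
  then show ?case
    unfolding funpow.simps(2) boundary_action_comp by simp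
qed

lemma funpow_in_G: "g \<in> G \<Longrightarrow> g ^^ n \<in> G"
  by (induction n) (simp_all only: funpow.simps id_in_G comp_in_G)

text \<open>If \<open>\<delta> = 0\<close>, the measure is invariant up to a constant. The sets \<open>g\<^sup>n(A)\<close> with \<open>A\<close> away from
  the fixed points accumulate at the attracting fixed point only, so \<open>A\<close> has measure zero.\<close>

lemma loxodromic_concentrated:
  assumes \<delta>: "\<delta> = 0" and g: "g \<in> G" and lox: "loxodromic p D g"
  shows "\<exists>F\<subseteq>boundary_fixed_points p g. gromov_boundary p - F \<in> null_sets \<mu>"
proof -
  obtain \<omega> \<alpha> where fix_pts: "\<omega> \<in> boundary_fixed_points p g" "\<alpha> \<in> boundary_fixed_points p g"
    and attr: "iterates_attracted p D g \<alpha> \<omega>"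
    using lox unfolding loxodromic_def by blast
  have \<omega>: "\<omega> \<in> gromov_boundary p" "boundary_action g \<omega> = \<omega>"
    and \<alpha>: "\<alpha> \<in> gromov_boundary p"
    using fix_pts by (auto simp: boundary_fixed_points_def)
  have pow_\<omega>: "boundary_action (g ^^ n) \<omega> = \<omega>" for n
    unfolding act_funpow[symmetric] by (induction n) (simp_all add: \<omega>(2))
  have null: "gromov_boundary p - mball \<alpha> r - {\<omega>} \<in> null_sets \<mu>" if r: "0 < r" for r
  proof -
    \<comment> \<open>\<open>\<omega>\<close> is excluded as well: it is fixed, so it would remain
      in all images.\<close>
    define A where "A = gromov_boundary p - mball \<alpha> r - {\<omega>}"
    have A: "A \<in> sets \<mu>"
      using sets.Diff[OF sets.Diff[OF sets.top open_sets[OF openin_mball]] singleton_sets[OF \<omega>(1)]]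
      by (simp add: A_def space_\<mu>)
    define B where "B n = (\<Union>m\<in>{n..}. boundary_action (g ^^ m) ` A)" for n
    have B_sets: "B n \<in> sets \<mu>" for n
      unfolding B_def using act_image_sets[OF funpow_in_G[OF g] A] by auto
    have lower: "prob A / Q \<le> prob (B n)" for n
    proof -
      let ?h = "g ^^ n"
      have h: "?h \<in> G" by (rule funpow_in_G[OF g])
      \<comment> \<open>Any positive lower bound would do: its power with exponent \<open>0\<close>
        is \<open>1\<close>, whereas \<open>0 powr 0\<close> is \<open>0\<close>.\<close>
      have "b powr (- len ?h - \<sigma>) \<le> conformal_derivative b p ?h \<eta>" if "\<eta> \<in> A" for \<eta>
      proof -
        have \<eta>: "\<eta> \<in> gromov_boundary p" using that by (simp add: A_def)
        have "- len ?h - \<sigma> \<le> 2 * boundary_product p (ginv ?h p) \<eta> - len ?h - \<sigma>"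
          using boundary_product_ereal(2)[OF \<eta>, of p "ginv ?h p"] by linarith
        from powr_le[OF this] conformal_derivative_bounds(1)[OF isometry[OF h] \<eta>]
        show ?thesis by linarith
      qed
      then have "(b powr (- len ?h - \<sigma>)) powr \<delta> * prob A / Q \<le> prob (boundary_action ?h ` A)"
        by (intro measure_act_lower[OF h A]) auto
      also have "\<dots> \<le> prob (B n)"
        using B_sets by (intro finite_measure_mono) (auto simp: B_def)
      finally show ?thesis using \<delta> b_gt_1 by simp
    qed
    \<comment> \<open>A common point is hit by arbitrarily high iterates, so attraction forces it to
      be \<open>\<omega>\<close>; but the only preimage of \<open>\<omega>\<close> is
      \<open>\<omega>\<close>, which is not in \<open>A\<close>.\<close>
    have "(\<Inter>n. B n) = {}"
    proof (rule ccontr)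
      assume "(\<Inter>n. B n) \<noteq> {}"
      then obtain \<eta> where \<eta>: "\<And>n. \<eta> \<in> B n" by blast
      then have ex: "\<exists>m\<ge>n. \<exists>a\<in>A. \<eta> = boundary_action (g ^^ m) a" for n
        unfolding B_def by blast
      have \<eta>_in: "\<eta> \<in> gromov_boundary p"
        using \<eta>[of 0] B_sets[of 0] sets.sets_into_space space_\<mu> by blast
      have "D \<eta> \<omega> < e" if "0 < e" for e
      proof -
        have "\<forall>\<^sub>F n in sequentially. \<forall>\<eta>\<in>gromov_boundary p - mball \<alpha> r.
            D ((boundary_action g ^^ n) \<eta>) \<omega> < e"
          using attr r \<alpha> that unfolding iterates_attracted_def by simp
        then obtain N where N: "\<And>n \<eta>. N \<le> n \<Longrightarrow> \<eta> \<in> gromov_boundary p - mball \<alpha> r \<Longrightarrow>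
            D (boundary_action (g ^^ n) \<eta>) \<omega> < e"
          unfolding eventually_sequentially act_funpow by blast
        obtain m a where "N \<le> m" "a \<in> A" "\<eta> = boundary_action (g ^^ m) a" using ex by blast
        then show ?thesis using N[of m a] by (simp add: A_def)
      qed
      then have "D \<eta> \<omega> \<le> 0" by (meson not_le order_less_irrefl)
      then have "\<eta> = \<omega>" using zero[OF \<eta>_in \<omega>(1)] nonneg[of \<eta> \<omega>] by linarith
      moreover obtain m a where a: "a \<in> A" "\<eta> = boundary_action (g ^^ m) a" using ex[of 0] by blast
      ultimately have "boundary_action (g ^^ m) a = boundary_action (g ^^ m) \<omega>"
        using pow_\<omega> by simp
      then have "a = \<omega>" using act_inv(1)[OF funpow_in_G[OF g]] by metis
      then show False using a(1) by (simp add: A_def)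
    qed
    moreover have "decseq B"
      unfolding decseq_def B_def by (intro allI impI UN_mono) auto
    then have "(\<lambda>n. prob (B n)) \<longlonglongrightarrow> prob (\<Inter>n. B n)"
      using B_sets by (intro finite_Lim_measure_decseq) auto
    ultimately have "(\<lambda>n. prob (B n)) \<longlonglongrightarrow> 0" by simp
    then have "prob A / Q \<le> 0" by (rule LIMSEQ_le_const) (use lower in auto)
    then have "prob A = 0" using Q_ge_1 measure_nonneg[of \<mu> A] by (simp add: divide_le_0_iff)
    then show ?thesis using A unfolding A_def by (simp add: null_sets_def emeasure_eq_measure)
  qed
  have "(\<Union>n. gromov_boundary p - mball \<alpha> (1 / real (Suc n)) - {\<omega>}) \<in> null_sets \<mu>"
    by (intro null_sets_UN null) simp
  moreover have "gromov_boundary p - {\<alpha>, \<omega>}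
      \<subseteq> (\<Union>n. gromov_boundary p - mball \<alpha> (1 / real (Suc n)) - {\<omega>})"
  proof
    fix \<eta> assume \<eta>: "\<eta> \<in> gromov_boundary p - {\<alpha>, \<omega>}"
    then have "0 < D \<alpha> \<eta>" using mdist_pos_less[of \<alpha> \<eta>] \<alpha> by auto
    then obtain n where "1 / real (Suc n) < D \<alpha> \<eta>" using nat_approx_posE by blast
    then show "\<eta> \<in> (\<Union>n. gromov_boundary p - mball \<alpha> (1 / real (Suc n)) - {\<omega>})"
      using \<eta> by (intro UN_I[of n]) auto
  qed
  moreover have "gromov_boundary p - {\<alpha>, \<omega>} \<in> sets \<mu>"
  proof -
    have "space \<mu> - ({\<alpha>} \<union> {\<omega>}) \<in> sets \<mu>"
      by (intro sets.compl_sets sets.Un singleton_sets \<alpha> \<omega>(1))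
    then show ?thesis by (simp add: space_\<mu> insert_commute)
  qed
  ultimately have "gromov_boundary p - {\<alpha>, \<omega>} \<in> null_sets \<mu>"
    by (metis null_sets_subset)
  then show ?thesis using fix_pts by (intro exI[of _ "{\<alpha>, \<omega>}"]) auto
qed

lemma general_type_moves:
  assumes "general_type p D G"
  shows "\<exists>f\<in>G. boundary_action f \<xi> \<noteq> \<xi>"
  using assms \<xi>_in unfolding general_type_def boundary_fixed_points_def by blast

text \<open>With exponent \<open>0\<close>, the measure would be concentrated on each of two
  disjoint sets of fixed points.\<close>

lemma general_type_exponent_pos:
  assumes "general_type p D G"
  shows "0 < \<delta>"
proof (rule ccontr)
  assume "\<not> ?thesis"
  then have \<delta>: "\<delta> = 0" using \<delta>_nonneg by linarith
  obtain g h where gh: "g \<in> G" "h \<in> G" "loxodromic p D g" "loxodromic p D h"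
      "boundary_fixed_points p g \<inter> boundary_fixed_points p h = {}"
    using assms unfolding general_type_def by blast
  obtain F F' where F: "F \<subseteq> boundary_fixed_points p g" "gromov_boundary p - F \<in> null_sets \<mu>"
      and F': "F' \<subseteq> boundary_fixed_points p h" "gromov_boundary p - F' \<in> null_sets \<mu>"
    using loxodromic_concentrated[OF \<delta>] gh(1-4) by metis
  have "(gromov_boundary p - F) \<union> (gromov_boundary p - F') = space \<mu>"
    using F(1) F'(1) gh(5) space_\<mu> by blast
  then have "space \<mu> \<in> null_sets \<mu>" using null_sets.Un[OF F(2) F'(2)] by simp
  then show False using emeasure_space_1 by (simp add: null_sets_def)
qed

end

section \<open>Deduction of the three claims\<close>

theorem theorem8p1:
  fixes p :: "'a::metric_space"
    and b :: real
    and D :: "(nat \<Rightarrow> 'a) set \<Rightarrow> (nat \<Rightarrow> 'a) set \<Rightarrow> real"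
    and G :: "('a \<Rightarrow> 'a) set"
    and \<xi> :: "(nat \<Rightarrow> 'a) set"
    and \<delta> :: real
    and \<mu> :: "(nat \<Rightarrow> 'a) set measure"
    and \<Phi> :: "real \<Rightarrow> real"
  assumes hyperbolic: "gromov_hyperbolic_on (UNIV :: 'a set)"
    and b: "b > 1"
    and visual: "visual_metric b p D"
    and G_subgroup: "subgroup G isometry_group"
    and G_discrete: "strongly_discrete p G"
    and G_general: "general_type p D G"
    and \<xi>: "\<xi> \<in> gromov_boundary p"
    and \<delta>: "ereal \<delta> = poincare_exponent b p G"
    and \<mu>_borel: "sets \<mu> = sets (boundary_borel p D)"
    and \<mu>_prob: "prob_space \<mu>"
    and \<mu>_limit_set: "measure \<mu> (limit_set p G) = 1"
    and \<mu>_quasiconformal: "quasiconformal b p G \<delta> \<mu>"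
    and \<mu>_ergodic: "ergodic_measure G \<mu>"
    and \<mu>_\<xi>: "measure \<mu> {\<xi>} = 0"
    and \<Phi>_pos: "\<And>t. t \<ge> 0 \<Longrightarrow> \<Phi> t > 0"
    and \<Phi>_mono: "antimono_on {0<..} (\<lambda>t. t * \<Phi> t)"
  shows "((\<forall>K>0. \<not> (\<lambda>g. b powr (- \<delta> * dist p (g p)) *
              ball_mass p D \<mu> \<xi> (b powr dist p (g p) * \<Phi> (K * b powr dist p (g p))))
            summable_on G)
          \<longrightarrow> measure \<mu> (well_approximable b p D G \<Phi> \<xi>) = 1)
       \<and> ((\<exists>K>0. (\<lambda>g. conformal_derivative b p g \<xi> powr \<delta> *
              ball_mass p D \<mu> \<xi> (\<Phi> (K * b powr dist p (g p)) / conformal_derivative b p g \<xi>))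
            summable_on G)
          \<longrightarrow> well_approximable b p D G \<Phi> \<xi> \<in> null_sets \<mu>)
       \<and> (bounded_parabolic_point b p G \<xi> \<and>
          (\<exists>K>0. (\<lambda>g. b powr (- \<delta> * dist p (g p)) *
              ball_mass p D \<mu> \<xi> (b powr dist p (g p) * \<Phi> (K * b powr dist p (g p))))
            summable_on G)
          \<longrightarrow> well_approximable b p D G \<Phi> \<xi> \<in> null_sets \<mu>)"
proof -
  obtain C where C: "0 \<le> C" "\<And>w x y z :: 'a.
      min (gromov_product w x y) (gromov_product w y z) - C \<le> gromov_product w x z"
    using hyperbolic unfolding gromov_hyperbolic_on_def by blast
  obtain V where V: "1 \<le> V" and visual_bounds: "\<And>\<eta> \<zeta>. \<eta> \<in> gromov_boundary p \<Longrightarrow> \<zeta> \<in> gromov_boundary p \<Longrightarrow>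
      ext_powr_minus b (ext_gromov_product p (Inr \<eta>) (Inr \<zeta>)) / V \<le> D \<eta> \<zeta> \<and>
      D \<eta> \<zeta> \<le> V * ext_powr_minus b (ext_gromov_product p (Inr \<eta>) (Inr \<zeta>))"
    using visual unfolding visual_metric_def by blast
  have metric: "Metric_space (gromov_boundary p) D"
    using visual unfolding visual_metric_def by blast
  obtain Q where Q: "1 \<le> Q" and quasi: "\<And>g A. g \<in> G \<Longrightarrow> A \<in> sets \<mu> \<Longrightarrow>
        ennreal (1 / Q) * (\<integral>\<^sup>+\<eta>\<in>A. ennreal (conformal_derivative b p g \<eta> powr \<delta>) \<partial>\<mu>)
          \<le> emeasure \<mu> (boundary_action g ` A) \<and>
        emeasure \<mu> (boundary_action g ` A)
          \<le> ennreal Q * (\<integral>\<^sup>+\<eta>\<in>A. ennreal (conformal_derivative b p g \<eta> powr \<delta>) \<partial>\<mu>)"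
    using \<mu>_quasiconformal unfolding quasiconformal_def by blast
  have G_sub: "g \<in> carrier isometry_group" if "g \<in> G" for g
    using subgroup.subset[OF G_subgroup] that by blast
  have G_id: "id \<in> G"
    using subgroup.one_closed[OF G_subgroup] by (simp add: isometry_group_def)
  have G_comp: "g \<circ> h \<in> G" if "g \<in> G" "h \<in> G" for g h
    using subgroup.m_closed[OF G_subgroup that] by (simp add: isometry_group_def)
  \<comment> \<open>The inverse in the group of isometries is identified with
    \<open>inv_into UNIV\<close>, the form used for derivatives and lengths.\<close>
  have G_inv: "inv_into UNIV g \<in> G" if g: "g \<in> G" for g
  proof -
    let ?h = "inv\<^bsub>isometry_group\<^esub> g"
    have h: "?h \<in> G" using subgroup.m_inv_closed[OF G_subgroup g] .
    have "?h \<circ> g = id"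
      using group.l_inv[OF group_isometry_group G_sub[OF g]] by (simp add: isometry_group_def)
    then have "?h (g x) = x" for x by (metis comp_apply id_apply)
    then have "?h = inv_into UNIV g"
      using isometry_inv_into(2)[OF G_sub[OF g]] by (metis ext)
    with h show ?thesis by simp
  qed
  have \<delta>_nonneg: "0 \<le> \<delta>"
  proof -
    have "0 \<le> poincare_exponent b p G" unfolding poincare_exponent_def by (intro INF_greatest) simp
    then show ?thesis by (simp flip: \<delta>)
  qed
  interpret Metric_space "gromov_boundary p" D by (rule metric)
  interpret prob_space \<mu> by (rule \<mu>_prob)
  interpret quasiconformal_action p C D b V \<mu> G \<delta> Q \<xi> \<Phi>
  proof unfold_locales
    fix \<eta> \<zeta> assume "\<eta> \<in> gromov_boundary p" "\<zeta> \<in> gromov_boundary p"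
    then show "ext_powr_minus b (ext_gromov_product p (Inr \<eta>) (Inr \<zeta>)) \<le> V * D \<eta> \<zeta>"
      using visual_bounds[of \<eta> \<zeta>] V by (simp add: divide_le_eq mult.commute)
  qed (use C b V visual_bounds G_sub G_id G_comp G_inv G_discrete \<xi> \<delta>_nonneg Q \<mu>_borel quasi \<mu>_\<xi> \<Phi>_pos \<Phi>_mono
      in auto)
  let ?WA = "well_approximable b p D G \<Phi> \<xi>"
  let ?L = "limit_set p G"
  \<comment> \<open>A set outside the sigma-algebra has measure \<open>0\<close> by default, so
    measure \<open>1\<close> forces measurability.\<close>
  have L_sets: "?L \<in> sets \<mu>" using \<mu>_limit_set measure_notin_sets by force
  have WA: "?WA = approximated G \<inter> ?L"
    by (auto simp: well_approximable_def approximated_def limit_set_def)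
  have WA_sets: "?WA \<in> sets \<mu>" unfolding WA by (intro sets.Int approximated_sets L_sets) simp
  have WA_null: "?WA \<in> null_sets \<mu>" if "approximated G \<in> null_sets \<mu>"
    using that by (rule null_sets_subset[OF _ WA_sets]) (simp add: WA)
  have "measure \<mu> ?WA = 1"
    if div: "\<forall>K>0. \<not> (\<lambda>g. b powr (- \<delta> * len g) * mass (b powr len g * \<Phi> (K * b powr len g))) summable_on G"
  proof -
    obtain f where f: "f \<in> G" "boundary_action f \<xi> \<noteq> \<xi>" using general_type_moves[OF G_general] by blast
    have sets: "approximated G \<in> sets \<mu>" by (rule approximated_sets) simp
    have "approximated G \<notin> null_sets \<mu>"
      using div by (intro approximated_not_null[OF general_type_exponent_pos[OF G_general] f]) blast
    then have "emeasure \<mu> (approximated G) \<noteq> 0" using sets by (simp add: null_sets_def)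
    then have "emeasure \<mu> (space \<mu> - approximated G) = 0"
      using \<mu>_ergodic sets approximated_invariant unfolding ergodic_measure_def by blast
    then have "prob (approximated G) = 1"
      using prob_compl[OF sets] by (simp add: emeasure_eq_measure)
    then have "AE \<eta> in \<mu>. \<eta> \<in> approximated G \<and> \<eta> \<in> ?L"
      using \<mu>_limit_set sets L_sets by (simp add: prob_eq_1)
    then show ?thesis using WA_sets by (simp add: prob_eq_1 WA)
  qed
  moreover have "?WA \<in> null_sets \<mu>"
    if "\<exists>K>0. (\<lambda>g. conformal_derivative b p g \<xi> powr \<delta> *
      mass (\<Phi> (K * b powr len g) / conformal_derivative b p g \<xi>)) summable_on G"
    using that approximated_null[OF order_refl] WA_null by blast
  moreover have "?WA \<in> null_sets \<mu>"
    if "bounded_parabolic_point b p G \<xi> \<and> (\<exists>K>0. (\<lambda>g. b powr (- \<delta> * len g) *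
      mass (b powr len g * \<Phi> (K * b powr len g))) summable_on G)"
    using that approximated_null_parabolic WA_null by blast
  ultimately show ?thesis by blast
qed

end
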